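(* The Super Lifted Euler Characteristic Transform, which assigns to a definable function $f:\mathbb{R}^d\to\mathbb{R}$ with compact support the constructible function $\operatorname{SELECT}(f)\in\operatorname{CF}(S^{d-1}\times\mathbb{R}\times\mathbb{R})$ given by $$\operatorname{SELECT}(f)(v,h,t)=\chi\big(\{x\in\mathbb{R}^d\mid x\cdot v\le h,\ f(x)\ge t\}\big),$$ is injective: if $f,g:\mathbb{R}^d\to\mathbb{R}$ are definable functions with compact support and $\operatorname{SELECT}(f)=\operatorname{SELECT}(g)$, then $f=g$.
   Context: Fix an o-minimal structure $\mathcal{O}=\{\mathcal{O}_n\}_{n\ge 0}$: each $\mathcal{O}_n$ is a collection of subsets of $\mathbb{R}^n$ closed under intersection and complement; $A\in\mathcal{O}_n$ implies $A\times\mathbb{R},\ \mathbb{R}\times A\in\mathcal{O}_{n+1}$; $A\in\mathcal{O}_{n+1}$ implies $\pi(A)\in\mathcal{O}_n$ for axis-aligned projections $\pi:\mathbb{R}^{n+1}\to\mathbb{R}^n$; $\mathcal{O}$ contains all semialgebraic sets; and $\mathcal{O}_1$ contains only finite unions of points and open intervals. Elements of $\mathcal{O}$ are called definable sets. A function between definable sets is definable if its graph is a definable set. Any definable set $X$ admits a definable bijection with a subcollection of open simplices $\sigma_i$ of the geometric realization of a finite Euclidean simplicial complex; the (combinatorial) Euler characteristic is $\chi(X)=\sum_i(-1)^{\dim\sigma_i}$, with $\chi(\varnothing)=0$. This is well defined. $\operatorname{CF}(X)$ denotes the set of constructible functions on a definable set $X$: functions $X\to\mathbb{Z}$ all of whose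 level sets are definable and only finitely many of whose level sets are non-empty. $S^{d-1}$ is the unit sphere in $\mathbb{R}^d$. *)

theory Defs
  imports "HOL-Analysis.Analysis"
begin

text \<open>
  Since the dimension has to vary, \<open>\<real>\<^sup>n\<close> is the library's space \<^const>\<open>Euclidean_space\<close> \<open>n\<close>: the
  sequences \<^typ>\<open>nat \<Rightarrow> real\<close> that vanish from index \<open>n\<close> on.  As \<open>\<real>\<^sup>m \<subseteq> \<real>\<^sup>n\<close> for \<open>m \<le> n\<close> in this
  encoding, the ambient dimension of a set is always passed explicitly.
\<close>

abbreviation RR :: "nat \<Rightarrow> (nat \<Rightarrow> real) set" where
  "RR n \<equiv> topspace (Euclidean_space n)"

text \<open>The identification of \<open>\<real>\<^sup>m \<times> \<real>\<^sup>n\<close> with \<open>\<real>\<^sup>m\<^sup>+\<^sup>n\<close>, and of \<open>\<real>\<close> with \<open>\<real>\<^sup>1\<close>.\<close>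

definition cat :: "nat \<Rightarrow> (nat \<Rightarrow> real) \<Rightarrow> (nat \<Rightarrow> real) \<Rightarrow> (nat \<Rightarrow> real)" where
  "cat m x y = (\<lambda>i. if i < m then x i else y (i - m))"

definition prodR :: "nat \<Rightarrow> (nat \<Rightarrow> real) set \<Rightarrow> (nat \<Rightarrow> real) set \<Rightarrow> (nat \<Rightarrow> real) set" where
  "prodR m A B = {cat m x y | x y. x \<in> A \<and> y \<in> B}"

definition pt :: "real \<Rightarrow> (nat \<Rightarrow> real)" where
  "pt a = (\<lambda>i. if i = 0 then a else 0)"

text \<open>The axis-aligned projection forgetting the coordinate \<open>j\<close>.\<close>

definition proj :: "nat \<Rightarrow> (nat \<Rightarrow> real) \<Rightarrow> (nat \<Rightarrow> real)" where
  "proj j x = (\<lambda>i. if i < j then x i else x (Suc i))"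


subsection \<open>O-minimal structures\<close>

inductive polynomial_fun :: "nat \<Rightarrow> ((nat \<Rightarrow> real) \<Rightarrow> real) \<Rightarrow> bool" for n where
  const: "polynomial_fun n (\<lambda>x. c)"
| coord: "i < n \<Longrightarrow> polynomial_fun n (\<lambda>x. x i)"
| add: "polynomial_fun n p \<Longrightarrow> polynomial_fun n q \<Longrightarrow> polynomial_fun n (\<lambda>x. p x + q x)"
| mult: "polynomial_fun n p \<Longrightarrow> polynomial_fun n q \<Longrightarrow> polynomial_fun n (\<lambda>x. p x * q x)"

inductive semialgebraic :: "nat \<Rightarrow> (nat \<Rightarrow> real) set \<Rightarrow> bool" for n where
  zero: "polynomial_fun n p \<Longrightarrow> semialgebraic n {x \<in> RR n. p x = 0}"
| pos: "polynomial_fun n p \<Longrightarrow> semialgebraic n {x \<in> RR n. p x > 0}"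
| inter: "semialgebraic n A \<Longrightarrow> semialgebraic n B \<Longrightarrow> semialgebraic n (A \<inter> B)"
| compl: "semialgebraic n A \<Longrightarrow> semialgebraic n (RR n - A)"

locale o_minimal_structure =
  fixes \<O> :: "nat \<Rightarrow> (nat \<Rightarrow> real) set set"
  assumes subset: "A \<in> \<O> n \<Longrightarrow> A \<subseteq> RR n"
    and inter: "A \<in> \<O> n \<Longrightarrow> B \<in> \<O> n \<Longrightarrow> A \<inter> B \<in> \<O> n"
    and compl: "A \<in> \<O> n \<Longrightarrow> RR n - A \<in> \<O> n"
    and times_R: "A \<in> \<O> n \<Longrightarrow> prodR n A (RR 1) \<in> \<O> (Suc n)"
    and R_times: "A \<in> \<O> n \<Longrightarrow> prodR 1 (RR 1) A \<in> \<O> (Suc n)"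
    and proj: "A \<in> \<O> (Suc n) \<Longrightarrow> j \<le> n \<Longrightarrow> proj j ` A \<in> \<O> n"
    and semialg: "semialgebraic n A \<Longrightarrow> A \<in> \<O> n"
    and o_min: "A \<in> \<O> 1 \<Longrightarrow>
      \<exists>\<I>. finite \<I> \<and> (\<forall>I\<in>\<I>. (\<exists>a. I = {a}) \<or> (open I \<and> is_interval I)) \<and> A = pt ` \<Union>\<I>"

definition definable_map ::
  "(nat \<Rightarrow> (nat \<Rightarrow> real) set set) \<Rightarrow> nat \<Rightarrow> (nat \<Rightarrow> real) set \<Rightarrow> nat \<Rightarrow> (nat \<Rightarrow> real) set
    \<Rightarrow> ((nat \<Rightarrow> real) \<Rightarrow> (nat \<Rightarrow> real)) \<Rightarrow> bool" where
  "definable_map \<O> m X n Y \<phi> \<longleftrightarrow>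
     X \<in> \<O> m \<and> Y \<in> \<O> n \<and> \<phi> \<in> X \<rightarrow> Y \<and> {cat m x (\<phi> x) | x. x \<in> X} \<in> \<O> (m + n)"


subsection \<open>Euler characteristic\<close>

text \<open>
  A simplex is given by its finite, nonempty, affinely independent set of vertices.  (The library's
  \<open>affine_dependent\<close> and \<open>simplicial_complex\<close> need a vector space type, which
  \<^typ>\<open>nat \<Rightarrow> real\<close> is not.)
\<close>

definition affinely_independent :: "(nat \<Rightarrow> real) set \<Rightarrow> bool" where
  "affinely_independent V \<longleftrightarrow>
     (\<forall>c. (\<Sum>v\<in>V. c v) = 0 \<and> (\<forall>i. (\<Sum>v\<in>V. c v * v i) = 0) \<longrightarrow> (\<forall>v\<in>V. c v = 0))"

definition closed_simplex :: "(nat \<Rightarrow> real) set \<Rightarrow> (nat \<Rightarrow> real) set" where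
  "closed_simplex V =
     {(\<lambda>i. \<Sum>v\<in>V. c v * v i) | c. (\<forall>v\<in>V. c v \<ge> 0) \<and> (\<Sum>v\<in>V. c v) = (1::real)}"

definition open_simplex :: "(nat \<Rightarrow> real) set \<Rightarrow> (nat \<Rightarrow> real) set" where
  "open_simplex V =
     {(\<lambda>i. \<Sum>v\<in>V. c v * v i) | c. (\<forall>v\<in>V. c v > 0) \<and> (\<Sum>v\<in>V. c v) = (1::real)}"

text \<open>The last condition uses \<open>closed_simplex {} = {}\<close> for simplices without a common vertex.\<close>

definition euclidean_complex :: "nat \<Rightarrow> (nat \<Rightarrow> real) set set \<Rightarrow> bool" where
  "euclidean_complex N K \<longleftrightarrow>
     finite K \<and>
     (\<forall>V\<in>K. finite V \<and> V \<noteq> {} \<and> V \<subseteq> RR N \<and> affinely_independent V) \<and>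
     (\<forall>V\<in>K. \<forall>W. W \<subseteq> V \<and> W \<noteq> {} \<longrightarrow> W \<in> K) \<and>
     (\<forall>V\<in>K. \<forall>W\<in>K. closed_simplex V \<inter> closed_simplex W = closed_simplex (V \<inter> W))"

text \<open>
  \<open>k\<close> is the alternating sum over the open simplices (those in \<open>T\<close>) of some definable bijection
  onto a union of open simplices of a complex; the dimension of \<open>V\<close> is \<open>card V - 1\<close>.
\<close>

definition has_euler_char ::
  "(nat \<Rightarrow> (nat \<Rightarrow> real) set set) \<Rightarrow> nat \<Rightarrow> (nat \<Rightarrow> real) set \<Rightarrow> int \<Rightarrow> bool" where
  "has_euler_char \<O> n X k \<longleftrightarrow>
     (\<exists>N K T \<phi>. euclidean_complex N K \<and> T \<subseteq> K \<and>
        definable_map \<O> n X N (\<Union>V\<in>T. open_simplex V) \<phi> \<and>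
        bij_betw \<phi> X (\<Union>V\<in>T. open_simplex V) \<and>
        k = (\<Sum>V\<in>T. (- 1) ^ (card V - 1)))"

definition euler_char ::
  "(nat \<Rightarrow> (nat \<Rightarrow> real) set set) \<Rightarrow> nat \<Rightarrow> (nat \<Rightarrow> real) set \<Rightarrow> int" where
  "euler_char \<O> n X = (THE k. has_euler_char \<O> n X k)"

definition CF ::
  "(nat \<Rightarrow> (nat \<Rightarrow> real) set set) \<Rightarrow> nat \<Rightarrow> (nat \<Rightarrow> real) set \<Rightarrow> ((nat \<Rightarrow> real) \<Rightarrow> int) set" where
  "CF \<O> n X = {F \<in> X \<rightarrow>\<^sub>E UNIV.
     (\<forall>k. {x \<in> X. F x = k} \<in> \<O> n) \<and> finite {k. {x \<in> X. F x = k} \<noteq> {}}}"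


subsection \<open>The transform\<close>

text \<open>Functions \<open>\<real>\<^sup>d \<rightarrow> \<real>\<close> are extensional, so that equality in HOL is equality on \<open>\<real>\<^sup>d\<close>.\<close>

definition definable_compact_support ::
  "(nat \<Rightarrow> (nat \<Rightarrow> real) set set) \<Rightarrow> nat \<Rightarrow> ((nat \<Rightarrow> real) \<Rightarrow> real) set" where
  "definable_compact_support \<O> d = {f \<in> RR d \<rightarrow>\<^sub>E UNIV.
     definable_map \<O> d (RR d) 1 (RR 1) (\<lambda>x. pt (f x)) \<and>
     compactin (Euclidean_space d) (Euclidean_space d closure_of {x \<in> RR d. f x \<noteq> 0})}"

text \<open>
  \<open>S\<^sup>d\<^sup>-\<^sup>1 \<times> \<real> \<times> \<real>\<close> inside \<open>\<real>\<^sup>d\<^sup>+\<^sup>2\<close>, for \<open>d \<ge> 1\<close>.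
\<close>

definition select_domain :: "nat \<Rightarrow> (nat \<Rightarrow> real) set" where
  "select_domain d = prodR d (topspace (nsphere (d - 1))) (prodR 1 (RR 1) (RR 1))"

text \<open>
  A point \<open>(v, h, t)\<close> of this domain is a sequence \<open>p\<close> with \<open>v\<close> in the positions below \<open>d\<close>,
  \<open>h = p d\<close> and \<open>t = p (d + 1)\<close>.
\<close>

definition SELECT ::
  "(nat \<Rightarrow> (nat \<Rightarrow> real) set set) \<Rightarrow> nat \<Rightarrow> ((nat \<Rightarrow> real) \<Rightarrow> real) \<Rightarrow> (nat \<Rightarrow> real) \<Rightarrow> int" where
  "SELECT \<O> d f = (\<lambda>p \<in> select_domain d.
     let v = (\<lambda>i. if i < d then p i else 0); h = p d; t = p (d + 1)
     in euler_char \<O> d {x \<in> RR d. (\<Sum>i<d. x i * v i) \<le> h \<and> f x \<ge> t})"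

end

theory Submission
  imports Defs
begin

text \<open>
  On definable sets the Euler characteristic is computed by integrating out one coordinate after the
  other; a function of one variable contributes its values at points minus its values on open
  intervals.  Invariance under definable bijections then reduces, via the graph, to interchanging two
  integrations in the plane, where piecewise monotonicity of definable functions gives it for regions
  above and below a graph.  Since the bijections need not be continuous, no cell decomposition with
  continuous cells is needed, only uniform finiteness; over the reals its proof and that of
  monotonicity are shortened by countability arguments.

  For injectivity, let \<open>A\<close> be a superlevel set of \<open>f\<close> for a positive level, or the complement of one
  for a level \<open>\<le> 0\<close>, so that \<open>A\<close> is bounded.  The transform determines \<open>\<chi>(A \<inter> H)\<close> for all hyperplanes
  \<open>H\<close>.  Integrating \<open>\<chi>(A \<inter> {x. (x - a) \<bullet> v = 0})\<close> over all \<open>v \<in> \<real>\<^sup>d\<close> and interchanging the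
  integrals gives \<open>(-1)\<^sup>d\<^sup>-\<^sup>1 (\<chi>(A) - 2 \<cdot> 1\<^sub>A(a))\<close>, hence whether \<open>a \<in> A\<close>.
\<close>

text \<open>\<open>euler_char\<close> is a definite description over definable bijections with
  unions of open simplices, so it carries no information until such a bijection exists and the
  alternating sum is shown not to depend on it. Existence comes from cutting a definable set into
  pieces in definable bijection with open orthants and laying these out as disjoint open faces of
  one standard simplex; independence holds because every admissible sum equals the iterated integral
  \<open>EI\<close>. All this needs many definability proofs, so definability is made syntactic:
  predicates live on infinite sequences but see finitely many coordinates, closure under
  connectives, quantifiers and substitution becomes a set of introduction rules, and analytic
  notions are first put in first-order form. Directions range over all of the space rather than the
  sphere because \<open>EI\<close> integrates coordinate by coordinate: a nonzero \<open>v\<close>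
  gives the hyperplane of its unit vector, and \<open>v = 0\<close> gives the Euler characteristic
  of \<open>A\<close> itself, which is read off from a half-space containing \<open>A\<close>. This
  is why \<open>A\<close> has to be bounded.\<close>

lemma RR_iff: "x \<in> RR n \<longleftrightarrow> (\<forall>i\<ge>n. x i = 0)"
  by (simp add: topspace_Euclidean_space)

text \<open>Coordinates act as de Bruijn indices: prepending frees index \<open>0\<close> for a
  bound variable or an integration variable and shifts the parameters up by one.\<close>

definition scons :: "real \<Rightarrow> (nat \<Rightarrow> real) \<Rightarrow> nat \<Rightarrow> real" (infixr "##" 65) where
  "t ## x = (\<lambda>i. case i of 0 \<Rightarrow> t | Suc j \<Rightarrow> x j)"

lemma scons_simps [simp]: "(t ## x) 0 = t" "(t ## x) (Suc i) = x i"
  by (simp_all add: scons_def)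

text \<open>Retraction of all sequences onto \<open>RR n\<close>; invariance under it says that only
  the first \<open>n\<close> coordinates matter.\<close>

definition cut :: "nat \<Rightarrow> (nat \<Rightarrow> real) \<Rightarrow> nat \<Rightarrow> real" where
  "cut n x = (\<lambda>i. if i < n then x i else 0)"

lemma cut_in_RR [simp]: "cut n x \<in> RR n"
  by (simp add: cut_def RR_iff)

lemma cut_id: "x \<in> RR n \<Longrightarrow> cut n x = x"
  by (auto simp: cut_def RR_iff)

lemma cut_cut: "m \<le> n \<Longrightarrow> cut m (cut n x) = cut m x"
  by (auto simp: cut_def)

lemma cut_cong: "(\<And>i. i < n \<Longrightarrow> x i = y i) \<Longrightarrow> cut n x = cut n y"
  by (auto simp: cut_def)

lemma scons_in_RR [simp]: "t ## x \<in> RR (Suc n) \<longleftrightarrow> x \<in> RR n"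
  by (auto simp: RR_iff scons_def split: nat.split)

lemma RR_last_zero: "x \<in> RR (Suc n) \<and> x n = 0 \<longleftrightarrow> x \<in> RR n"
  by (auto simp: RR_iff Suc_le_eq) (metis le_less)

lemma scons_tail: "x 0 ## (\<lambda>i. x (Suc i)) = x"
  by (auto simp: scons_def split: nat.split)

lemma cut_scons: "cut (Suc n) (t ## x) = t ## cut n x"
  by (auto simp: cut_def scons_def split: nat.split)

lemma RR_SucE:
  assumes "x \<in> RR (Suc n)"
  obtains t y where "x = t ## y" "y \<in> RR n"
proof -
  have "(\<lambda>i. x (Suc i)) \<in> RR n"
    using assms by (auto simp: RR_iff)
  then show ?thesis using that scons_tail[of x] by metis
qed

lemma RR_0: "RR 0 = {\<lambda>_. 0}"
  by (auto simp: RR_iff)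

lemma pt_eq: "pt a = a ## (\<lambda>_. 0)"
  by (auto simp: pt_def scons_def split: nat.split)

lemma RR_Suc_0: "RR (Suc 0) = range pt"
proof -
  have "x \<in> range pt" if "x \<in> RR (Suc 0)" for x
    by (rule RR_SucE[OF that]) (auto simp: RR_0 pt_eq)
  then show ?thesis by (auto simp: pt_eq RR_0)
qed

lemma polynomial_fun_cut: "polynomial_fun n p \<Longrightarrow> p (cut n x) = p x"
  by (induction rule: polynomial_fun.induct) (auto simp: cut_def)

context o_minimal_structure
begin

subsection \<open>Definable predicates on sequences\<close>

text \<open>The number of relevant coordinates is hidden behind the quantifier, so that predicates
  with different numbers of variables combine without arity bookkeeping.\<close>

definition dpred :: "((nat \<Rightarrow> real) \<Rightarrow> bool) \<Rightarrow> bool" where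
  "dpred P \<longleftrightarrow> (\<exists>n. {x \<in> RR n. P x} \<in> \<O> n \<and> (\<forall>x. P x = P (cut n x)))"

lemma lift_definable:
  assumes "{x \<in> RR n. P x} \<in> \<O> n" and loc: "\<And>x. P x = P (cut n x)"
  shows "{x \<in> RR (Suc n). P x} \<in> \<O> (Suc n)"
proof -
  have "prodR n {x \<in> RR n. P x} (RR 1) = {x \<in> RR (Suc n). P x}"
  proof (intro subset_antisym subsetI)
    fix z assume "z \<in> prodR n {x \<in> RR n. P x} (RR 1)"
    then obtain x y where z: "z = cat n x y" "x \<in> RR n" "P x" "y \<in> RR 1"
      by (auto simp: prodR_def)
    then have "cut n z = x" by (auto simp: cut_def cat_def RR_iff)
    with z loc[of z] show "z \<in> {x \<in> RR (Suc n). P x}"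
      by (auto simp: RR_iff cat_def)
  next
    fix z assume z: "z \<in> {x \<in> RR (Suc n). P x}"
    then have "z = cat n (cut n z) (pt (z n))"
      by (auto simp: fun_eq_iff cat_def cut_def pt_def RR_iff)
    moreover have "P (cut n z)" using z loc by auto
    ultimately show "z \<in> prodR n {x \<in> RR n. P x} (RR 1)"
      unfolding prodR_def
      by (intro CollectI exI[of _ "cut n z"] exI[of _ "pt (z n)"]) (auto simp: RR_Suc_0)
  qed
  with times_R[OF assms(1)] show ?thesis by simp
qed

lemma dpredE:
  assumes "dpred P"
  obtains n0 where "\<And>n. n \<ge> n0 \<Longrightarrow> {x \<in> RR n. P x} \<in> \<O> n"
    and "\<And>n x. n \<ge> n0 \<Longrightarrow> P (cut n x) = P x"
proof -
  obtain n0 where n0: "{x \<in> RR n0. P x} \<in> \<O> n0" "\<And>x. P x = P (cut n0 x)"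
    using assms dpred_def by auto
  have loc: "P (cut n x) = P x" if "n \<ge> n0" for n x
    using n0(2)[of x] n0(2)[of "cut n x"] cut_cut[OF that] by simp
  have "{x \<in> RR n. P x} \<in> \<O> n" if "n \<ge> n0" for n
    using that
  proof (induction rule: dec_induct)
    case (step n)
    then show ?case using lift_definable loc by blast
  qed (rule n0(1))
  then show ?thesis using that loc by blast
qed

lemma dpred_poly:
  assumes "polynomial_fun n p"
  shows "dpred (\<lambda>x. p x = 0)" "dpred (\<lambda>x. p x > 0)"
  unfolding dpred_def polynomial_fun_cut[OF assms] using assms
  by (auto intro!: exI[of _ n] semialg semialgebraic.intros simp: polynomial_fun_cut)

text \<open>Below the number of relevant coordinates one descends a dimension at a time:
  \<open>RR m\<close> is the slice \<open>x m = 0\<close> of \<open>RR (Suc m)\<close>, and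
  forgetting that zero coordinate changes nothing.\<close>

lemma dpred_in:
  assumes "dpred P"
  shows "{x \<in> RR n. P x} \<in> \<O> n"
proof -
  obtain n0 where n0: "\<And>n. n \<ge> n0 \<Longrightarrow> {x \<in> RR n. P x} \<in> \<O> n"
    using dpredE[OF assms] by metis
  have "{x \<in> RR n. P x} \<in> \<O> n" if "n \<le> max n n0" for n
    using that
  proof (induction rule: inc_induct)
    case base
    then show ?case using n0 by simp
  next
    case (step m)
    have "{x \<in> RR (Suc m). x m = 0} \<in> \<O> (Suc m)"
      by (intro semialg semialgebraic.zero polynomial_fun.coord) simp
    then have "proj m ` ({x \<in> RR (Suc m). P x} \<inter> {x \<in> RR (Suc m). x m = 0}) \<in> \<O> m"
      using step by (intro proj inter) auto
    also have "{x \<in> RR (Suc m). P x} \<inter> {x \<in> RR (Suc m). x m = 0} = {x \<in> RR m. P x}"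
      using RR_last_zero by blast
    also have "proj m ` {x \<in> RR m. P x} = {x \<in> RR m. P x}"
      by (rule image_cong[of _ _ _ "\<lambda>x. x", simplified]) (auto simp: proj_def RR_iff fun_eq_iff)
    finally show ?case .
  qed
  then show ?thesis by simp
qed

lemma dpred_set:
  assumes "A \<in> \<O> n"
  shows "dpred (\<lambda>x. cut n x \<in> A)"
proof -
  have "{x \<in> RR n. cut n x \<in> A} = A"
    using subset[OF assms] by (auto simp: cut_id)
  then show ?thesis
    using assms unfolding dpred_def by (intro exI[of _ n]) (auto simp: cut_cut)
qed

named_theorems dpred_intros

lemma dpred_not [dpred_intros]:
  assumes "dpred P"
  shows "dpred (\<lambda>x. \<not> P x)"
proof -
  obtain n where n: "{x \<in> RR n. P x} \<in> \<O> n" "\<And>x. P (cut n x) = P x"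
    using dpredE[OF assms] by (metis order_refl)
  have "{x \<in> RR n. \<not> P x} = RR n - {x \<in> RR n. P x}" by auto
  then show ?thesis
    unfolding dpred_def using compl[OF n(1)] n(2) by (intro exI[of _ n]) auto
qed

lemma dpred_conj [dpred_intros]:
  assumes "dpred P" "dpred Q"
  shows "dpred (\<lambda>x. P x \<and> Q x)"
proof -
  obtain m where m: "\<And>n. n \<ge> m \<Longrightarrow> {x \<in> RR n. P x} \<in> \<O> n" "\<And>n x. n \<ge> m \<Longrightarrow> P (cut n x) = P x"
    using dpredE[OF assms(1)] by blast
  obtain k where k: "\<And>n. n \<ge> k \<Longrightarrow> {x \<in> RR n. Q x} \<in> \<O> n" "\<And>n x. n \<ge> k \<Longrightarrow> Q (cut n x) = Q x"
    using dpredE[OF assms(2)] by blast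
  let ?n = "max m k"
  have "{x \<in> RR ?n. P x \<and> Q x} = {x \<in> RR ?n. P x} \<inter> {x \<in> RR ?n. Q x}" by auto
  then show ?thesis
    unfolding dpred_def using inter[OF m(1) k(1), of ?n] m(2) k(2) by (intro exI[of _ ?n]) auto
qed

lemma dpred_disj [dpred_intros]: "dpred P \<Longrightarrow> dpred Q \<Longrightarrow> dpred (\<lambda>x. P x \<or> Q x)"
  using dpred_not[OF dpred_conj[OF dpred_not dpred_not, of P Q]] by simp

lemma dpred_imp [dpred_intros]: "dpred P \<Longrightarrow> dpred Q \<Longrightarrow> dpred (\<lambda>x. P x \<longrightarrow> Q x)"
  unfolding imp_conv_disj by (intro dpred_disj dpred_not)

lemma dpred_iff [dpred_intros]: "dpred P \<Longrightarrow> dpred Q \<Longrightarrow> dpred (\<lambda>x. P x \<longleftrightarrow> Q x)"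
  unfolding iff_conv_conj_imp by (intro dpred_conj dpred_imp)

lemma dpred_const [dpred_intros]: "dpred (\<lambda>x. b)"
  using dpred_poly(1)[OF polynomial_fun.const[of _ "if b then 0 else 1"]] by (cases b) auto

text \<open>The bound variable becomes coordinate \<open>0\<close> and the parameters are shifted, so that the rule
  applies to any body without a freshness condition.\<close>

lemma dpred_ex [dpred_intros]:
  assumes "dpred (\<lambda>x. Q (\<lambda>i. x (Suc i)) (x 0))"
  shows "dpred (\<lambda>x. \<exists>t. Q x t)"
proof -
  obtain n0 where n0: "\<And>n. n \<ge> n0 \<Longrightarrow> {x \<in> RR n. Q (\<lambda>i. x (Suc i)) (x 0)} \<in> \<O> n"
    "\<And>n x. n \<ge> n0 \<Longrightarrow> Q (\<lambda>i. cut n x (Suc i)) (cut n x 0) = Q (\<lambda>i. x (Suc i)) (x 0)"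
    using dpredE[OF assms] by blast
  have "proj 0 ` {x \<in> RR (Suc n0). Q (\<lambda>i. x (Suc i)) (x 0)} = {x \<in> RR n0. \<exists>t. Q x t}"
  proof (intro subset_antisym subsetI)
    fix y assume "y \<in> {x \<in> RR n0. \<exists>t. Q x t}"
    then obtain t where "y \<in> RR n0" "Q y t" by auto
    then show "y \<in> proj 0 ` {x \<in> RR (Suc n0). Q (\<lambda>i. x (Suc i)) (x 0)}"
      by (intro image_eqI[of _ _ "t ## y"]) (auto simp: proj_def)
  qed (auto simp: proj_def RR_iff)
  moreover have "proj 0 ` {x \<in> RR (Suc n0). Q (\<lambda>i. x (Suc i)) (x 0)} \<in> \<O> n0"
    by (intro proj n0) auto
  moreover have "Q (cut n0 x) t = Q x t" for x t
    using n0(2)[of "Suc n0" "t ## x"] by (simp add: cut_scons)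
  ultimately show ?thesis
    unfolding dpred_def by (intro exI[of _ n0]) auto
qed

lemma dpred_all [dpred_intros]:
  "dpred (\<lambda>x. Q (\<lambda>i. x (Suc i)) (x 0)) \<Longrightarrow> dpred (\<lambda>x. \<forall>t. Q x t)"
  using dpred_not[OF dpred_ex[of "\<lambda>x t. \<not> Q x t", OF dpred_not]] by simp

lemma dpred_fin_all [dpred_intros]:
  assumes "finite I" "\<And>i. i \<in> I \<Longrightarrow> dpred (P i)"
  shows "dpred (\<lambda>x. \<forall>i\<in>I. P i x)"
  using assms by (induction I) (auto intro: dpred_intros)

lemma dpred_fin_ex [dpred_intros]:
  assumes "finite I" "\<And>i. i \<in> I \<Longrightarrow> dpred (P i)"
  shows "dpred (\<lambda>x. \<exists>i\<in>I. P i x)"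
  using assms by (induction I) (auto intro: dpred_intros)

lemma dpred_coords:
  "dpred (\<lambda>s. s i = s j)" "dpred (\<lambda>s. s i = c)" "dpred (\<lambda>s. s i < s j)"
  "dpred (\<lambda>s. s i = s j + s k)" "dpred (\<lambda>s. s i = s j * s k)"
proof -
  let ?n = "Suc (max i (max j k))"
  have p: "polynomial_fun ?n (\<lambda>x. x i)" "polynomial_fun ?n (\<lambda>x. x j)" "polynomial_fun ?n (\<lambda>x. x k)"
    by (auto intro: polynomial_fun.coord)
  note pi = polynomial_fun.add polynomial_fun.mult polynomial_fun.const p
  have "polynomial_fun ?n (\<lambda>x. x i + (-1) * x j)" "polynomial_fun ?n (\<lambda>x. x i + (-c))"
    "polynomial_fun ?n (\<lambda>x. x j + (-1) * x i)" "polynomial_fun ?n (\<lambda>x. x i + (-1) * (x j + x k))"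
    "polynomial_fun ?n (\<lambda>x. x i + (-1) * (x j * x k))"
    by (intro pi)+
  note this[THEN dpred_poly(1)] this[THEN dpred_poly(2)]
  then show "dpred (\<lambda>s. s i = s j)" "dpred (\<lambda>s. s i = c)" "dpred (\<lambda>s. s i < s j)"
    "dpred (\<lambda>s. s i = s j + s k)" "dpred (\<lambda>s. s i = s j * s k)"
    by (simp_all add: algebra_simps)
qed

subsection \<open>Definable functions and substitution\<close>

text \<open>The value sits in coordinate \<open>0\<close>, where \<open>dpred_ex\<close> binds;
  substituting a function is then one existential quantification over its value.\<close>

definition dfun :: "((nat \<Rightarrow> real) \<Rightarrow> real) \<Rightarrow> bool" where
  "dfun e \<longleftrightarrow> dpred (\<lambda>s. s 0 = e (\<lambda>i. s (Suc i)))"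

text \<open>Entries are substituted one at a time, and \<open>n\<close> steps suffice because
  \<open>P\<close> sees finitely many coordinates. The remaining entries are stacked in front of the
  original sequence, which stays readable from position \<open>k\<close> on; hence the shifted
  argument of \<open>e i\<close> in \<open>step\<close>.\<close>

lemma dpred_app:
  assumes "dpred P"
    and step: "\<And>Q k i. dpred Q \<Longrightarrow> dpred (\<lambda>y. Q (e i (\<lambda>j. y (k + j)) ## y))"
  shows "dpred (\<lambda>x. P (\<lambda>i. e i x))"
proof -
  define app :: "nat \<Rightarrow> (nat \<Rightarrow> real) \<Rightarrow> (nat \<Rightarrow> real) \<Rightarrow> (nat \<Rightarrow> real)"
    where "app k t x = (\<lambda>i. if i < k then t i else x (i - k))" for k t x
  have app_tail: "app k t x (k + j) = x j" for k t x j
    by (auto simp: app_def)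
  have app_Suc: "app (Suc k) t x = t 0 ## app k (\<lambda>i. t (Suc i)) x" for k t x
    by (auto simp: app_def fun_eq_iff scons_def split: nat.split)
  have *: "dpred Q \<Longrightarrow> dpred (\<lambda>x. Q (app k (\<lambda>i. e (m + i) x) x))" for Q k m
  proof (induction k arbitrary: Q m)
    case 0
    then show ?case by (simp add: app_def)
  next
    case (Suc k)
    have "dpred (\<lambda>y. Q (e m (\<lambda>j. y (k + j)) ## y))"
      using step Suc.prems by blast
    from Suc.IH[OF this, of "Suc m"] show ?case
      by (simp add: app_Suc app_tail)
  qed
  obtain n where n: "\<And>x. P (cut n x) = P x" using dpredE[OF assms(1)] by (metis order_refl)
  have "P (app n (\<lambda>i. e (0 + i) x) x) = P (\<lambda>i. e i x)" for x
    using n[of "app n (\<lambda>i. e i x) x"] n[of "\<lambda>i. e i x"]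
      cut_cong[of n "app n (\<lambda>i. e i x) x" "\<lambda>i. e i x"] by (simp add: app_def)
  with *[OF assms(1), of n 0] show ?thesis by simp
qed

text \<open>Copying coordinates needs only the equality of two coordinates. It comes first because
  the general substitution has to reindex the functions that it substitutes.\<close>

lemma dpred_reindex:
  assumes "dpred P"
  shows "dpred (\<lambda>x. P (\<lambda>i. x (\<sigma> i)))"
proof (rule dpred_app[OF assms, of "\<lambda>i x. x (\<sigma> i)"])
  fix Q k i assume Q: "dpred Q"
  have "dpred (\<lambda>y. \<exists>t. t = y (k + \<sigma> i) \<and> Q (t ## y))"
    by (intro dpred_intros) (simp_all add: scons_tail dpred_coords Q)
  then show "dpred (\<lambda>y. Q (y (k + \<sigma> i) ## y))" by simp
qed

lemma dfun_reindex: "dfun e \<Longrightarrow> dfun (\<lambda>x. e (\<lambda>i. x (\<sigma> i)))"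
  unfolding dfun_def
  by (drule dpred_reindex[of _ "\<lambda>i. case i of 0 \<Rightarrow> 0 | Suc j \<Rightarrow> Suc (\<sigma> j)"]) simp

lemma dpred_subst:
  assumes "dpred P" and "\<And>i. dfun (e i)"
  shows "dpred (\<lambda>x. P (\<lambda>i. e i x))"
proof (rule dpred_app[OF assms(1)])
  fix Q k i assume Q: "dpred Q"
  have "dfun (\<lambda>y. e i (\<lambda>j. y (k + j)))" using assms(2) by (rule dfun_reindex)
  then have "dpred (\<lambda>y. \<exists>t. t = e i (\<lambda>j. y (k + j)) \<and> Q (t ## y))"
    by (intro dpred_intros) (simp_all add: scons_tail dfun_def Q)
  then show "dpred (\<lambda>y. Q (e i (\<lambda>j. y (k + j)) ## y))" by simp
qed

lemma dfun_var [dpred_intros]: "dfun (\<lambda>x. x i)"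
  by (simp add: dfun_def dpred_coords)

lemma dfun_const [dpred_intros]: "dfun (\<lambda>x. c)"
  by (simp add: dfun_def dpred_coords)

lemma dpred_subst2:
  assumes "dpred (\<lambda>s. R (s 0) (s 1))" "dfun e1" "dfun e2"
  shows "dpred (\<lambda>x. R (e1 x) (e2 x))"
  using dpred_subst[OF assms(1), of "\<lambda>i. if i = 0 then e1 else e2"] assms by simp

lemma dpred_eq [dpred_intros]: "dfun e1 \<Longrightarrow> dfun e2 \<Longrightarrow> dpred (\<lambda>x. e1 x = e2 x)"
  by (rule dpred_subst2) (rule dpred_coords)

lemma dpred_less [dpred_intros]: "dfun e1 \<Longrightarrow> dfun e2 \<Longrightarrow> dpred (\<lambda>x. e1 x < e2 x)"
  by (rule dpred_subst2) (rule dpred_coords)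

lemma dpred_le [dpred_intros]: "dfun e1 \<Longrightarrow> dfun e2 \<Longrightarrow> dpred (\<lambda>x. e1 x \<le> e2 x)"
  unfolding less_eq_real_def by (intro dpred_intros)

lemma dfun_subst:
  assumes "dfun f" and "\<And>i. dfun (e i)"
  shows "dfun (\<lambda>x. f (\<lambda>i. e i x))"
proof -
  let ?e = "\<lambda>i s. case i of 0 \<Rightarrow> s 0 | Suc j \<Rightarrow> e j (\<lambda>i. s (Suc i))"
  have "dfun (?e i)" for i
    by (cases i) (auto intro: dfun_reindex assms dfun_var)
  from dpred_subst[OF assms(1)[unfolded dfun_def], of ?e, OF this] show ?thesis
    by (simp add: dfun_def)
qed

lemma dfun_add [dpred_intros]:
  assumes "dfun e1" "dfun e2"
  shows "dfun (\<lambda>x. e1 x + e2 x)"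
proof -
  have "dfun (\<lambda>x. x 0 + x 1)" by (simp add: dfun_def dpred_coords)
  from dfun_subst[OF this, of "\<lambda>i. if i = 0 then e1 else e2"] assms show ?thesis by simp
qed

lemma dfun_mult [dpred_intros]:
  assumes "dfun e1" "dfun e2"
  shows "dfun (\<lambda>x. e1 x * e2 x)"
proof -
  have "dfun (\<lambda>x. x 0 * x 1)" by (simp add: dfun_def dpred_coords)
  from dfun_subst[OF this, of "\<lambda>i. if i = 0 then e1 else e2"] assms show ?thesis by simp
qed

lemma dfun_minus [dpred_intros]: "dfun e \<Longrightarrow> dfun (\<lambda>x. - e x)"
  using dfun_mult[OF dfun_const[of "-1"]] by simp

lemma dfun_diff [dpred_intros]: "dfun e1 \<Longrightarrow> dfun e2 \<Longrightarrow> dfun (\<lambda>x. e1 x - e2 x)"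
  using dfun_add[OF _ dfun_minus, of e1 e2] by simp

lemma dfunI:
  assumes "dpred (\<lambda>s. R (\<lambda>i. s (Suc i)) (s 0))" and "\<And>x y. R x y \<longleftrightarrow> y = e x"
  shows "dfun e"
  using assms by (simp add: dfun_def)

lemma dfun_if [dpred_intros]:
  assumes "dpred P" "dfun e1" "dfun e2"
  shows "dfun (\<lambda>x. if P x then e1 x else e2 x)"
proof (rule dfunI[where R = "\<lambda>x y. (P x \<and> y = e1 x) \<or> (\<not> P x \<and> y = e2 x)"])
  show "dpred (\<lambda>s. (P (\<lambda>i. s (Suc i)) \<and> s 0 = e1 (\<lambda>i. s (Suc i))) \<or>
      (\<not> P (\<lambda>i. s (Suc i)) \<and> s 0 = e2 (\<lambda>i. s (Suc i))))"
    by (intro dpred_intros dpred_reindex[OF assms(1)] assms(2,3)[THEN dfun_reindex])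
qed auto

lemma dfun_abs [dpred_intros]: "dfun e \<Longrightarrow> dfun (\<lambda>x. \<bar>e x\<bar>)"
  unfolding abs_if by (intro dpred_intros)

lemma dfun_divide [dpred_intros]:
  assumes "dfun e1" "dfun e2"
  shows "dfun (\<lambda>x. e1 x / e2 x)"
proof (rule dfunI[where R = "\<lambda>x y. if e2 x = 0 then y = 0 else y * e2 x = e1 x"])
  have "dpred (\<lambda>s. (e2 (\<lambda>i. s (Suc i)) = 0 \<longrightarrow> s 0 = 0) \<and>
      (e2 (\<lambda>i. s (Suc i)) \<noteq> 0 \<longrightarrow> s 0 * e2 (\<lambda>i. s (Suc i)) = e1 (\<lambda>i. s (Suc i))))"
    by (intro dpred_intros assms[THEN dfun_reindex])
  then show "dpred (\<lambda>s. if e2 (\<lambda>i. s (Suc i)) = 0 then s 0 = 0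
      else s 0 * e2 (\<lambda>i. s (Suc i)) = e1 (\<lambda>i. s (Suc i)))"
    by (rule back_subst[of dpred]) auto
qed (auto simp: field_simps)

lemma dfun_sum [dpred_intros]:
  assumes "finite I" "\<And>i. i \<in> I \<Longrightarrow> dfun (e i)"
  shows "dfun (\<lambda>x. \<Sum>i\<in>I. e i x)"
  using assms by (induction I) (auto intro: dpred_intros)

text \<open>Definability entry by entry is enough for substitution, because a predicate sees
  finitely many entries.\<close>

definition dseq :: "((nat \<Rightarrow> real) \<Rightarrow> nat \<Rightarrow> real) \<Rightarrow> bool" where
  "dseq w \<longleftrightarrow> (\<forall>i. dfun (\<lambda>x. w x i))"

lemma dseq_id [dpred_intros]: "dseq (\<lambda>x. x)"
  by (simp add: dseq_def dpred_intros)

lemma dseq_lambda [dpred_intros]: "(\<And>i. dfun (\<lambda>x. w x i)) \<Longrightarrow> dseq (\<lambda>x i. w x i)"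
  by (simp add: dseq_def)

lemma dseq_nth: "dseq w \<Longrightarrow> dfun (\<lambda>x. w x i)"
  by (simp add: dseq_def)

lemma dseq_scons [dpred_intros]: "dfun e \<Longrightarrow> dseq w \<Longrightarrow> dseq (\<lambda>x. e x ## w x)"
  unfolding dseq_def by (rule allI, case_tac i) auto

lemma dseq_const [dpred_intros]: "dseq (\<lambda>x. c)"
  by (simp add: dseq_def dpred_intros)

lemma dseq_cut [dpred_intros]: "dseq w \<Longrightarrow> dseq (\<lambda>x. cut n (w x))"
  unfolding dseq_def cut_def by (auto intro: dpred_intros)

lemma dpred_comp: "dpred P \<Longrightarrow> dseq w \<Longrightarrow> dpred (\<lambda>x. P (w x))"
  using dpred_subst[of P "\<lambda>i x. w x i"] by (simp add: dseq_def)

lemma dfun_comp: "dfun f \<Longrightarrow> dseq w \<Longrightarrow> dfun (\<lambda>x. f (w x))"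
  using dfun_subst[of f "\<lambda>i x. w x i"] by (simp add: dseq_def)

lemma dseq_comp:
  assumes "dseq f" "dseq w"
  shows "dseq (\<lambda>x. f (w x))"
  unfolding dseq_def using dfun_comp[OF dseq_nth[OF assms(1)] assms(2)] by blast

text \<open>A predicate of one real variable with parameters, coded on \<open>t ## z\<close>, so
  that the fibre \<open>R z\<close> is available as a set of reals.\<close>

definition dfam :: "((nat \<Rightarrow> real) \<Rightarrow> real \<Rightarrow> bool) \<Rightarrow> bool" where
  "dfam R \<longleftrightarrow> dpred (\<lambda>s. R (\<lambda>i. s (Suc i)) (s 0))"

lemma dfamD: "dfam R \<Longrightarrow> dseq w \<Longrightarrow> dfun e \<Longrightarrow> dpred (\<lambda>x. R (w x) (e x))"
  unfolding dfam_def
  using dpred_comp[of "\<lambda>s. R (\<lambda>i. s (Suc i)) (s 0)" "\<lambda>x. e x ## w x"]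
  by (simp add: dseq_scons)

lemma dfam_ex: "dfam R \<Longrightarrow> dpred (\<lambda>x. \<exists>t. R x t)"
  unfolding dfam_def by (rule dpred_ex)

end

subsection \<open>Break points of functions of one real variable\<close>

text \<open>The points at which \<open>g\<close> is not locally constant. Unlike a list of pieces,
  this set is given by a first-order condition, so the break points of a constructible family form a
  definable family (\<open>dfam_brk\<close>).\<close>

definition brk :: "(real \<Rightarrow> 'a) \<Rightarrow> real set" where
  "brk g = {x. \<forall>e>0. \<exists>s. \<bar>s - x\<bar> < e \<and> g s \<noteq> g x}"

definition tame :: "(real \<Rightarrow> 'a) \<Rightarrow> bool" where
  "tame g \<longleftrightarrow> finite (brk g)"

lemma not_brk_iff: "x \<notin> brk g \<longleftrightarrow> (\<exists>e>0. \<forall>s. \<bar>s - x\<bar> < e \<longrightarrow> g s = g x)"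
  unfolding brk_def by blast

lemma not_brkD:
  assumes "x \<notin> brk g"
  obtains e where "e > 0" "\<And>s. \<bar>s - x\<bar> < e \<Longrightarrow> g s = g x"
  using assms by (auto simp: brk_def)

text \<open>Local constancy spreads over a compact interval by bisection.\<close>

lemma brk_const:
  assumes "x \<le> y" "{x..y} \<inter> brk g = {}"
  shows "g x = g y"
  using assms(1)
proof (induction rule: Bolzano)
  case (local z)
  then have "z \<notin> brk g" using assms by auto
  then obtain e where e: "e > 0" "\<And>s. \<bar>s - z\<bar> < e \<Longrightarrow> g s = g z" by (metis not_brkD)
  show ?case
  proof (intro exI[of _ e] conjI allI impI e(1))
    fix a b assume "a \<le> z \<and> z \<le> b \<and> b - a < e"
    then show "g a = g b" using e(2)[of a] e(2)[of b] by auto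
  qed
qed auto

lemma brk_map: "brk (\<lambda>t. h (g t)) \<subseteq> brk g"
  unfolding brk_def by (smt (verit, best) Collect_mono)

lemma brk_map2: "brk (\<lambda>t. h (f t) (g t)) \<subseteq> brk f \<union> brk g"
proof
  fix x assume x: "x \<in> brk (\<lambda>t. h (f t) (g t))"
  show "x \<in> brk f \<union> brk g"
  proof (rule ccontr)
    assume "x \<notin> brk f \<union> brk g"
    then obtain d e where "d > 0" "\<And>s. \<bar>s - x\<bar> < d \<Longrightarrow> f s = f x"
      "e > 0" "\<And>s. \<bar>s - x\<bar> < e \<Longrightarrow> g s = g x"
      by (metis UnCI not_brkD)
    moreover from this have "min d e > 0" by simp
    with x obtain s where "\<bar>s - x\<bar> < min d e" "h (f s) (g s) \<noteq> h (f x) (g x)"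
      unfolding brk_def by blast
    ultimately show False by (metis min_less_iff_conj)
  qed
qed

lemma tame_map: "tame g \<Longrightarrow> tame (\<lambda>t. h (g t))"
  unfolding tame_def by (rule finite_subset[OF brk_map])

lemma tame_map2: "tame f \<Longrightarrow> tame g \<Longrightarrow> tame (\<lambda>t. h (f t) (g t))"
  unfolding tame_def by (rule finite_subset[OF brk_map2]) simp

lemma tame_subset:
  assumes "finite F" "\<And>x. x \<notin> F \<Longrightarrow> \<exists>e>0. \<forall>s. \<bar>s - x\<bar> < e \<longrightarrow> g s = g x"
  shows "tame g"
proof -
  have "brk g \<subseteq> F" using assms(2) unfolding brk_def by blast
  with assms(1) show ?thesis unfolding tame_def by (rule finite_subset[rotated])
qed

lemma tame_const: "tame (\<lambda>t. c)"
  by (rule tame_subset[of "{}"]) (auto intro: exI[of _ 1])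

lemma tame_point: "tame (\<lambda>t. t = (a::real))"
  by (rule tame_subset[of "{a}"]) (auto intro!: exI[of _ "\<bar>_ - a\<bar>"])

lemma tame_ray: "tame (\<lambda>t. t < (a::real))"
  by (rule tame_subset[of "{a}"]) (auto intro!: exI[of _ "\<bar>_ - a\<bar>"])

lemma tame_le: "tame (\<lambda>t. t \<le> (a::real))"
  using tame_map2[OF tame_ray tame_point, of "(\<or>)" a a] by (simp add: le_less)

lemma tame_interval:
  fixes I :: "real set"
  assumes "is_interval I"
  shows "tame (\<lambda>t. t \<in> I)"
proof -
  have ge: "tame (\<lambda>t. a \<le> t)" "tame (\<lambda>t. a < t)" for a :: real
    using tame_map[OF tame_ray, of Not] tame_map[OF tame_le, of Not] by (simp_all add: not_less not_le)
  have "\<exists>a b. I \<in> {{}, UNIV, {..<b}, {..b}, {a<..}, {a..}, {a<..<b}, {a<..b}, {a..<b}, {a..b}}"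
    using assms interval_cases[of I] unfolding is_interval_1 by (smt (verit, ccfv_threshold) insertCI)
  then show ?thesis
    by (auto simp: tame_const tame_ray tame_le ge intro!: tame_map2[where h = "(\<and>)"])
qed

lemma tame_Union:
  fixes \<I> :: "real set set"
  assumes "finite \<I>" "\<And>I. I \<in> \<I> \<Longrightarrow> tame (\<lambda>t. t \<in> I)"
  shows "tame (\<lambda>t. t \<in> \<Union>\<I>)"
  using assms
proof (induction \<I>)
  case empty
  then show ?case by (simp add: tame_const)
next
  case (insert I \<I>)
  then show ?case using tame_map2[of "\<lambda>t. t \<in> I" "\<lambda>t. t \<in> \<Union>\<I>" "(\<or>)"] by simp
qed

text \<open>An infinite set escapes the finitely many break points, and a point off them carries a
  whole neighbourhood. This turns infinitely many instances of a definable condition into an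
  interval of them.\<close>

lemma tame_contains_interval:
  assumes "tame P" "infinite {t. a < t \<and> t < b \<and> P t}"
  shows "\<exists>c d. a \<le> c \<and> c < d \<and> d \<le> b \<and> (\<forall>t. c < t \<and> t < d \<longrightarrow> P t)"
proof -
  obtain t where t: "a < t" "t < b" "P t" "t \<notin> brk P"
    using assms unfolding tame_def by (metis (mono_tags, lifting) finite_subset mem_Collect_eq subsetI)
  then obtain e where e: "e > 0" "\<And>s. \<bar>s - t\<bar> < e \<Longrightarrow> P s = P t" by (metis not_brkD)
  have "\<forall>s. max a (t - e) < s \<and> s < min b (t + e) \<longrightarrow> P s"
  proof (intro allI impI)
    fix s assume "max a (t - e) < s \<and> s < min b (t + e)"
    then show "P s" using e(2)[of s] t(3) by auto
  qed
  moreover have "a \<le> max a (t - e)" "max a (t - e) < min b (t + e)" "min b (t + e) \<le> b"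
    using t e(1) by auto
  ultimately show ?thesis by blast
qed

lemma finite_gap_right:
  fixes F :: "real set"
  assumes "finite F"
  obtains q where "q > p" "{p<..<q} \<inter> F = {}"
proof -
  let ?G = "insert (p + 1) {t \<in> F. p < t}"
  have "Min ?G \<le> t" if "t \<in> F" "p < t" for t
    using assms that by (intro Min_le) auto
  moreover have "p < Min ?G" using assms by (subst Min_gr_iff) auto
  ultimately show ?thesis
    by (intro that[of "Min ?G"]) (force simp del: Min_insert)+
qed

lemma tame_right_germ:
  assumes "tame g"
  obtains v q where "q > p" "\<And>s. p < s \<Longrightarrow> s < q \<Longrightarrow> g s = v"
proof -
  obtain q where q: "q > p" "{p<..<q} \<inter> brk g = {}"
    using assms finite_gap_right unfolding tame_def by metis
  have "g s = g ((p + q) / 2)" if s: "p < s" "s < q" for s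
  proof (cases "s \<le> (p + q) / 2")
    case True
    then have "{s..(p + q) / 2} \<subseteq> {p<..<q}" using s q(1) by auto
    with True q(2) show ?thesis by (intro brk_const) auto
  next
    case False
    then have "{(p + q) / 2..s} \<subseteq> {p<..<q}" using s q(1) by auto
    with False q(2) show ?thesis by (intro brk_const[symmetric]) auto
  qed
  then show ?thesis using q that by blast
qed

lemma tame_reflect:
  assumes "tame g"
  shows "tame (\<lambda>t. g (- t))"
proof -
  have "brk (\<lambda>t. g (- t)) \<subseteq> uminus ` brk g"
  proof
    fix x assume "x \<in> brk (\<lambda>t. g (- t))"
    then have "\<exists>s. \<bar>s - (- x)\<bar> < e \<and> g s \<noteq> g (- x)" if "e > 0" for e
      using that unfolding brk_def
      by (smt (verit, ccfv_SIG) mem_Collect_eq)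
    then show "x \<in> uminus ` brk g"
      unfolding brk_def by (intro image_eqI[of _ _ "- x"]) auto
  qed
  with assms show ?thesis unfolding tame_def by (meson finite_imageI finite_subset)
qed

lemma tame_left_germ:
  assumes "tame g"
  obtains v q where "q < p" "\<And>s. q < s \<Longrightarrow> s < p \<Longrightarrow> g s = v"
proof -
  obtain v q where "q > - p" "\<And>s. - p < s \<Longrightarrow> s < q \<Longrightarrow> g (- s) = v"
    using tame_right_germ[OF tame_reflect[OF assms]] by metis
  then show ?thesis using that[of "- q" v] by (metis minus_less_iff minus_minus neg_less_iff_less)
qed

text \<open>Two strict maxima over the same interval would each exceed the other, so every interval
  with rational end points accounts for at most one point.\<close>

lemma countable_strict_local_max:
  fixes f :: "real \<Rightarrow> real"
  shows "countable {x. \<exists>e>0. \<forall>u. \<bar>u - x\<bar> < e \<and> u \<noteq> x \<longrightarrow> f u < f x}"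
proof -
  define M where "M p q = {x. p < x \<and> x < q \<and> (\<forall>u. p < u \<and> u < q \<and> u \<noteq> x \<longrightarrow> f u < f x)}" for p q
  have "countable (M p q)" for p q
  proof (rule countable_subset)
    show "M p q \<subseteq> {SOME x. x \<in> M p q}"
    proof
      fix x assume x: "x \<in> M p q"
      then have "(SOME x. x \<in> M p q) \<in> M p q" by (rule someI)
      with x show "x \<in> {SOME x. x \<in> M p q}" unfolding M_def by (smt (verit) mem_Collect_eq singletonI)
    qed
  qed simp
  then have "countable (\<Union>p\<in>\<rat>. \<Union>q\<in>\<rat>. M p q)"
    by (intro countable_UN countable_rat) auto
  moreover have "{x. \<exists>e>0. \<forall>u. \<bar>u - x\<bar> < e \<and> u \<noteq> x \<longrightarrow> f u < f x} \<subseteq> (\<Union>p\<in>\<rat>. \<Union>q\<in>\<rat>. M p q)"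
  proof
    fix x assume "x \<in> {x. \<exists>e>0. \<forall>u. \<bar>u - x\<bar> < e \<and> u \<noteq> x \<longrightarrow> f u < f x}"
    then obtain e where e: "e > 0" "\<And>u. \<bar>u - x\<bar> < e \<Longrightarrow> u \<noteq> x \<Longrightarrow> f u < f x" by auto
    obtain p where p: "p \<in> \<rat>" "x - e < p" "p < x"
      using Rats_dense_in_real[of "x - e" x] e(1) by auto
    obtain q where q: "q \<in> \<rat>" "x < q" "q < x + e"
      using Rats_dense_in_real[of x "x + e"] e(1) by auto
    have "x \<in> M p q" unfolding M_def using p q e(2) by auto
    then show "x \<in> (\<Union>p\<in>\<rat>. \<Union>q\<in>\<rat>. M p q)" using p q by blast
  qed
  ultimately show ?thesis by (rule countable_subset[rotated])
qed

section \<open>Tameness and piecewise monotonicity of definable functions of one variable\<close>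

context o_minimal_structure
begin

text \<open>The o-minimality axiom enters here: a definable set of reals is a finite union of points
  and intervals, each with finitely many break points.\<close>

lemma dpred_tame:
  assumes "dpred (\<lambda>s. P (s 0))"
  shows "tame P"
proof -
  from o_min[OF dpred_in[OF assms, of 1]] obtain \<I> where I: "finite \<I>" "\<forall>I\<in>\<I>. (\<exists>a. I = {a}) \<or> (open I \<and> is_interval I)"
    "{s \<in> RR 1. P (s 0)} = pt ` \<Union>\<I>"
    by (elim exE conjE)
  have "inj pt" by (auto simp: inj_def pt_def fun_eq_iff split: if_splits)
  moreover have "{s \<in> RR 1. P (s 0)} = pt ` {t. P t}"
    by (auto simp: RR_Suc_0 pt_def)
  ultimately have "{t. P t} = \<Union>\<I>" using I(3) by (metis inj_image_eq_iff)
  then have "P = (\<lambda>t. t \<in> \<Union>\<I>)" unfolding set_eq_iff by (intro ext) simp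
  moreover have "tame (\<lambda>t. t \<in> \<Union>\<I>)"
    by (rule tame_Union[OF I(1)]) (use I(2) in \<open>auto simp: tame_point tame_interval\<close>)
  ultimately show ?thesis by simp
qed

lemma dfun_of_real:
  assumes "dfun (\<lambda>s. f (s 0))" and "dfun e"
  shows "dfun (\<lambda>x. f (e x))"
  using dfun_comp[OF assms(1), of "\<lambda>x i. e x"] assms(2) by (simp add: dseq_def)

text \<open>The sign of \<open>f s - f x\<close> is constant just left and just right of
  \<open>x\<close>, so at \<open>x\<close> the function is weakly increasing, weakly decreasing, or
  has a strict local extremum. Strict extrema are countable, hence one of the monotone types occurs
  infinitely often, therefore on an interval, and bisection makes it global there.\<close>

lemma monotone_subinterval:
  fixes f :: "real \<Rightarrow> real"
  assumes f: "dfun (\<lambda>s. f (s 0))" and "a < b"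
  obtains c d where "a \<le> c" "c < d" "d \<le> b"
    "mono_on {c<..<d} f \<or> mono_on {c<..<d} (\<lambda>t. - f t)"
proof -
  \<comment> \<open>\<open>Inc\<close> compares values with \<open>h x\<close> only; this pointwise
    form is what the sign analysis yields.\<close>
  define Inc where "Inc h x \<longleftrightarrow> (\<exists>e>0. \<forall>u. (x - e < u \<and> u \<le> x \<longrightarrow> h u \<le> h x) \<and>
    (x \<le> u \<and> u < x + e \<longrightarrow> h x \<le> h u))" for h :: "real \<Rightarrow> real" and x
  define smax where "smax h = {x. \<exists>e>0. \<forall>u. \<bar>u - x\<bar> < e \<and> u \<noteq> x \<longrightarrow> h u < h x}"
    for h :: "real \<Rightarrow> real"
  have Inc_mono: "mono_on {c<..<d} h" if Inc: "\<And>t. c < t \<Longrightarrow> t < d \<Longrightarrow> Inc h t" for c d h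
  proof (rule mono_onI)
    fix u v assume "u \<in> {c<..<d}" "v \<in> {c<..<d}" "u \<le> v"
    from this(3) show "h u \<le> h v"
    proof (induction rule: Bolzano)
      case (local z)
      then have "Inc h z" using Inc \<open>u \<in> _\<close> \<open>v \<in> _\<close> by auto
      then obtain e where e: "e > 0" "\<And>u. z - e < u \<Longrightarrow> u \<le> z \<Longrightarrow> h u \<le> h z"
        "\<And>u. z \<le> u \<Longrightarrow> u < z + e \<Longrightarrow> h z \<le> h u"
        unfolding Inc_def by auto
      show ?case
      proof (intro exI[of _ e] conjI allI impI e(1))
        fix a b assume "a \<le> z \<and> z \<le> b \<and> b - a < e"
        then show "h a \<le> h b" using e(2)[of a] e(3)[of b] by auto
      qed
    qed auto
  qed
  have tame_Inc: "tame (Inc h)" if "dfun (\<lambda>s. h (s 0))" for h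
    unfolding Inc_def by (intro dpred_tame dpred_intros dfun_of_real[OF that])
  have cover: "Inc f x \<or> Inc (\<lambda>t. - f t) x \<or> x \<in> smax f \<or> x \<in> smax (\<lambda>t. - f t)" for x
  proof -
    have "tame (\<lambda>u. (f u < f x, f x < f u))"
      by (rule tame_map2[where h = Pair]; intro dpred_tame dpred_intros dfun_of_real[OF f])
    note tm = this
    obtain v q where q: "q > x" "\<And>s. x < s \<Longrightarrow> s < q \<Longrightarrow> (f s < f x, f x < f s) = v"
      using tame_right_germ[OF tm] by metis
    obtain w p where p: "p < x" "\<And>s. p < s \<Longrightarrow> s < x \<Longrightarrow> (f s < f x, f x < f s) = w"
      using tame_left_germ[OF tm] by metis
    define e where "e = min (q - x) (x - p)"
    have e: "e > 0" "\<And>s. x < s \<Longrightarrow> s < x + e \<Longrightarrow> f s < f x \<longleftrightarrow> fst v"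
      "\<And>s. x < s \<Longrightarrow> s < x + e \<Longrightarrow> f x < f s \<longleftrightarrow> snd v"
      "\<And>s. x - e < s \<Longrightarrow> s < x \<Longrightarrow> f s < f x \<longleftrightarrow> fst w"
      "\<And>s. x - e < s \<Longrightarrow> s < x \<Longrightarrow> f x < f s \<longleftrightarrow> snd w"
      subgoal using p(1) q(1) unfolding e_def by simp
      subgoal for s using q(2)[of s, symmetric] unfolding e_def by simp
      subgoal for s using q(2)[of s, symmetric] unfolding e_def by simp
      subgoal for s using p(2)[of s, symmetric] unfolding e_def by simp
      subgoal for s using p(2)[of s, symmetric] unfolding e_def by simp
      done
    have d: "u < x \<or> u = x \<or> x < u" for u by linarith
    \<comment> \<open>Sampling at distance \<open>e / 2\<close> shows that the two opposite strict
      inequalities cannot both hold on one side.\<close>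
    have vw: "\<not> (fst v \<and> snd v)" "\<not> (fst w \<and> snd w)"
      using e(1) e(2,3)[of "x + e / 2"] e(4,5)[of "x - e / 2"] by (auto simp: field_simps)
    consider "\<not> snd w" "\<not> fst v" | "\<not> fst w" "\<not> snd v" | "snd w" "snd v" | "fst w" "fst v"
      using vw by blast
    then show ?thesis
    proof cases
      case 1
      then have "Inc f x"
        unfolding Inc_def by (intro exI[of _ e] allI conjI impI e(1)) (metis d e linorder_not_less order_refl)+
      then show ?thesis ..
    next
      case 2
      then have "Inc (\<lambda>t. - f t) x"
        unfolding Inc_def neg_le_iff_le
        by (intro exI[of _ e] allI conjI impI e(1)) (metis d e linorder_not_less order_refl)+
      then show ?thesis by simp
    next
      case 3
      have "- f u < - f x" if "\<bar>u - x\<bar> < e" "u \<noteq> x" for u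
        using that 3 e(3)[of u] e(5)[of u] d[of u] by auto
      then show ?thesis unfolding smax_def using e(1) by blast
    next
      case 4
      have "f u < f x" if "\<bar>u - x\<bar> < e" "u \<noteq> x" for u
        using that 4 e(2)[of u] e(4)[of u] d[of u] by auto
      then show ?thesis unfolding smax_def using e(1) by blast
    qed
  qed
  have "infinite {t. a < t \<and> t < b \<and> Inc f t} \<or> infinite {t. a < t \<and> t < b \<and> Inc (\<lambda>t. - f t) t}"
  proof (rule ccontr)
    assume "\<not> ?thesis"
    then have "countable ({t. a < t \<and> t < b \<and> Inc f t} \<union> {t. a < t \<and> t < b \<and> Inc (\<lambda>t. - f t) t}
      \<union> smax f \<union> smax (\<lambda>t. - f t))"
      unfolding smax_def
      by (intro countable_Un countable_strict_local_max) (auto intro: countable_finite)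
    moreover have "{a<..<b} \<subseteq> ({t. a < t \<and> t < b \<and> Inc f t} \<union> {t. a < t \<and> t < b \<and> Inc (\<lambda>t. - f t) t}
      \<union> smax f \<union> smax (\<lambda>t. - f t))"
      using cover by auto
    ultimately have "countable {a<..<b}" by (rule countable_subset[rotated])
    then show False using \<open>a < b\<close> uncountable_open_interval by blast
  qed
  then show ?thesis
  proof
    assume "infinite {t. a < t \<and> t < b \<and> Inc f t}"
    then obtain c d where "a \<le> c" "c < d" "d \<le> b" "\<And>t. c < t \<Longrightarrow> t < d \<Longrightarrow> Inc f t"
      using tame_contains_interval[OF tame_Inc[OF f]] by blast
    then show ?thesis using that Inc_mono by blast
  next
    assume "infinite {t. a < t \<and> t < b \<and> Inc (\<lambda>t. - f t) t}"
    then obtain c d where "a \<le> c" "c < d" "d \<le> b" "\<And>t. c < t \<Longrightarrow> t < d \<Longrightarrow> Inc (\<lambda>t. - f t) t"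
      using tame_contains_interval[OF tame_Inc[OF dfun_minus[OF f]]] by blast
    then show ?thesis using that Inc_mono by blast
  qed
qed

text \<open>A form of continuity that quantifies over reals only, to which the closure rules for
  \<open>dpred\<close> apply.\<close>

lemma isCont_iff_dist:
  "isCont f x \<longleftrightarrow> (\<forall>e>0. \<exists>d>0. \<forall>u. \<bar>u - x\<bar> < d \<longrightarrow> \<bar>f u - f x\<bar> < e)" for f :: "real \<Rightarrow> real"
  unfolding continuous_at_eps_delta dist_real_def by simp

text \<open>An infinite definable set of discontinuities would contain an interval, hence one on
  which \<open>f\<close> is monotone; but a monotone function has only countably many
  discontinuities.\<close>

lemma finite_discontinuities:
  assumes f: "dfun (\<lambda>s. f (s 0))"
  shows "finite {x. \<not> isCont f x}"
proof (rule ccontr)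
  assume inf: "infinite {x. \<not> isCont f x}"
  have tm: "tame (\<lambda>x. \<not> isCont f x)"
    unfolding isCont_iff_dist
    by (intro dpred_tame dpred_intros dfun_of_real[OF f])
  then obtain x where x: "\<not> isCont f x" "x \<notin> brk (\<lambda>x. \<not> isCont f x)"
    using inf unfolding tame_def by (metis (mono_tags, lifting) finite_subset mem_Collect_eq subsetI)
  then obtain e where e: "e > 0" "\<And>s. \<bar>s - x\<bar> < e \<Longrightarrow> \<not> isCont f s"
    unfolding not_brk_iff by blast
  obtain c d where cd: "x - e \<le> c" "c < d" "d \<le> x + e"
    "mono_on {c<..<d} f \<or> mono_on {c<..<d} (\<lambda>t. - f t)"
    using monotone_subinterval[OF f, of "x - e" "x + e"] e(1) by auto
  have "isCont (\<lambda>t. - f t) t = isCont f t" for t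
    using continuous_minus[of "at t" f] continuous_minus[of "at t" "\<lambda>t. - f t"] by auto
  then have "countable {t \<in> {c<..<d}. \<not> isCont f t}"
    using cd(4) mono_on_ctble_discont_open[of "{c<..<d}" f]
      mono_on_ctble_discont_open[of "{c<..<d}" "\<lambda>t. - f t"] by auto
  moreover have "{t \<in> {c<..<d}. \<not> isCont f t} = {c<..<d}"
    using e(2) cd by (auto simp: abs_less_iff)
  ultimately have "countable {c<..<d}" by simp
  then show False using cd(2) uncountable_open_interval by blast
qed

text \<open>Local monotonicity fails only finitely often, since an interval of failures would
  contain a monotone subinterval. The break points of \<open>L f\<close> and
  \<open>L (\<lambda>t. - f t)\<close> are put into \<open>F\<close> so that the direction cannot
  change along an interval missing \<open>F\<close>.\<close>

lemma piecewise_monotone: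
  assumes f: "dfun (\<lambda>s. f (s 0))"
  shows "\<exists>F. finite F \<and> (\<forall>x. x \<notin> F \<longrightarrow> isCont f x) \<and>
    (\<forall>J. is_interval J \<and> J \<inter> F = {} \<longrightarrow> mono_on J f \<or> mono_on J (\<lambda>t. - f t))"
proof -
  define L where "L h x \<longleftrightarrow> (\<exists>e>0. \<forall>u v. x - e < u \<and> u \<le> v \<and> v < x + e \<longrightarrow> h u \<le> h v)"
    for h :: "real \<Rightarrow> real" and x
  have tame_L: "tame (L h)" if "dfun (\<lambda>s. h (s 0))" for h
    unfolding L_def by (intro dpred_tame dpred_intros dfun_of_real[OF that])
  note tm = tame_L[OF f] tame_L[OF dfun_minus[OF f]]
  define B where "B = {x. \<not> (L f x \<or> L (\<lambda>t. - f t) x)}"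
  have "finite B"
  proof (rule ccontr)
    assume inf: "infinite B"
    have "tame (\<lambda>x. \<not> (L f x \<or> L (\<lambda>t. - f t) x))"
      using tame_map2[OF tm, of "\<lambda>p q. \<not> (p \<or> q)"] .
    then obtain x where "x \<in> B" "x \<notin> brk (\<lambda>x. \<not> (L f x \<or> L (\<lambda>t. - f t) x))"
      using inf unfolding tame_def by (metis finite_subset subsetI)
    then obtain e where e: "e > 0" "\<And>s. \<bar>s - x\<bar> < e \<Longrightarrow> s \<in> B"
      unfolding B_def not_brk_iff mem_Collect_eq by blast
    obtain c d where cd: "x - e \<le> c" "c < d" "d \<le> x + e"
      "mono_on {c<..<d} f \<or> mono_on {c<..<d} (\<lambda>t. - f t)"
      using monotone_subinterval[OF f, of "x - e" "x + e"] e(1) by auto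
    have "L h ((c + d) / 2)" if "mono_on {c<..<d} h" for h
      unfolding L_def using cd(2) mono_onD[OF that]
      by (intro exI[of _ "(d - c) / 2"]) (auto simp: field_simps)
    then have "(c + d) / 2 \<notin> B" using cd(4) unfolding B_def by auto
    moreover have "(c + d) / 2 \<in> B" using cd by (intro e(2)) (auto simp: abs_less_iff field_simps)
    ultimately show False by blast
  qed
  define F where "F = {x. \<not> isCont f x} \<union> B \<union> brk (L f) \<union> brk (L (\<lambda>t. - f t))"
  have glob: "mono_on J h" if J: "is_interval J" and h: "\<And>x. x \<in> J \<Longrightarrow> L h x" for J h
  proof (rule mono_onI)
    fix u v assume uv: "u \<in> J" "v \<in> J" "u \<le> v"
    from this(3) show "h u \<le> h v"
    proof (induction rule: Bolzano)
      case (local z)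
      then have "L h z" using h uv J unfolding is_interval_1 by blast
      then obtain e where e: "e > 0" "\<And>u v. z - e < u \<Longrightarrow> u \<le> v \<Longrightarrow> v < z + e \<Longrightarrow> h u \<le> h v"
        unfolding L_def by auto
      show ?case
      proof (intro exI[of _ e] conjI allI impI e(1))
        fix a b assume "a \<le> z \<and> z \<le> b \<and> b - a < e"
        then show "h a \<le> h b" by (intro e(2)) auto
      qed
    qed auto
  qed
  show ?thesis
  proof (intro exI[of _ F] conjI allI impI)
    show "finite F"
      unfolding F_def using finite_discontinuities[OF f] \<open>finite B\<close> tm by (simp add: tame_def)
    show "isCont f x" if "x \<notin> F" for x using that by (simp add: F_def)
    fix J assume "is_interval J \<and> J \<inter> F = {}"
    then have J: "is_interval J" "J \<inter> F = {}" by auto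
    have const: "L h x = L h y" if xy: "x \<in> J" "y \<in> J" "h = f \<or> h = (\<lambda>t. - f t)" for x y h
    proof -
      have *: "L h a = L h b" if ab: "a \<in> J" "b \<in> J" "a \<le> b" for a b
      proof (rule brk_const[OF ab(3), of "L h"])
        have "{a..b} \<subseteq> J" using J(1) ab unfolding is_interval_1 by (meson atLeastAtMost_iff subsetI)
        then show "{a..b} \<inter> brk (L h) = {}"
          using J(2) xy(3) unfolding F_def by blast
      qed
      show ?thesis
        using *[OF xy(1,2)] *[OF xy(2,1), symmetric] linear[of x y] by blast
    qed
    show "mono_on J f \<or> mono_on J (\<lambda>t. - f t)"
    proof (cases "\<exists>x\<in>J. L f x")
      case True
      then show ?thesis using const glob[OF J(1), of f] by blast
    next
      case False
      then have "L (\<lambda>t. - f t) x" if "x \<in> J" for x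
        using that J(2) unfolding F_def B_def by blast
      then show ?thesis using glob[OF J(1)] by blast
    qed
  qed
qed

end

subsection \<open>Ranks in finite sets of reals\<close>

text \<open>The recursion that makes cardinalities of fibres first-order: a set with more than
  \<open>k\<close> elements has an element above \<open>k\<close> others, for instance its
  maximum.\<close>

lemma Suc_le_card_iff:
  fixes S :: "real set"
  assumes "finite S"
  shows "Suc k \<le> card S \<longleftrightarrow> (\<exists>t\<in>S. k \<le> card {s \<in> S. s < t})"
proof
  assume k: "Suc k \<le> card S"
  then have "S \<noteq> {}" by auto
  then have M: "Max S \<in> S" using assms by simp
  have "{s \<in> S. s < Max S} = S - {Max S}"
    using assms by (auto simp: less_le)
  then have "k \<le> card {s \<in> S. s < Max S}" using M assms k by simp
  with M show "\<exists>t\<in>S. k \<le> card {s \<in> S. s < t}" by blast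
next
  assume "\<exists>t\<in>S. k \<le> card {s \<in> S. s < t}"
  then obtain t where t: "t \<in> S" "k \<le> card {s \<in> S. s < t}" by blast
  have "card (insert t {s \<in> S. s < t}) \<le> card S"
    using assms t(1) by (intro card_mono) auto
  then show "Suc k \<le> card S" using assms t(2) by simp
qed

definition rnk :: "real set \<Rightarrow> real \<Rightarrow> nat" where
  "rnk S y = card {s \<in> S. s < y}"

text \<open>The inverse of \<open>rnk S\<close> on a finite \<open>S\<close>, listing it in
  increasing order. The default \<open>0\<close> keeps the \<open>i\<close>-th entry a total
  function of the parameters of \<open>S\<close>.\<close>

definition elt :: "real set \<Rightarrow> nat \<Rightarrow> real" where
  "elt S i = (if i < card S then THE y. y \<in> S \<and> rnk S y = i else 0)"

lemma rnk_mono: "finite S \<Longrightarrow> y \<le> y' \<Longrightarrow> rnk S y \<le> rnk S y'"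
  unfolding rnk_def by (intro card_mono) auto

lemma rnk_less:
  assumes "finite S" "y \<in> S" "y < y'"
  shows "rnk S y < rnk S y'"
proof -
  have "y \<in> {s \<in> S. s < y'}" "y \<notin> {s \<in> S. s < y}" "{s \<in> S. s < y} \<subseteq> {s \<in> S. s < y'}"
    using assms by auto
  then show ?thesis unfolding rnk_def using assms(1) by (intro psubset_card_mono) auto
qed

lemma rnk_less_card: "finite S \<Longrightarrow> y \<in> S \<Longrightarrow> rnk S y < card S"
  unfolding rnk_def by (intro psubset_card_mono) auto

lemma rnk_le_card: "finite S \<Longrightarrow> rnk S y \<le> card S"
  unfolding rnk_def by (intro card_mono) auto

lemma inj_on_rnk: "finite S \<Longrightarrow> inj_on (rnk S) S"
  by (rule linorder_inj_onI') (metis rnk_less less_irrefl)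

lemma rnk_ex1:
  assumes "finite S" "i < card S"
  shows "\<exists>!y. y \<in> S \<and> rnk S y = i"
proof -
  have "rnk S ` S = {..<card S}"
    using assms(1) rnk_less_card by (intro card_subset_eq) (auto simp: card_image inj_on_rnk)
  then have "i \<in> rnk S ` S" using assms(2) by simp
  then obtain y where "y \<in> S" "rnk S y = i" by auto
  then show ?thesis using inj_on_rnk[OF assms(1)] by (auto simp: inj_on_def)
qed

lemma elt_props:
  assumes "finite S" "i < card S"
  shows elt_in: "elt S i \<in> S" and rnk_elt: "rnk S (elt S i) = i"
  using theI'[OF rnk_ex1[OF assms]] assms(2) by (auto simp: elt_def)

lemma elt_eqI: "finite S \<Longrightarrow> y \<in> S \<Longrightarrow> rnk S y = i \<Longrightarrow> elt S i = y"
  using rnk_less_card[of S y] elt_props[of S i] inj_on_rnk[of S] by (auto simp: inj_on_def)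

text \<open>An adjunction between rank and element: a bound on the rank means lying on or below the
  graph of the \<open>i\<close>-th element. Fubini in the plane uses it to bound regions by
  graphs.\<close>

lemma le_elt_iff:
  assumes "finite S" "i < card S"
  shows "y \<le> elt S i \<longleftrightarrow> rnk S y \<le> i"
  using rnk_mono[OF assms(1), of y "elt S i"] rnk_less[OF assms(1) elt_in[OF assms], of y]
    rnk_elt[OF assms] by linarith

subsection \<open>Constructible functions\<close>

context o_minimal_structure
begin

text \<open>The value type is arbitrary, so truth values and pairs are covered, and the rule for
  pairs yields all binary operations.\<close>

definition cfun :: "((nat \<Rightarrow> real) \<Rightarrow> 'b) \<Rightarrow> bool" where
  "cfun c \<longleftrightarrow> finite (range c) \<and> (\<forall>k. dpred (\<lambda>x. c x = k))"

lemma cfun_dpred: "cfun c \<Longrightarrow> dpred (\<lambda>x. p (c x))"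
proof -
  assume c: "cfun c"
  have "dpred (\<lambda>x. \<exists>k\<in>{k \<in> range c. p k}. c x = k)"
    using c by (intro dpred_fin_ex) (auto simp: cfun_def)
  then show ?thesis by (rule back_subst[of dpred]) auto
qed

lemma dpred_of_cfun: "cfun P \<Longrightarrow> dpred P"
  using cfun_dpred[of P "\<lambda>b. b"] by simp

lemma cfun_map: "cfun c \<Longrightarrow> cfun (\<lambda>x. h (c x))"
proof -
  assume c: "cfun c"
  then have "finite (h ` range c)" by (simp add: cfun_def)
  moreover have "range (\<lambda>x. h (c x)) = h ` range c" by auto
  ultimately show ?thesis
    unfolding cfun_def using cfun_dpred[OF c, of "\<lambda>i. h i = _"] by simp
qed

lemma cfun_pair: "cfun c \<Longrightarrow> cfun d \<Longrightarrow> cfun (\<lambda>x. (c x, d x))"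
proof -
  assume c: "cfun c" and d: "cfun d"
  have "finite (range c \<times> range d)" using c d by (simp add: cfun_def)
  then have "finite (range (\<lambda>x. (c x, d x)))"
    by (rule finite_subset[rotated]) auto
  moreover have "dpred (\<lambda>x. c x = fst k \<and> d x = snd k)" for k
    using c d unfolding cfun_def by (intro dpred_conj) auto
  ultimately show ?thesis unfolding cfun_def by (simp add: prod_eq_iff)
qed

lemma cfun_map2: "cfun c \<Longrightarrow> cfun d \<Longrightarrow> cfun (\<lambda>x. h (c x) (d x))"
  using cfun_map[OF cfun_pair, of c d "\<lambda>(i, j). h i j"] by simp

lemma cfun_eq: "cfun c \<Longrightarrow> cfun d \<Longrightarrow> dpred (\<lambda>x. c x = d x)"
  using cfun_dpred[OF cfun_pair, of c d "\<lambda>(i, j). i = j"] by simp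

lemma cfun_bool: "dpred P \<Longrightarrow> cfun P"
  unfolding cfun_def by (auto intro!: dpred_intros)

named_theorems cfun_intros

lemma cfun_of_bool [cfun_intros]: "dpred P \<Longrightarrow> cfun (\<lambda>x. of_bool (P x))"
  by (rule cfun_map[OF cfun_bool])

lemma cfun_const [cfun_intros]: "cfun (\<lambda>x. k)"
  unfolding cfun_def by (auto intro: dpred_intros)

lemma cfun_add [cfun_intros]: "cfun c \<Longrightarrow> cfun d \<Longrightarrow> cfun (\<lambda>x. c x + d x)"
  by (rule cfun_map2)

lemma cfun_diff [cfun_intros]: "cfun c \<Longrightarrow> cfun d \<Longrightarrow> cfun (\<lambda>x. c x - d x)"
  by (rule cfun_map2)

lemma cfun_mult [cfun_intros]: "cfun c \<Longrightarrow> cfun d \<Longrightarrow> cfun (\<lambda>x. c x * d x)"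
  by (rule cfun_map2)

lemma cfun_if [cfun_intros]: "dpred P \<Longrightarrow> cfun c \<Longrightarrow> cfun d \<Longrightarrow> cfun (\<lambda>x. if P x then c x else d x)"
  using cfun_map2[OF cfun_bool cfun_pair, of P c d "\<lambda>b (i, j). if b then i else j"] by simp

lemma cfun_sum [cfun_intros]:
  assumes "finite I" "\<And>i. i \<in> I \<Longrightarrow> cfun (c i)"
  shows "cfun (\<lambda>x. \<Sum>i\<in>I. c i x)"
  using assms by (induction I) (auto intro: cfun_intros)

lemma cfun_comp: "cfun c \<Longrightarrow> dseq w \<Longrightarrow> cfun (\<lambda>x. c (w x))"
  unfolding cfun_def using dpred_comp[of "\<lambda>x. c x = _" w]
  by (auto intro: finite_subset[of "range (\<lambda>x. c (w x))" "range c"])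

text \<open>The break points of \<open>g\<close> lie among those of its finitely many level
  sets.\<close>

lemma cfun_tame:
  assumes "cfun (\<lambda>s. g (s 0))"
  shows "tame g"
proof -
  have "finite (range g)"
    using assms unfolding cfun_def
    by (auto elim!: finite_subset[rotated] intro: range_eqI[of _ _ "\<lambda>_. _"])
  moreover have "tame (\<lambda>t. g t = k)" for k
    using assms unfolding cfun_def by (auto intro: dpred_tame)
  ultimately have "finite (\<Union>k\<in>range g. brk (\<lambda>t. g t = k))"
    unfolding tame_def by (intro finite_UN_I)
  moreover have "brk g \<subseteq> (\<Union>k\<in>range g. brk (\<lambda>t. g t = k))"
  proof
    fix x assume "x \<in> brk g"
    then have "x \<in> brk (\<lambda>t. g t = g x)" unfolding brk_def by simp
    then show "x \<in> (\<Union>k\<in>range g. brk (\<lambda>t. g t = k))" by blast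
  qed
  ultimately show ?thesis unfolding tame_def by (rule finite_subset[rotated])
qed

definition cfam :: "((nat \<Rightarrow> real) \<Rightarrow> real \<Rightarrow> 'b) \<Rightarrow> bool" where
  "cfam c \<longleftrightarrow> cfun (\<lambda>s. c (\<lambda>i. s (Suc i)) (s 0))"

lemma cfamD: "cfam c \<Longrightarrow> dseq w \<Longrightarrow> dfun e \<Longrightarrow> cfun (\<lambda>x. c (w x) (e x))"
  unfolding cfam_def
  using cfun_comp[of "\<lambda>s. c (\<lambda>i. s (Suc i)) (s 0)" "\<lambda>x. e x ## w x"]
  by (simp add: dseq_scons)

lemma cfam_tame: "cfam c \<Longrightarrow> tame (c x)"
  by (rule cfun_tame[OF cfamD[OF _ dseq_const dfun_var]])

lemma dfam_brk: "cfam c \<Longrightarrow> dfam (\<lambda>z t. t \<in> brk (c z))"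
  unfolding dfam_def brk_def mem_Collect_eq by (intro dpred_intros cfun_eq cfamD)

lemma finite_brk: "cfam c \<Longrightarrow> finite (brk (c z))"
  using cfam_tame tame_def by blast

subsection \<open>Definability of cardinalities\<close>

text \<open>Induction along \<open>Suc_le_card_iff\<close>; the chosen element becomes a further
  parameter, which cuts the fibre down to what lies below it.\<close>

lemma dpred_card_ge:
  assumes "dfam R" "\<And>z. finite {t. R z t}"
  shows "dpred (\<lambda>z. k \<le> card {t. R z t})"
  using assms
proof (induction k arbitrary: R)
  case (Suc k)
  let ?R = "\<lambda>z s. R (\<lambda>i. z (Suc i)) s \<and> s < z 0"
  have "dfam ?R" unfolding dfam_def
    by (intro dpred_intros dfamD[OF Suc.prems(1)])
  moreover have "finite {s. ?R z s}" for z
    using Suc.prems(2) by (rule finite_subset[rotated]) auto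
  ultimately have "dpred (\<lambda>z. k \<le> card {s. ?R z s})" by (rule Suc.IH)
  then have "dpred (\<lambda>z. \<exists>t. R z t \<and> k \<le> card {s. R z s \<and> s < t})"
    by (intro dpred_intros dfamD[OF Suc.prems(1)])
  moreover have "(Suc k \<le> card {t. R z t}) = (\<exists>t. R z t \<and> k \<le> card {s. R z s \<and> s < t})" for z
    using Suc_le_card_iff[OF Suc.prems(2), of k z] by simp
  ultimately show ?case by simp
qed (simp add: dpred_const)

lemma dpred_card_eq:
  assumes "dfam R" "\<And>z. finite {t. R z t}"
  shows "dpred (\<lambda>z. card {t. R z t} = k)"
proof -
  have "dpred (\<lambda>z. k \<le> card {t. R z t} \<and> \<not> Suc k \<le> card {t. R z t})"
    by (intro dpred_intros dpred_card_ge assms)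
  then show ?thesis by (rule back_subst[of dpred]) auto
qed

lemma dfam_rnk_eq:
  assumes "dfam R" "\<And>z. finite {t. R z t}"
  shows "dfam (\<lambda>z y. rnk {t. R z t} y = i)"
proof -
  let ?R = "\<lambda>z s. R (\<lambda>i. z (Suc i)) s \<and> s < z 0"
  have "dfam ?R" unfolding dfam_def by (intro dpred_intros dfamD[OF assms(1)])
  moreover have "finite {s. ?R z s}" for z
    using assms(2) by (rule finite_subset[rotated]) auto
  ultimately have "dpred (\<lambda>z. card {s. ?R z s} = i)" by (rule dpred_card_eq)
  then show ?thesis unfolding dfam_def rnk_def by simp
qed

lemma dfun_elt:
  assumes "dfam R" "\<And>z. finite {t. R z t}"
  shows "dfun (\<lambda>z. elt {t. R z t} i)"
proof (rule dfunI[where R = "\<lambda>z y. (Suc i \<le> card {t. R z t} \<and> R z y \<and> rnk {t. R z t} y = i) \<or>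
    (\<not> Suc i \<le> card {t. R z t} \<and> y = 0)"])
  show "dpred (\<lambda>s. (Suc i \<le> card {t. R (\<lambda>i. s (Suc i)) t} \<and> R (\<lambda>i. s (Suc i)) (s 0) \<and>
      rnk {t. R (\<lambda>i. s (Suc i)) t} (s 0) = i) \<or>
      (\<not> Suc i \<le> card {t. R (\<lambda>i. s (Suc i)) t} \<and> s 0 = 0))"
    by (intro dpred_intros dfamD[OF assms(1)] dfamD[OF dfam_rnk_eq[OF assms]]
        dpred_reindex[OF dpred_card_ge[OF assms]])
  fix z y
  show "(Suc i \<le> card {t. R z t} \<and> R z y \<and> rnk {t. R z t} y = i) \<or>
      (\<not> Suc i \<le> card {t. R z t} \<and> y = 0) \<longleftrightarrow> y = elt {t. R z t} i"
    using elt_props[OF assms(2), of i z] elt_eqI[OF assms(2), of y z i]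
    by (cases "i < card {t. R z t}") (auto simp: elt_def[of _ i])
qed

end

subsection \<open>Uniform finiteness\<close>

text \<open>Uniqueness on both sides makes proximity up to \<open>e\<close> a bijection, so equal
  cardinality follows from a condition that quantifies over reals only.\<close>

definition matched :: "real \<Rightarrow> (real \<Rightarrow> bool) \<Rightarrow> (real \<Rightarrow> bool) \<Rightarrow> bool" where
  "matched e S T \<longleftrightarrow> (\<forall>y. S y \<longrightarrow> (\<exists>!y'. T y' \<and> \<bar>y - y'\<bar> < e)) \<and>
     (\<forall>y'. T y' \<longrightarrow> (\<exists>!y. S y \<and> \<bar>y - y'\<bar> < e))"

lemma matched_card:
  assumes "matched e S T"
  shows "card {y. S y} = card {y. T y}"
proof (rule bij_betw_same_card)
  let ?f = "\<lambda>y. THE y'. T y' \<and> \<bar>y - y'\<bar> < e"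
  have f: "T (?f y) \<and> \<bar>y - ?f y\<bar> < e" if "S y" for y
  proof (rule theI')
    show "\<exists>!y'. T y' \<and> \<bar>y - y'\<bar> < e" using assms that unfolding matched_def by blast
  qed
  show "bij_betw ?f {y. S y} {y. T y}"
  proof (rule bij_betwI')
    fix x y assume "x \<in> {y. S y}" "y \<in> {y. S y}"
    then show "?f x = ?f y \<longleftrightarrow> x = y"
      using f[of x] f[of y] assms unfolding matched_def by auto
  next
    fix y assume "y \<in> {y. T y}"
    then obtain x where x: "S x" "\<bar>x - y\<bar> < e" using assms unfolding matched_def by blast
    moreover have "\<exists>!y'. T y' \<and> \<bar>x - y'\<bar> < e" using assms x(1) unfolding matched_def by blast
    ultimately have "y = ?f x" using f[OF x(1)] \<open>y \<in> _\<close> by blast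
    then show "\<exists>x\<in>{y. S y}. y = ?f x" using x(1) by blast
  qed (use f in auto)
qed

text \<open>Outside \<open>bad A\<close> the fibres of \<open>A\<close> are in bijection with the neighbouring ones.  Unlike local
  constancy of the cardinality of the fibres, this is a first-order condition.\<close>

definition bad :: "(real \<Rightarrow> real \<Rightarrow> bool) \<Rightarrow> real \<Rightarrow> bool" where
  "bad A x \<longleftrightarrow> \<not> (\<exists>e>0. \<exists>d>0. \<forall>u. \<bar>u - x\<bar> < d \<longrightarrow> matched e (A x) (A u))"

lemma brk_card_bad: "brk (\<lambda>x. card {y. A x y}) \<subseteq> {x. bad A x}"
proof
  fix x assume x: "x \<in> brk (\<lambda>x. card {y. A x y})"
  show "x \<in> {x. bad A x}"
  proof (rule ccontr)
    assume "x \<notin> {x. bad A x}"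
    then obtain e d where "d > 0" "\<And>u. \<bar>u - x\<bar> < d \<Longrightarrow> matched e (A x) (A u)"
      unfolding bad_def by blast
    then have "x \<notin> brk (\<lambda>x. card {y. A x y})"
      unfolding not_brk_iff by (metis matched_card)
    with x show False by blast
  qed
qed

lemma finite_separated:
  fixes S :: "real set"
  assumes "finite S"
  obtains g where "g > 0" "\<And>y y'. y \<in> S \<Longrightarrow> y' \<in> S \<Longrightarrow> \<bar>y - y'\<bar> < g \<Longrightarrow> y = y'"
proof -
  let ?G = "insert 1 ((\<lambda>(y, y'). \<bar>y - y'\<bar>) ` {(y, y'). y \<in> S \<and> y' \<in> S \<and> y \<noteq> y'})"
  have "{(y, y'). y \<in> S \<and> y' \<in> S \<and> y \<noteq> y'} \<subseteq> S \<times> S" by auto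
  then have fin: "finite ?G" using assms by (meson finite_SigmaI finite_imageI finite_insert finite_subset)
  have pos: "0 < Min ?G" using fin by (subst Min_gr_iff) auto
  have "y = y'" if "y \<in> S" "y' \<in> S" "\<bar>y - y'\<bar> < Min ?G" for y y'
  proof (rule ccontr)
    assume "y \<noteq> y'"
    then have "\<bar>y - y'\<bar> \<in> ?G" using that by force
    then have "Min ?G \<le> \<bar>y - y'\<bar>" using fin by (intro Min_le)
    with that show False by linarith
  qed
  with pos show ?thesis by (rule that)
qed

text \<open>Every component of the complement of \<open>B\<close> contains one of these candidates:
  \<open>0\<close> if \<open>B\<close> is empty, an extreme point moved by \<open>1\<close>, or the
  midpoint of two neighbours. They are first-order in \<open>B\<close>, as the induction on the
  parameters requires.\<close>

lemma finite_test_point: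
  fixes B :: "real set"
  assumes "finite B" "x \<notin> B"
  obtains t where "t = 0 \<or> (\<exists>a\<in>B. t = a + 1 \<or> t = a - 1) \<or> (\<exists>a\<in>B. \<exists>b\<in>B. t = (a + b) / 2)"
    "{min x t..max x t} \<inter> B = {}"
proof -
  let ?L = "{b \<in> B. b < x}" and ?U = "{b \<in> B. x < b}"
  have B: "b \<in> ?L \<or> b \<in> ?U" if "b \<in> B" for b using that assms(2) by (cases b x rule: linorder_cases) auto
  have fin: "finite ?L" "finite ?U" using assms(1) by auto
  have L: "b \<le> Max ?L" if "b \<in> ?L" for b using fin(1) that by (rule Max_ge)
  have U: "Min ?U \<le> b" if "b \<in> ?U" for b using fin(2) that by (rule Min_le)
  note Lmax = Max_in[OF fin(1)] and Umin = Min_in[OF fin(2)]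
  consider "?L = {}" "?U = {}" | "?L = {}" "?U \<noteq> {}" | "?L \<noteq> {}" "?U = {}" | "?L \<noteq> {}" "?U \<noteq> {}"
    by blast
  then show ?thesis
  proof cases
    case 1
    then have "B = {}" using B by blast
    then show ?thesis using that[of 0] by auto
  next
    case 2
    have "b \<notin> {min x (Min ?U - 1)..max x (Min ?U - 1)}" if "b \<in> B" for b
      using B[OF that] 2 U[of b] Umin by auto
    then show ?thesis using that[of "Min ?U - 1"] Umin 2 by blast
  next
    case 3
    have "b \<notin> {min x (Max ?L + 1)..max x (Max ?L + 1)}" if "b \<in> B" for b
      using B[OF that] 3 L[of b] Lmax by auto
    then show ?thesis using that[of "Max ?L + 1"] Lmax 3 by blast
  next
    case 4
    let ?t = "(Max ?L + Min ?U) / 2"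
    have t: "Max ?L < ?t" "?t < Min ?U" using Lmax Umin 4 by auto
    have x: "Max ?L < x" "x < Min ?U" using Lmax[OF 4(1)] Umin[OF 4(2)] by auto
    have "b \<notin> {min x ?t..max x ?t}" if "b \<in> B" for b
      using B[OF that]
    proof
      assume "b \<in> ?L"
      then have "b < x" "b < ?t" using L[of b] x t by linarith+
      then show ?thesis by (simp add: min_def)
    next
      assume "b \<in> ?U"
      then have "x < b" "?t < b" using U[of b] x t by linarith+
      then show ?thesis by (simp add: max_def)
    qed
    then show ?thesis using that[of ?t] Lmax Umin 4 by blast
  qed
qed

context o_minimal_structure
begin

lemma dpred_ex1 [dpred_intros]:
  "dpred (\<lambda>x. \<exists>t. Q x t \<and> (\<forall>s. Q x s \<longrightarrow> s = t)) \<Longrightarrow> dpred (\<lambda>x. \<exists>!t. Q x t)"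
  by (simp add: Ex1_def)

lemma dfam_bad:
  assumes "dfam R"
  shows "dfam (\<lambda>z x. bad (\<lambda>x y. R (x ## z) y) x)"
  unfolding dfam_def bad_def matched_def by (intro dpred_intros dfamD[OF assms])

text \<open>Infinitely many bad points would fill an interval. Only countably many cardinalities
  occur over it, so on a subinterval the fibres have a fixed size \<open>k\<close> and consist of
  the values of \<open>k\<close> definable functions; at a common point of continuity these match
  the neighbouring fibres, against badness.\<close>

lemma finite_bad:
  assumes A: "dfam (\<lambda>z y. A (z 0) y)" and fin: "\<And>x. finite {y. A x y}"
  shows "finite {x. bad A x}"
proof (rule ccontr)
  assume inf: "infinite {x. bad A x}"
  have "dpred (\<lambda>s. bad A (s 0))"
    using dfamD[OF dfam_bad[OF A] dseq_id dfun_var, of 0] by simp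
  then have tm: "tame (bad A)" by (rule dpred_tame)
  have cardA: "dpred (\<lambda>s. card {y. A (s 0) y} = k)" for k
    by (rule dpred_card_eq[OF A fin])
  obtain x where x: "bad A x" "x \<notin> brk (bad A)"
    using tm inf unfolding tame_def by (metis finite_subset mem_Collect_eq subsetI)
  then obtain e where e: "e > 0" "\<And>s. \<bar>s - x\<bar> < e \<Longrightarrow> bad A s"
    unfolding not_brk_iff by blast
  have "\<exists>k. infinite {t. x - e < t \<and> t < x + e \<and> card {y. A t y} = k}"
  proof (rule ccontr)
    assume "\<not> ?thesis"
    then have "countable (\<Union>k. {t. x - e < t \<and> t < x + e \<and> card {y. A t y} = k})"
      by (auto intro: countable_finite)
    moreover have "(\<Union>k. {t. x - e < t \<and> t < x + e \<and> card {y. A t y} = k}) = {x - e<..<x + e}"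
      by auto
    ultimately show False using uncountable_open_interval[of "x - e" "x + e"] e(1) by simp
  qed
  then obtain k where k: "infinite {t. x - e < t \<and> t < x + e \<and> card {y. A t y} = k}" ..
  obtain c d where cd: "x - e \<le> c" "c < d" "d \<le> x + e" "\<And>t. c < t \<Longrightarrow> t < d \<Longrightarrow> card {y. A t y} = k"
    using tame_contains_interval[OF dpred_tame[OF cardA] k] by blast
  define f where "f i t = elt {y. A t y} i" for i t
  have "dfun (\<lambda>s. f i (s 0))" for i
    unfolding f_def by (rule dfun_elt[OF A fin])
  then have "finite (\<Union>i<k. {t. \<not> isCont (f i) t})"
    by (intro finite_UN_I finite_discontinuities) auto
  then have "infinite ({c<..<d} - (\<Union>i<k. {t. \<not> isCont (f i) t}))"
    using cd(2) by (intro Diff_infinite_finite) auto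
  then obtain p where "p \<in> {c<..<d} - (\<Union>i<k. {t. \<not> isCont (f i) t})"
    using infinite_imp_nonempty by blast
  then have p: "c < p" "p < d" "\<And>i. i < k \<Longrightarrow> isCont (f i) p" by auto
  have fib: "A t y \<longleftrightarrow> (\<exists>i<k. y = f i t)" if "c < t" "t < d" for t y
    using elt_eqI[OF fin, of y t] elt_in[OF fin, of _ t] rnk_less_card[OF fin, of y t] cd(4)[OF that]
    unfolding f_def by auto
  obtain g where g: "g > 0" "\<And>y y'. A p y \<Longrightarrow> A p y' \<Longrightarrow> \<bar>y - y'\<bar> < g \<Longrightarrow> y = y'"
    using finite_separated[OF fin[of p]] by auto
  have finj: "i = j" if "f i p = f j p" "i < k" "j < k" for i j
    using that rnk_elt[OF fin, of _ p] cd(4)[OF p(1,2)] unfolding f_def by metis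
  \<comment> \<open>With tolerance \<open>g / 3\<close>, a value \<open>f j u\<close> close to both
    \<open>f j p\<close> and \<open>f i p\<close> puts these two at distance less than
    \<open>2 * g / 3\<close>, so they coincide by the choice of \<open>g\<close>.\<close>
  have "\<forall>i<k. \<exists>d>0. \<forall>u. \<bar>u - p\<bar> < d \<longrightarrow> \<bar>f i u - f i p\<bar> < g / 3"
    using p(3) g(1) unfolding isCont_iff_dist by (meson divide_pos_pos zero_less_numeral)
  then obtain \<delta> where \<delta>: "\<And>i. i < k \<Longrightarrow> \<delta> i > 0"
    "\<And>i u. i < k \<Longrightarrow> \<bar>u - p\<bar> < \<delta> i \<Longrightarrow> \<bar>f i u - f i p\<bar> < g / 3"
    by metis
  define r where "r = Min (insert (min (p - c) (d - p)) (\<delta> ` {..<k}))"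
  have r: "r > 0" unfolding r_def using p(1,2) \<delta>(1) by (subst Min_gr_iff) auto
  have r_le: "r \<le> min (p - c) (d - p)" "\<And>i. i < k \<Longrightarrow> r \<le> \<delta> i"
    unfolding r_def by (rule Min_le; simp)+
  have "matched (g / 3) (A p) (A u)" if u: "\<bar>u - p\<bar> < r" for u
  proof -
    have near: "\<bar>f i u - f i p\<bar> < g / 3" if "i < k" for i
      using \<delta>(2)[OF that, of u] u r_le(2)[OF that] by linarith
    have A: "A u y \<longleftrightarrow> (\<exists>i<k. y = f i u)" "A p y \<longleftrightarrow> (\<exists>i<k. y = f i p)" for y
      using u r_le(1) p by (auto intro!: fib)
    have sep: "i = j" if "i < k" "j < k" "\<bar>f i p - f j u\<bar> < g / 3" for i j
    proof -
      have "\<bar>f i p - f j p\<bar> < g" using near[OF that(2)] that(3) g(1) by linarith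
      then have "f i p = f j p" using A(2) that(1,2) by (intro g(2)) blast+
      then show ?thesis using finj that by blast
    qed
    show ?thesis
      unfolding matched_def A
    proof (intro conjI allI impI)
      fix y assume "\<exists>i<k. y = f i p"
      then obtain i where i: "i < k" "y = f i p" by blast
      show "\<exists>!y'. (\<exists>i<k. y' = f i u) \<and> \<bar>y - y'\<bar> < g / 3"
        using i near[OF i(1)] sep[OF i(1)] by (intro ex1I[of _ "f i u"]) (auto simp: abs_minus_commute)
    next
      fix y' assume "\<exists>i<k. y' = f i u"
      then obtain i where i: "i < k" "y' = f i u" by blast
      show "\<exists>!y. (\<exists>i<k. y = f i p) \<and> \<bar>y - y'\<bar> < g / 3"
        using i near[OF i(1)] sep[OF _ i(1)] by (intro ex1I[of _ "f i p"]) (auto simp: abs_minus_commute)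
    qed
  qed
  then have "\<not> bad A p" unfolding bad_def using g(1) r by (metis divide_pos_pos zero_less_numeral)
  moreover have "bad A p" using p cd by (intro e(2)) auto
  ultimately show False by blast
qed

text \<open>The induction on the number of parameters replaces the fibre over the last parameter by the
  fibres over finitely many test values, one in each component of the complement of \<open>bad\<close>.\<close>

theorem uniform_finiteness:
  assumes "dfam R" "\<And>z. finite {t. R z t}"
  shows "\<exists>N. \<forall>z. card {t. R z t} \<le> N"
proof -
  have *: "\<exists>N. \<forall>z. card {t. R z t} \<le> N"
    if "dfam R" "\<And>z. finite {t. R z t}" "\<And>z. R z = R (cut n z)" for n R
    using that
  proof (induction n arbitrary: R)
    case 0
    have "cut 0 z = (\<lambda>_. 0)" for z by (simp add: cut_def)
    then have "card {t. R z t} \<le> card {t. R (\<lambda>_. 0) t}" for z using 0(3)[of z] by simp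
    then show ?case by blast
  next
    case (Suc n)
    note R = dfamD[OF Suc.prems(1)]
    define B where "B w x \<longleftrightarrow> bad (\<lambda>x y. R (x ## w) y) x" for w x
    \<comment> \<open>Test values: the bad points and at least one point in every component of their
      complement. \<open>R'\<close> collects the fibres over them, a finite union with one parameter
      fewer.\<close>
    define T where "T w t \<longleftrightarrow> B w t \<or> t = 0 \<or> (\<exists>a. B w a \<and> (t = a + 1 \<or> t = a - 1)) \<or>
      (\<exists>a. B w a \<and> (\<exists>b. B w b \<and> t = (a + b) / 2))" for w t
    define R' where "R' w y \<longleftrightarrow> (\<exists>t. T w t \<and> R (t ## w) y)" for w y
    have B: "dfam B" unfolding B_def by (rule dfam_bad[OF Suc.prems(1)])
    have "dfam T" unfolding dfam_def T_def by (intro dpred_intros dfamD[OF B])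
    then have R': "dfam R'" unfolding dfam_def[of R'] R'_def by (intro dpred_intros R dfamD)
    have finB: "finite {x. B w x}" for w
      unfolding B_def
    proof (rule finite_bad)
      show "dfam (\<lambda>z. R (z 0 ## w))" unfolding dfam_def by (intro dpred_intros R)
    qed (rule Suc.prems(2))
    have finT: "finite {t. T w t}" for w
    proof (rule finite_subset)
      let ?B = "{x. B w x}"
      show "finite (?B \<union> {0} \<union> (\<lambda>a. a + 1) ` ?B \<union> (\<lambda>a. a - 1) ` ?B \<union> (\<lambda>(a, b). (a + b) / 2) ` (?B \<times> ?B))"
        using finB by simp
      show "{t. T w t} \<subseteq> ?B \<union> {0} \<union> (\<lambda>a. a + 1) ` ?B \<union> (\<lambda>a. a - 1) ` ?B \<union> (\<lambda>(a, b). (a + b) / 2) ` (?B \<times> ?B)"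
        unfolding T_def by force
    qed
    have finR': "finite {y. R' w y}" for w
    proof -
      have "{y. R' w y} = (\<Union>t\<in>{t. T w t}. {y. R (t ## w) y})" unfolding R'_def by auto
      then show ?thesis using finT Suc.prems(2) by simp
    qed
    have "R (t ## w) = R (t ## cut n w)" for t w
      using Suc.prems(3)[of "t ## w"] by (simp add: cut_scons)
    then have "R' w = R' (cut n w)" for w
      unfolding R'_def T_def B_def by presburger
    then obtain N where N: "\<And>w. card {y. R' w y} \<le> N"
      using Suc.IH[OF R' finR'] by blast
    have T_le: "card {y. R (t ## w) y} \<le> N" if "T w t" for t w
    proof -
      have "card {y. R (t ## w) y} \<le> card {y. R' w y}"
        using that by (intro card_mono finR') (auto simp: R'_def)
      with N show ?thesis using le_trans by blast
    qed
    have "card {y. R (x ## w) y} \<le> N" for x w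
    proof (cases "B w x")
      case True
      then show ?thesis by (intro T_le) (simp add: T_def)
    next
      case False
      then obtain t where t: "t = 0 \<or> (\<exists>a\<in>{x. B w x}. t = a + 1 \<or> t = a - 1) \<or>
          (\<exists>a\<in>{x. B w x}. \<exists>b\<in>{x. B w x}. t = (a + b) / 2)" "{min x t..max x t} \<inter> {x. B w x} = {}"
        using finite_test_point[OF finB[of w], of x] by (metis mem_Collect_eq)
      \<comment> \<open>Off the bad points the cardinality is locally constant, so \<open>x\<close>
        shares it with the test value of its component.\<close>
      have "{min x t..max x t} \<inter> brk (\<lambda>x. card {y. R (x ## w) y}) = {}"
        using t(2) brk_card_bad[of "\<lambda>x y. R (x ## w) y"] unfolding B_def by blast
      then have "card {y. R (min x t ## w) y} = card {y. R (max x t ## w) y}"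
        by (intro brk_const[of "min x t" "max x t" "\<lambda>x. card {y. R (x ## w) y}"]) auto
      then have "card {y. R (x ## w) y} = card {y. R (t ## w) y}"
        by (cases "x \<le> t") (auto simp: min_def max_def)
      moreover have "T w t" using t(1) unfolding T_def by blast
      ultimately show ?thesis using T_le by simp
    qed
    then have "card {y. R z y} \<le> N" for z using scons_tail[of z] by metis
    then show ?case by blast
  qed
  define P where "P s = R (\<lambda>i. s (Suc i)) (s 0)" for s
  have "dpred P" using assms(1) unfolding dfam_def P_def .
  then obtain n0 where "\<And>n x. n \<ge> n0 \<Longrightarrow> P (cut n x) = P x"
    using dpredE[of P] by metis
  \<comment> \<open>One coordinate is the fibre variable, so \<open>Suc n0\<close> coordinates leave
    \<open>n0\<close> parameters.\<close>
  then have m: "P (cut (Suc n0) s) = P s" for s by simp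
  have "R z t = R (cut n0 z) t" for z t
    using m[of "t ## z"] unfolding cut_scons P_def by simp
  then have "R z = R (cut n0 z)" for z by (rule ext)
  from *[OF assms this] show ?thesis .
qed

text \<open>The level sets are first-order by \<open>dpred_card_eq\<close>; uniform finiteness
  supplies the finite range.\<close>

lemma cfun_card:
  assumes "dfam R" "\<And>z. finite {t. R z t}"
  shows "cfun (\<lambda>z. card {t. R z t})"
proof -
  obtain N where "\<forall>z. card {t. R z t} \<le> N" using uniform_finiteness[OF assms] ..
  then have "range (\<lambda>z. card {t. R z t}) \<subseteq> {..N}" by auto
  then have "finite (range (\<lambda>z. card {t. R z t}))" using finite_subset by blast
  then show ?thesis unfolding cfun_def using dpred_card_eq[OF assms] by blast
qed

end

subsection \<open>The Euler integral on the line\<close>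

text \<open>One-sided values exist for tame functions. They give the Euler integral without a choice
  of partition, which makes its additivity a termwise matter.\<close>

definition rl :: "(real \<Rightarrow> int) \<Rightarrow> real \<Rightarrow> int" where
  "rl g p = (THE v. \<exists>q>p. \<forall>s. p < s \<and> s < q \<longrightarrow> g s = v)"

definition ml :: "(real \<Rightarrow> int) \<Rightarrow> int" where
  "ml g = (THE v. \<exists>q. \<forall>s<q. g s = v)"

text \<open>Each point \<open>p\<close> contributes \<open>g p\<close>, the interval to its right \<open>- g(p+)\<close>, and the leftmost
  interval \<open>- g(-\<infinity>)\<close>.\<close>

definition eul :: "(real \<Rightarrow> int) \<Rightarrow> int" where
  "eul g = (\<Sum>p | g p \<noteq> rl g p. g p - rl g p) - ml g"

lemma rl_eqI:
  assumes "\<exists>q>p. \<forall>s. p < s \<and> s < q \<longrightarrow> g s = v"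
  shows "rl g p = v"
  unfolding rl_def
proof (rule the_equality[where P = "\<lambda>v. \<exists>q>p. \<forall>s. p < s \<and> s < q \<longrightarrow> g s = v", OF assms])
  fix w assume "\<exists>q>p. \<forall>s. p < s \<and> s < q \<longrightarrow> g s = w"
  then obtain q where q: "q > p" "\<forall>s. p < s \<and> s < q \<longrightarrow> g s = w" by blast
  obtain q' where q': "q' > p" "\<forall>s. p < s \<and> s < q' \<longrightarrow> g s = v" using assms by blast
  have "p < (p + min q q') / 2" "(p + min q q') / 2 < q" "(p + min q q') / 2 < q'"
    using q(1) q'(1) by (auto simp: min_def)
  then show "w = v" using q(2) q'(2) by metis
qed

lemma ml_eqI:
  assumes "\<exists>q. \<forall>s<q. g s = v"
  shows "ml g = v"
  unfolding ml_def
proof (rule the_equality[where P = "\<lambda>v. \<exists>q. \<forall>s<q. g s = v", OF assms])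
  fix w assume "\<exists>q. \<forall>s<q. g s = w"
  then obtain q where q: "\<forall>s<q. g s = w" by blast
  obtain q' where q': "\<forall>s<q'. g s = v" using assms by blast
  have "min q q' - 1 < q" "min q q' - 1 < q'" by auto
  then show "w = v" using q q' by metis
qed

lemma rl_tame: "tame g \<Longrightarrow> \<exists>q>p. \<forall>s. p < s \<and> s < q \<longrightarrow> g s = rl g p"
proof -
  assume "tame g"
  then obtain v q where "q > p" "\<And>s. p < s \<Longrightarrow> s < q \<Longrightarrow> g s = v"
    using tame_right_germ by metis
  then have *: "\<exists>q>p. \<forall>s. p < s \<and> s < q \<longrightarrow> g s = v" by blast
  show ?thesis unfolding rl_eqI[OF *] by (rule *)
qed

lemma ml_tame: "tame g \<Longrightarrow> \<exists>q. \<forall>s<q. g s = ml g"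
proof -
  assume g: "tame g"
  define q where "q = Min (insert 0 (brk g)) - 1"
  have fin: "finite (insert 0 (brk g))" using g by (simp add: tame_def)
  have q: "q < p" if "p \<in> brk g" for p
    using Min_le[OF fin, of p] that by (simp add: q_def)
  have "\<forall>s<q. g s = g q"
  proof (intro allI impI brk_const)
    fix s assume "s < q"
    show "{s..q} \<inter> brk g = {}" using q by fastforce
  qed simp
  then have *: "\<exists>q. \<forall>s<q. g s = g q'" if "q' = q" for q' using that by blast
  show ?thesis unfolding ml_eqI[OF *[OF refl]] using *[OF refl] .
qed

text \<open>Any finite set off which there is no jump may replace the exact set of jumps, so two
  functions can be compared over a common one.\<close>

lemma eul_eqI:
  assumes "finite F" and r: "\<And>p. \<exists>q>p. \<forall>s. p < s \<and> s < q \<longrightarrow> g s = r p"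
    and F: "\<And>p. p \<notin> F \<Longrightarrow> g p = r p" and m: "\<exists>q. \<forall>s<q. g s = m"
  shows "eul g = (\<Sum>p\<in>F. g p - r p) - m"
proof -
  have "rl g p = r p" for p by (rule rl_eqI[OF r])
  moreover have "(\<Sum>p | g p \<noteq> r p. g p - r p) = (\<Sum>p\<in>F. g p - r p)"
    using assms(1) F by (intro sum.mono_neutral_left) auto
  ultimately show ?thesis unfolding eul_def using ml_eqI[OF m] by simp
qed

lemma rl_not_brk: "tame g \<Longrightarrow> p \<notin> brk g \<Longrightarrow> g p = rl g p"
proof (rule rl_eqI[symmetric])
  assume "p \<notin> brk g"
  then obtain e where e: "e > 0" "\<And>s. \<bar>s - p\<bar> < e \<Longrightarrow> g s = g p" unfolding not_brk_iff by blast
  show "\<exists>q>p. \<forall>s. p < s \<and> s < q \<longrightarrow> g s = g p"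
  proof (intro exI[of _ "p + e"] conjI allI impI)
    fix s assume "p < s \<and> s < p + e"
    then show "g s = g p" by (intro e(2)) auto
  qed (use e(1) in simp)
qed

lemma eul_tame:
  assumes "tame g" "finite F" "brk g \<subseteq> F"
  shows "eul g = (\<Sum>p\<in>F. g p - rl g p) - ml g"
  using assms by (intro eul_eqI rl_tame ml_tame rl_not_brk) auto

lemma eul_add:
  assumes f: "tame f" and g: "tame g"
  shows "eul (\<lambda>t. f t + g t) = eul f + eul g"
proof -
  let ?F = "brk f \<union> brk g"
  have fin: "finite ?F" using f g by (simp add: tame_def)
  have "eul (\<lambda>t. f t + g t) = (\<Sum>p\<in>?F. (f p + g p) - (rl f p + rl g p)) - (ml f + ml g)"
  proof (rule eul_eqI[OF fin])
    fix p
    obtain q where q: "q > p" "\<forall>s. p < s \<and> s < q \<longrightarrow> f s = rl f p" using rl_tame[OF f] by blast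
    obtain q' where q': "q' > p" "\<forall>s. p < s \<and> s < q' \<longrightarrow> g s = rl g p" using rl_tame[OF g] by blast
    show "\<exists>q>p. \<forall>s. p < s \<and> s < q \<longrightarrow> f s + g s = rl f p + rl g p"
      using q q' by (intro exI[of _ "min q q'"]) simp
    show "f p + g p = rl f p + rl g p" if "p \<notin> ?F"
      using that rl_not_brk[OF f, of p] rl_not_brk[OF g, of p] by simp
  next
    obtain q where q: "\<forall>s<q. f s = ml f" using ml_tame[OF f] by blast
    obtain q' where q': "\<forall>s<q'. g s = ml g" using ml_tame[OF g] by blast
    show "\<exists>q. \<forall>s<q. f s + g s = ml f + ml g"
      using q q' by (intro exI[of _ "min q q'"]) simp
  qed
  also have "\<dots> = eul f + eul g"
    using eul_tame[OF f fin] eul_tame[OF g fin] by (simp add: sum.distrib sum_subtractf)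
  finally show ?thesis .
qed

lemma eul_cmult:
  assumes g: "tame g"
  shows "eul (\<lambda>t. k * g t) = k * eul g"
proof -
  have fin: "finite (brk g)" using g by (simp add: tame_def)
  have "eul (\<lambda>t. k * g t) = (\<Sum>p\<in>brk g. k * g p - k * rl g p) - k * ml g"
  proof (rule eul_eqI[OF fin])
    show "\<exists>q>p. \<forall>s. p < s \<and> s < q \<longrightarrow> k * g s = k * rl g p" for p using rl_tame[OF g, of p] by metis
    show "k * g p = k * rl g p" if "p \<notin> brk g" for p using rl_not_brk[OF g that] by simp
    show "\<exists>q. \<forall>s<q. k * g s = k * ml g" using ml_tame[OF g] by metis
  qed
  also have "\<dots> = k * eul g"
    using eul_tame[OF g fin] by (simp add: sum_distrib_left right_diff_distrib)
  finally show ?thesis .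
qed

lemma eul_const: "eul (\<lambda>t. k) = - k"
  by (subst eul_eqI[of "{}" _ "\<lambda>_. k" k]) (auto intro: gt_ex)

lemma eul_zero [simp]: "eul (\<lambda>t. 0) = 0"
  by (simp add: eul_const)

lemma eul_point: "eul (\<lambda>t. of_bool (t = a)) = 1"
proof -
  have "eul (\<lambda>t. of_bool (t = a)) = (\<Sum>p\<in>{a}. of_bool (p = a) - 0) - 0"
  proof (rule eul_eqI)
    fix p :: real
    show "\<exists>q>p. \<forall>s. p < s \<and> s < q \<longrightarrow> of_bool (s = a) = (0 :: int)"
      by (intro exI[of _ "if p < a then a else p + 1"]) auto
  next
    show "\<exists>q. \<forall>s<q. of_bool (s = a) = (0 :: int)" by (intro exI[of _ a]) auto
  qed auto
  then show ?thesis by simp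
qed

section \<open>Open intervals and their Euler integrals\<close>

definition ival :: "real set \<Rightarrow> bool" where
  "ival S \<longleftrightarrow> open S \<and> is_interval S"

lemma ival_cases:
  assumes "ival S" "S \<noteq> {}"
  obtains "S = UNIV" | b where "S = {..<b}" | a where "S = {a<..}" | a b where "a < b" "S = {a<..<b}"
proof -
  have up: "\<exists>y\<in>S. x < y" and dn: "\<exists>y\<in>S. y < x" if x: "x \<in> S" for x
  proof -
    have "\<exists>e>0. \<forall>y. dist y x < e \<longrightarrow> y \<in> S"
      using assms(1) x unfolding ival_def open_dist by blast
    then obtain e where e: "e > 0" "\<And>y. \<bar>y - x\<bar> < e \<Longrightarrow> y \<in> S" by (auto simp: dist_real_def)
    show "\<exists>y\<in>S. x < y" using e(1) by (intro bexI[of _ "x + e / 2"] e(2)) auto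
    show "\<exists>y\<in>S. y < x" using e(1) by (intro bexI[of _ "x - e / 2"] e(2)) auto
  qed
  have "\<exists>a b. S = {} \<or> S = UNIV \<or> S = {..<b} \<or> S = {..b} \<or> S = {a<..} \<or> S = {a..} \<or>
    S = {a<..<b} \<or> S = {a<..b} \<or> S = {a..<b} \<or> S = {a..b}"
  proof (rule interval_cases)
    fix a b x assume "a \<in> S" "b \<in> S" "a \<le> x" "x \<le> b"
    then show "x \<in> S" using assms(1) unfolding ival_def is_interval_1 by blast
  qed
  then obtain a b where "S = {} \<or> S = UNIV \<or> S = {..<b} \<or> S = {..b} \<or> S = {a<..} \<or> S = {a..} \<or>
    S = {a<..<b} \<or> S = {a<..b} \<or> S = {a..<b} \<or> S = {a..b}" by (elim exE)
  moreover have "S \<noteq> {..b}" using up[of b] by auto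
  moreover have "S \<noteq> {a..}" using dn[of a] by auto
  moreover have "S \<noteq> {a<..b}"
  proof
    assume S: "S = {a<..b}"
    then have "b \<in> S" using assms(2) by auto
    then show False using up[of b] S by auto
  qed
  moreover have "S \<noteq> {a..<b}"
  proof
    assume S: "S = {a..<b}"
    then have "a \<in> S" using assms(2) by auto
    then show False using dn[of a] S by auto
  qed
  moreover have "S \<noteq> {a..b}"
  proof
    assume S: "S = {a..b}"
    then have "a \<in> S" using assms(2) by auto
    then show False using dn[of a] S by auto
  qed
  moreover have "S = {a<..<b} \<Longrightarrow> a < b" using assms(2) by auto
  ultimately show ?thesis using that assms(2) by blast
qed

lemma eul_ival:
  assumes "ival S"
  shows "eul (\<lambda>t. of_bool (t \<in> S)) = - of_bool (S \<noteq> {})"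
proof (cases "S = {}")
  case False
  from assms False have "eul (\<lambda>t. of_bool (t \<in> S)) = - 1"
  proof (cases rule: ival_cases)
    case 1
    then show ?thesis by (simp add: eul_const)
  next
    case (2 b)
    have "eul (\<lambda>t. of_bool (t < b)) = (\<Sum>p\<in>{}. of_bool (p < b) - of_bool (p < b)) - 1"
    proof (rule eul_eqI)
      fix p :: real
      show "\<exists>q>p. \<forall>s. p < s \<and> s < q \<longrightarrow> of_bool (s < b) = (of_bool (p < b) :: int)"
        by (intro exI[of _ "if p < b then b else p + 1"]) auto
    qed (auto intro: exI[of _ b])
    then show ?thesis by (simp add: 2)
  next
    case (3 a)
    \<comment> \<open>The only jump is at the left end point, where the value is \<open>0\<close>
      and the right germ \<open>1\<close>.\<close>
    have "eul (\<lambda>t. of_bool (a < t)) = (\<Sum>p\<in>{a}. of_bool (a < p) - of_bool (a \<le> p)) - 0"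
    proof (rule eul_eqI)
      fix p :: real
      show "\<exists>q>p. \<forall>s. p < s \<and> s < q \<longrightarrow> of_bool (a < s) = (of_bool (a \<le> p) :: int)"
        by (intro exI[of _ "if p < a then a else p + 1"]) auto
    qed (auto intro: exI[of _ a])
    then show ?thesis by (simp add: 3)
  next
    case (4 a b)
    have "eul (\<lambda>t. of_bool (a < t \<and> t < b)) =
      (\<Sum>p\<in>{a}. of_bool (a < p \<and> p < b) - of_bool (a \<le> p \<and> p < b)) - 0"
    proof (rule eul_eqI)
      fix p :: real
      show "\<exists>q>p. \<forall>s. p < s \<and> s < q \<longrightarrow> of_bool (a < s \<and> s < b) = (of_bool (a \<le> p \<and> p < b) :: int)"
        by (intro exI[of _ "if p < a then a else if p < b then b else p + 1"]) (use 4 in auto)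
    qed (auto intro: exI[of _ a])
    then show ?thesis using 4 by simp
  qed
  with False show ?thesis by simp
qed simp

lemma eul_neg_ival:
  assumes "ival S"
  shows "eul (\<lambda>t. - of_bool (t \<in> S)) = of_bool (S \<noteq> {})"
proof -
  have "is_interval S" using assms by (simp add: ival_def)
  from eul_cmult[OF tame_map[OF tame_interval[OF this], of of_bool], of "- 1"]
  show ?thesis using eul_ival[OF assms] by (simp del: of_bool_eq)
qed

section \<open>Euler integrals depending on parameters\<close>

context o_minimal_structure
begin

text \<open>Grouped by value, the sum becomes a fixed finite combination of cardinalities of fibres,
  which are constructible by uniform finiteness.\<close>

lemma cfun_finite_sum:
  fixes j :: "(nat \<Rightarrow> real) \<Rightarrow> real \<Rightarrow> int"
  assumes j: "cfam j" and fin: "\<And>z. finite {p. j z p \<noteq> 0}"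
  shows "cfun (\<lambda>z. \<Sum>p | j z p \<noteq> 0. j z p)"
proof -
  let ?V = "range (\<lambda>s. j (\<lambda>i. s (Suc i)) (s 0)) - {0}"
  have V: "finite ?V" using j by (simp add: cfam_def cfun_def)
  have jV: "j z p \<in> ?V" if "j z p \<noteq> 0" for z p
    using that by (auto intro!: range_eqI[of _ _ "p ## z"])
  have *: "(\<Sum>p | j z p \<noteq> 0. j z p) = (\<Sum>v\<in>?V. v * int (card {p. j z p = v}))" for z
  proof -
    have "(\<Sum>p | j z p \<noteq> 0. j z p) = (\<Sum>v\<in>?V. \<Sum>p\<in>{p \<in> {p. j z p \<noteq> 0}. j z p = v}. j z p)"
      by (rule sum.group[symmetric, OF fin V]) (intro image_subsetI jV, simp)
    also have "\<dots> = (\<Sum>v\<in>?V. v * int (card {p. j z p = v}))"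
    proof (rule sum.cong[OF refl])
      fix v assume "v \<in> ?V"
      then have "{p \<in> {p. j z p \<noteq> 0}. j z p = v} = {p. j z p = v}" by auto
      then show "(\<Sum>p\<in>{p \<in> {p. j z p \<noteq> 0}. j z p = v}. j z p) = v * int (card {p. j z p = v})"
        by simp
    qed
    finally show ?thesis .
  qed
  have "cfun (\<lambda>z. int (card {p. j z p = v}))" if "v \<in> ?V" for v
  proof (rule cfun_map[OF cfun_card])
    show "dfam (\<lambda>z p. j z p = v)"
      using j unfolding cfam_def dfam_def cfun_def by blast
    have "v \<noteq> 0" using that by simp
    then show "finite {p. j z p = v}" for z by (intro finite_subset[OF _ fin[of z]]) auto
  qed
  then show ?thesis unfolding * using V by (intro cfun_intros)
qed

lemma cfam_range:
  assumes "cfam c"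
  obtains V where "finite V" "\<And>z t. c z t \<in> V"
proof -
  have "c z t \<in> range (\<lambda>s. c (\<lambda>i. s (Suc i)) (s 0))" for z t
    by (auto intro!: range_eqI[of _ _ "t ## z"])
  with that assms show ?thesis unfolding cfam_def cfun_def by blast
qed

lemma cfam_eq: "cfam c \<Longrightarrow> dseq w \<Longrightarrow> dfun e \<Longrightarrow> dpred (\<lambda>x. c (w x) (e x) = k)"
  using cfamD[of c w e] unfolding cfun_def by blast

lemma cfam_rl:
  assumes c: "cfam c"
  shows "cfam (\<lambda>z p. rl (c z) p)"
proof -
  have iff: "rl (c z) p = v \<longleftrightarrow> (\<exists>q. q > p \<and> (\<forall>s. p < s \<and> s < q \<longrightarrow> c z s = v))" for z p v
    using rl_tame[OF cfam_tame[OF c], of p z] rl_eqI[of p "c z" v] by blast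
  obtain V where V: "finite V" "\<And>z t. c z t \<in> V" using cfam_range[OF c] by blast
  have "rl (c z) p \<in> V" for z p
  proof -
    obtain q where q: "q > p" "\<forall>s. p < s \<and> s < q \<longrightarrow> c z s = rl (c z) p"
      using rl_tame[OF cfam_tame[OF c]] by blast
    then have "c z ((p + q) / 2) = rl (c z) p" by auto
    then show ?thesis using V(2) by metis
  qed
  then have "finite (range (\<lambda>s. rl (c (\<lambda>i. s (Suc i))) (s 0)))"
    by (intro finite_subset[OF _ V(1)]) auto
  moreover have "dpred (\<lambda>s. rl (c (\<lambda>i. s (Suc i))) (s 0) = v)" for v
    unfolding iff by (intro dpred_intros cfam_eq[OF c])
  ultimately show ?thesis unfolding cfam_def cfun_def by blast
qed

lemma cfun_ml:
  assumes c: "cfam c"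
  shows "cfun (\<lambda>z. ml (c z))"
proof -
  have iff: "ml (c z) = v \<longleftrightarrow> (\<exists>q. \<forall>s. s < q \<longrightarrow> c z s = v)" for z v
    using ml_tame[OF cfam_tame[OF c], of z] ml_eqI[of "c z" v] by blast
  obtain V where V: "finite V" "\<And>z t. c z t \<in> V" using cfam_range[OF c] by blast
  have "ml (c z) \<in> V" for z
  proof -
    obtain q where "\<forall>s<q. c z s = ml (c z)" using ml_tame[OF cfam_tame[OF c]] by blast
    then have "c z (q - 1) = ml (c z)" by simp
    then show ?thesis using V(2) by metis
  qed
  then have "finite (range (\<lambda>z. ml (c z)))"
    by (intro finite_subset[OF _ V(1)]) auto
  moreover have "dpred (\<lambda>z. ml (c z) = v)" for v
    unfolding iff by (intro dpred_intros cfam_eq[OF c])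
  ultimately show ?thesis unfolding cfun_def by blast
qed

text \<open>Integrating out one variable preserves constructibility; this is what allows integrals
  to be iterated.\<close>

lemma cfun_eul:
  assumes c: "cfam c"
  shows "cfun (\<lambda>z. eul (c z))"
proof -
  let ?j = "\<lambda>z p. c z p - rl (c z) p"
  have "cfam ?j" using cfun_diff[OF c[unfolded cfam_def] cfam_rl[OF c, unfolded cfam_def]]
    unfolding cfam_def .
  moreover have "finite {p. ?j z p \<noteq> 0}" for z
    using rl_not_brk[OF cfam_tame[OF c]] by (intro finite_subset[OF _ finite_brk[OF c, of z]]) auto
  ultimately have "cfun (\<lambda>z. \<Sum>p | ?j z p \<noteq> 0. ?j z p)" by (rule cfun_finite_sum)
  from cfun_diff[OF this cfun_ml[OF c]] show ?thesis by (simp add: eul_def)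
qed

subsection \<open>Fubini in the plane\<close>

definition univ :: "(real \<Rightarrow> 'b) \<Rightarrow> bool" where
  "univ u \<longleftrightarrow> cfun (\<lambda>s. u (s 0))"

definition planar :: "(real \<Rightarrow> real \<Rightarrow> 'b) \<Rightarrow> bool" where
  "planar g \<longleftrightarrow> cfun (\<lambda>s. g (s 0) (s 1))"

lemma univD: "univ u \<Longrightarrow> dfun e \<Longrightarrow> cfun (\<lambda>x. u (e x))"
  unfolding univ_def using cfun_comp[of "\<lambda>s. u (s 0)" "\<lambda>x i. e x"] by (simp add: dseq_def)

lemma planarD: "planar g \<Longrightarrow> dfun e1 \<Longrightarrow> dfun e2 \<Longrightarrow> cfun (\<lambda>x. g (e1 x) (e2 x))"
  unfolding planar_def
  using cfun_comp[of "\<lambda>s. g (s 0) (s 1)" "\<lambda>x. e1 x ## e2 x ## (\<lambda>_. 0)"]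
  by (simp add: dseq_scons dseq_const)

lemma univ_tame: "univ u \<Longrightarrow> tame u"
  unfolding univ_def by (rule cfun_tame)

lemma planar_fibres:
  assumes "planar g"
  shows "cfam (\<lambda>z. g (z 0))" "cfam (\<lambda>z x. g x (z 0))" "univ (g x)" "univ (\<lambda>x. g x y)"
  unfolding cfam_def univ_def by (intro planarD[OF assms] dpred_intros)+

lemma planar_eul:
  assumes "planar g"
  shows "univ (\<lambda>x. eul (g x))" "univ (\<lambda>y. eul (\<lambda>x. g x y))"
  unfolding univ_def using planar_fibres[OF assms] by (auto intro: cfun_eul)

definition fubini :: "(real \<Rightarrow> real \<Rightarrow> int) \<Rightarrow> bool" where
  "fubini g \<longleftrightarrow> planar g \<and> eul (\<lambda>x. eul (g x)) = eul (\<lambda>y. eul (\<lambda>x. g x y))"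

lemma fubini_add:
  assumes "fubini f" "fubini g"
  shows "fubini (\<lambda>x y. f x y + g x y)"
proof -
  have f: "planar f" and g: "planar g" using assms by (auto simp: fubini_def)
  have "planar (\<lambda>x y. f x y + g x y)"
    unfolding planar_def by (intro cfun_intros planarD[OF f] planarD[OF g] dpred_intros)
  moreover have "eul (\<lambda>y. f x y + g x y) = eul (f x) + eul (g x)"
    "eul (\<lambda>x. f x y + g x y) = eul (\<lambda>x. f x y) + eul (\<lambda>x. g x y)" for x y
    by (intro eul_add univ_tame planar_fibres f g)+
  moreover note eul_add[OF planar_eul(1)[OF f, THEN univ_tame] planar_eul(1)[OF g, THEN univ_tame]]
    eul_add[OF planar_eul(2)[OF f, THEN univ_tame] planar_eul(2)[OF g, THEN univ_tame]]
  ultimately show ?thesis using assms by (simp add: fubini_def)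
qed

lemma fubini_cmult:
  assumes "fubini g"
  shows "fubini (\<lambda>x y. k * g x y)"
proof -
  have g: "planar g" using assms by (auto simp: fubini_def)
  have "planar (\<lambda>x y. k * g x y)"
    unfolding planar_def by (intro cfun_intros planarD[OF g] dpred_intros)
  moreover have "eul (\<lambda>y. k * g x y) = k * eul (g x)"
    "eul (\<lambda>x. k * g x y) = k * eul (\<lambda>x. g x y)" for x y
    by (intro eul_cmult univ_tame planar_fibres g)+
  moreover note eul_cmult[OF planar_eul(1)[OF g, THEN univ_tame]]
    eul_cmult[OF planar_eul(2)[OF g, THEN univ_tame]]
  ultimately show ?thesis using assms by (simp add: fubini_def)
qed

lemma fubini_diff: "fubini f \<Longrightarrow> fubini g \<Longrightarrow> fubini (\<lambda>x y. f x y - g x y)"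
  using fubini_add[OF _ fubini_cmult[of g "-1"], of f] by simp

lemma fubini_prod:
  assumes u: "univ u" and w: "univ w"
  shows "fubini (\<lambda>x y. u x * w y)"
proof -
  have "planar (\<lambda>x y. u x * w y)"
    unfolding planar_def by (intro cfun_intros univD[OF u] univD[OF w] dpred_intros)
  moreover have "eul (\<lambda>y. u x * w y) = eul w * u x" "eul (\<lambda>x. u x * w y) = eul u * w y" for x y
    using eul_cmult[OF univ_tame[OF w]] eul_cmult[OF univ_tame[OF u], of "w y"] by (simp_all add: mult.commute)
  moreover have "eul (\<lambda>x. eul w * u x) = eul w * eul u" "eul (\<lambda>y. eul u * w y) = eul u * eul w"
    by (intro eul_cmult univ_tame u w)+
  ultimately show ?thesis by (simp add: fubini_def)
qed

lemma fubini_zero: "fubini (\<lambda>x y. 0)"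
  by (simp add: fubini_def planar_def cfun_const)

lemma fubini_sum:
  assumes "finite I" "\<And>i. i \<in> I \<Longrightarrow> fubini (g i)"
  shows "fubini (\<lambda>x y. \<Sum>i\<in>I. g i x y)"
  using assms by (induction I) (auto intro: fubini_add fubini_zero)

text \<open>Both orders give \<open>1\<close> for a nonempty region and \<open>0\<close> for an
  empty one: integrating the fibres yields \<open>-1\<close> on the projection, and the projection,
  an open interval, contributes a second sign.\<close>

lemma fubini_ivals:
  assumes "planar P" "\<And>x. ival {y. P x y}" "\<And>y. ival {x. P x y}"
    "ival {x. \<exists>y. P x y}" "ival {y. \<exists>x. P x y}"
  shows "fubini (\<lambda>x y. of_bool (P x y))"
proof -
  have "planar (\<lambda>x y. of_bool (P x y) :: int)"
    using assms(1) unfolding planar_def by (rule cfun_map)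
  moreover have "eul (\<lambda>y. of_bool (P x y)) = - of_bool (x \<in> {x. \<exists>y. P x y})" for x
    using eul_ival[OF assms(2), of x] by auto
  moreover have "eul (\<lambda>x. of_bool (P x y)) = - of_bool (y \<in> {y. \<exists>x. P x y})" for y
    using eul_ival[OF assms(3), of y] by auto
  ultimately show ?thesis
    using eul_neg_ival[OF assms(4)] eul_neg_ival[OF assms(5)] unfolding fubini_def by auto
qed

end

lemma ival_ray: "ival {a<..}" "ival {..<a}" "ival UNIV" "ival {}"
  by (auto simp: ival_def is_interval_1)

lemma ival_Int: "ival S \<Longrightarrow> ival T \<Longrightarrow> ival (S \<inter> T)"
  by (auto simp: ival_def is_interval_Int)

text \<open>Continuity makes these sets open, monotonicity makes them order-convex.\<close>

lemma ival_preimage: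
  fixes f :: "real \<Rightarrow> real"
  assumes J: "ival J" and cont: "\<And>x. x \<in> J \<Longrightarrow> isCont f x"
    and mono: "mono_on J f \<or> mono_on J (\<lambda>t. - f t)"
  shows "ival {x. x \<in> J \<and> f x < y}" "ival {x. x \<in> J \<and> y < f x}"
proof -
  have c: "continuous_on J f" using cont by (simp add: continuous_at_imp_continuous_on)
  have m: "(f a \<le> f x \<and> f x \<le> f b) \<or> (f b \<le> f x \<and> f x \<le> f a)"
    if "a \<in> J" "b \<in> J" "a \<le> x" "x \<le> b" "x \<in> J" for a b x
    using mono
  proof
    assume "mono_on J f"
    then show ?thesis using that mono_onD[of J f a x] mono_onD[of J f x b] by simp
  next
    assume "mono_on J (\<lambda>t. - f t)"
    then have "- f a \<le> - f x" "- f x \<le> - f b"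
      using that mono_onD[of J "\<lambda>t. - f t" a x] mono_onD[of J "\<lambda>t. - f t" x b] by blast+
    then show ?thesis by linarith
  qed
  have J': "x \<in> J" if "a \<in> J" "b \<in> J" "a \<le> x" "x \<le> b" for a b x
    using J that unfolding ival_def is_interval_1 by blast
  have "open (J \<inter> f -` {..<y})" "open (J \<inter> f -` {y<..})"
    using J unfolding ival_def by (intro continuous_open_preimage[OF c]; simp)+
  moreover have "J \<inter> f -` {..<y} = {x. x \<in> J \<and> f x < y}" "J \<inter> f -` {y<..} = {x. x \<in> J \<and> y < f x}"
    by auto
  moreover have "f x < y" if "a \<in> J" "f a < y" "b \<in> J" "f b < y" "a \<le> x" "x \<le> b" for a b x
    using m[of a b x] J'[of a b x] that by auto
  then have "is_interval {x. x \<in> J \<and> f x < y}"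
    unfolding is_interval_1 using J' by (intro ballI allI impI CollectI) blast
  moreover have "y < f x" if "a \<in> J" "y < f a" "b \<in> J" "y < f b" "a \<le> x" "x \<le> b" for a b x
    using m[of a b x] J'[of a b x] that by auto
  then have "is_interval {x. x \<in> J \<and> y < f x}"
    unfolding is_interval_1 using J' by (intro ballI allI impI CollectI) blast
  ultimately show "ival {x. x \<in> J \<and> f x < y}" "ival {x. x \<in> J \<and> y < f x}"
    by (auto simp: ival_def)
qed

lemma ival_upper: "ival {y. \<exists>x\<in>J. f x < y}" "ival {y. \<exists>x\<in>J. y < f x}" for f :: "real \<Rightarrow> real"
proof -
  have "{y. \<exists>x\<in>J. f x < y} = (\<Union>x\<in>J. {f x<..})" "{y. \<exists>x\<in>J. y < f x} = (\<Union>x\<in>J. {..<f x})"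
    by auto
  then have "open {y. \<exists>x\<in>J. f x < y}" "open {y. \<exists>x\<in>J. y < f x}" by (auto intro!: open_UN)
  moreover have "is_interval {y. \<exists>x\<in>J. f x < y}" "is_interval {y. \<exists>x\<in>J. y < f x}"
    unfolding is_interval_1 by (auto intro: less_le_trans le_less_trans)
  ultimately show "ival {y. \<exists>x\<in>J. f x < y}" "ival {y. \<exists>x\<in>J. y < f x}" by (auto simp: ival_def)
qed

context o_minimal_structure
begin

text \<open>Where \<open>f\<close> is continuous and monotone, the region on either side of its
  graph has open intervals as fibres in both directions and as projections.\<close>

lemma fubini_region:
  assumes J: "ival J" "univ (\<lambda>x. x \<in> J)" and f: "dfun (\<lambda>s. f (s 0))"
    and cont: "\<And>x. x \<in> J \<Longrightarrow> isCont f x" and mono: "mono_on J f \<or> mono_on J (\<lambda>t. - f t)"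
  shows "fubini (\<lambda>x y. of_bool (x \<in> J \<and> f x < y))" "fubini (\<lambda>x y. of_bool (x \<in> J \<and> y < f x))"
proof -
  have dJ: "dpred (\<lambda>s. e s \<in> J)" if "dfun e" for e by (rule dpred_of_cfun[OF univD[OF J(2) that]])
  have *: "{y. x \<in> J \<and> f x < y} = (if x \<in> J then {f x<..} else {})"
    "{y. x \<in> J \<and> y < f x} = (if x \<in> J then {..<f x} else {})" for x by auto
  have ex: "(\<exists>y. x \<in> J \<and> f x < y) \<longleftrightarrow> x \<in> J" "(\<exists>y. x \<in> J \<and> y < f x) \<longleftrightarrow> x \<in> J" for x
    by (auto intro: gt_ex lt_ex)
  show "fubini (\<lambda>x y. of_bool (x \<in> J \<and> f x < y))"
  proof (rule fubini_ivals)
    show "planar (\<lambda>x y. x \<in> J \<and> f x < y)"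
      unfolding planar_def by (intro cfun_bool dpred_intros dJ dfun_of_real[OF f])
  qed (use ival_preimage[OF J(1) cont mono] ival_upper[of J f] J(1) ival_ray
      in \<open>simp_all add: * ex Bex_def gt_ex lt_ex\<close>)
  show "fubini (\<lambda>x y. of_bool (x \<in> J \<and> y < f x))"
  proof (rule fubini_ivals)
    show "planar (\<lambda>x y. x \<in> J \<and> y < f x)"
      unfolding planar_def by (intro cfun_bool dpred_intros dJ dfun_of_real[OF f])
  qed (use ival_preimage[OF J(1) cont mono] ival_upper[of J f] J(1) ival_ray
      in \<open>simp_all add: * ex Bex_def gt_ex lt_ex\<close>)
qed

text \<open>Induction on the number of exceptional points in \<open>J\<close>: with none left,
  \<beta> is constant and \<open>f\<close> continuous and monotone on \<open>J\<close>; otherwise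
  \<open>J\<close> splits at such a point, whose vertical line carries a product function. The graph
  is what remains of the plane after removing the regions above and below.\<close>

lemma fubini_graph:
  assumes \<beta>: "univ \<beta>" and f: "dfun (\<lambda>s. f (s 0))"
  shows fubini_above: "fubini (\<lambda>x y. \<beta> x * of_bool (f x < y))"
    and fubini_below: "fubini (\<lambda>x y. \<beta> x * of_bool (y < f x))"
    and fubini_on: "fubini (\<lambda>x y. \<beta> x * of_bool (y = f x))"
proof -
  obtain F0 where "finite F0" "\<forall>x. x \<notin> F0 \<longrightarrow> isCont f x"
    "\<forall>J. is_interval J \<and> J \<inter> F0 = {} \<longrightarrow> mono_on J f \<or> mono_on J (\<lambda>t. - f t)"
    using piecewise_monotone[OF f] by (elim exE conjE)
  note F0 = this(1) this(2,3)[rule_format]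
  define F where "F = F0 \<union> brk \<beta>"
  have F: "finite F" using F0(1) univ_tame[OF \<beta>] by (simp add: F_def tame_def)
  have *: "fubini (\<lambda>x y. of_bool (x \<in> J) * (\<beta> x * of_bool (Q x y)))"
    if J: "ival J" "univ (\<lambda>x. x \<in> J)" and Q: "Q = (\<lambda>x y. f x < y) \<or> Q = (\<lambda>x y. y < f x)" for J Q
    using J
  proof (induction "card (F \<inter> J)" arbitrary: J rule: less_induct)
    case less
    show ?case
    proof (cases "F \<inter> J = {}")
      case True
      have "\<exists>k. \<forall>x\<in>J. \<beta> x = k"
      proof -
        have eq: "\<beta> x = \<beta> y" if "x \<in> J" "y \<in> J" "x \<le> y" for x y
        proof (rule brk_const[OF that(3)])
          have "{x..y} \<subseteq> J"
            using less.prems(1) that unfolding ival_def is_interval_1 by (meson atLeastAtMost_iff subsetI)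
          then show "{x..y} \<inter> brk \<beta> = {}" using True unfolding F_def by blast
        qed
        have "\<beta> x = \<beta> y" if "x \<in> J" "y \<in> J" for x y
          using eq[OF that] eq[OF that(2,1), symmetric] linear[of x y] by blast
        then show ?thesis by meson
      qed
      then obtain k where k: "\<And>x. x \<in> J \<Longrightarrow> \<beta> x = k" by blast
      have m: "mono_on J f \<or> mono_on J (\<lambda>t. - f t)" and c: "\<And>x. x \<in> J \<Longrightarrow> isCont f x"
        using F0(3)[of J] F0(2) less.prems(1) True unfolding ival_def F_def by auto
      have "fubini (\<lambda>x y. k * of_bool (x \<in> J \<and> Q x y))"
        using fubini_region[OF less.prems f c m] Q by (intro fubini_cmult) auto
      moreover have "k * of_bool (x \<in> J \<and> Q x y) = of_bool (x \<in> J) * (\<beta> x * of_bool (Q x y))" for x y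
        using k by simp
      ultimately show ?thesis by simp
    next
      case False
      then obtain p where p: "p \<in> F" "p \<in> J" by blast
      let ?A = "J \<inter> {..<p}" and ?B = "J \<inter> {p<..}"
      have dJ: "dpred (\<lambda>s. s 0 \<in> J)" by (rule dpred_of_cfun[OF univD[OF less.prems(2) dfun_var]])
      have "card (F \<inter> ?A) < card (F \<inter> J)" "card (F \<inter> ?B) < card (F \<inter> J)"
        using F p by (intro psubset_card_mono; auto)+
      moreover have "ival ?A" "ival ?B" using less.prems(1) ival_ray by (auto intro: ival_Int)
      moreover have "univ (\<lambda>x. x \<in> ?A)" "univ (\<lambda>x. x \<in> ?B)"
        unfolding univ_def Int_iff lessThan_iff greaterThan_iff by (intro cfun_bool dpred_intros dJ)+
      ultimately have AB: "fubini (\<lambda>x y. of_bool (x \<in> ?A) * (\<beta> x * of_bool (Q x y)))"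
        "fubini (\<lambda>x y. of_bool (x \<in> ?B) * (\<beta> x * of_bool (Q x y)))"
        using less.hyps by blast+
      have "univ (\<lambda>y. \<beta> p * of_bool (Q p y))"
        using Q unfolding univ_def by (auto intro!: cfun_intros dpred_intros)
      moreover have "univ (\<lambda>x. of_bool (x = p) :: int)"
        unfolding univ_def by (intro cfun_intros dpred_intros)
      ultimately have "fubini (\<lambda>x y. of_bool (x = p) * (\<beta> p * of_bool (Q p y)))"
        by (intro fubini_prod)
      from fubini_add[OF fubini_add[OF AB] this] show ?thesis
      proof (rule back_subst[of fubini], intro ext)
        fix x y
        show "of_bool (x \<in> ?A) * (\<beta> x * of_bool (Q x y)) + of_bool (x \<in> ?B) * (\<beta> x * of_bool (Q x y)) +
          of_bool (x = p) * (\<beta> p * of_bool (Q p y)) = of_bool (x \<in> J) * (\<beta> x * of_bool (Q x y))"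
          using p(2) by (cases x p rule: linorder_cases) auto
      qed
    qed
  qed
  have U: "univ (\<lambda>x::real. x \<in> UNIV)" by (simp add: univ_def cfun_const)
  show ab: "fubini (\<lambda>x y. \<beta> x * of_bool (f x < y))" "fubini (\<lambda>x y. \<beta> x * of_bool (y < f x))"
    using *[OF ival_ray(3) U, of "\<lambda>x y. f x < y"] *[OF ival_ray(3) U, of "\<lambda>x y. y < f x"] by simp_all
  have "fubini (\<lambda>x y. \<beta> x * 1)"
    using fubini_prod[OF \<beta>, of "\<lambda>_. 1"] by (simp add: univ_def cfun_const)
  from fubini_diff[OF fubini_diff[OF this ab(1)] ab(2)]
  show "fubini (\<lambda>x y. \<beta> x * of_bool (y = f x))"
  proof (rule back_subst[of fubini], intro ext)
    fix x y
    show "\<beta> x * 1 - \<beta> x * of_bool (f x < y) - \<beta> x * of_bool (y < f x) = \<beta> x * of_bool (y = f x)"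
      by (cases "f x" y rule: linorder_cases) auto
  qed
qed

text \<open>By uniform finiteness the support is covered by at most \<open>N\<close> graphs of
  definable functions, and \<open>fubini_on\<close> handles each weighted graph.\<close>

lemma fubini_finite_fibres:
  assumes b: "planar b" and fin: "\<And>x. finite {y. b x y \<noteq> 0}"
  shows "fubini b"
proof -
  define S where "S x = {y. b x y \<noteq> 0}" for x
  have finS: "finite (S x)" for x using fin by (simp add: S_def)
  have R: "dfam (\<lambda>z y. b (z 0) y \<noteq> 0)"
    unfolding dfam_def by (rule cfun_dpred[OF planarD[OF b dfun_var dfun_var]])
  from uniform_finiteness[OF R fin]
  obtain N where N: "\<forall>z :: nat \<Rightarrow> real. card {y. b (z 0) y \<noteq> 0} \<le> N" ..
  have cardS: "card (S x) \<le> N" for x using spec[OF N, of "\<lambda>_. x"] by (simp add: S_def)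
  have f: "dfun (\<lambda>s. elt (S (s 0)) i)" for i
    unfolding S_def by (rule dfun_elt[OF R fin])
  \<comment> \<open>The weight vanishes where no \<open>i\<close>-th point exists, which suppresses
    the default value of \<open>elt\<close>.\<close>
  define \<beta> where "\<beta> i x = (if i < card (S x) then b x (elt (S x) i) else 0)" for i x
  have "dpred (\<lambda>s. Suc i \<le> card (S (s 0)))" for i
    unfolding S_def by (rule dpred_card_ge[OF R fin])
  then have d: "dpred (\<lambda>s. i < card (S (s 0)))" for i by (simp only: Suc_le_eq)
  have "univ (\<beta> i)" for i
    unfolding univ_def \<beta>_def by (intro cfun_intros planarD[OF b] dfun_var f d)
  then have "fubini (\<lambda>x y. \<Sum>i<N. \<beta> i x * of_bool (y = elt (S x) i))"
    using f by (intro fubini_sum fubini_on) auto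
  then show ?thesis
  proof (rule back_subst[of fubini], intro ext)
    fix x y
    show "(\<Sum>i<N. \<beta> i x * of_bool (y = elt (S x) i)) = b x y"
    proof (cases "y \<in> S x")
      case True
      have "(\<Sum>i<N. \<beta> i x * of_bool (y = elt (S x) i)) = (\<Sum>i\<in>{rnk (S x) y}. \<beta> i x * of_bool (y = elt (S x) i))"
      proof (rule sum.mono_neutral_right)
        show "{rnk (S x) y} \<subseteq> {..<N}" using rnk_less_card[OF finS True] cardS[of x] by simp
        have "\<beta> i x * of_bool (y = elt (S x) i) = 0" if "i \<noteq> rnk (S x) y" for i
          using rnk_elt[OF finS, of i x] that by (cases "i < card (S x)") (auto simp: \<beta>_def)
        then show "\<forall>i\<in>{..<N} - {rnk (S x) y}. \<beta> i x * of_bool (y = elt (S x) i) = 0" by blast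
      qed simp
      also have "\<dots> = b x y"
        using elt_eqI[OF finS True refl] rnk_less_card[OF finS True] by (simp add: \<beta>_def)
      finally show ?thesis .
    next
      case False
      then have "\<beta> i x * of_bool (y = elt (S x) i) = 0" for i
        using elt_in[OF finS, of i x] by (auto simp: \<beta>_def)
      then have "(\<Sum>i<N. \<beta> i x * of_bool (y = elt (S x) i)) = 0" by (intro sum.neutral) blast
      moreover have "b x y = 0" using False by (simp add: S_def)
      ultimately show ?thesis by simp
    qed
  qed
qed

text \<open>The break points of \<open>g x\<close> cut each vertical line into bands of constant
  value, indexed by the rank. Bands are differences of regions below graphs, and the part supported
  on the break points has finite fibres.\<close>

theorem fubini_planar:
  assumes g: "planar g"
  shows "fubini g"
proof -
  define F where "F x = brk (g x)" for x
  have finF: "finite (F x)" for x using univ_tame[OF planar_fibres(3)[OF g]] by (simp add: F_def tame_def)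
  have c: "cfam (\<lambda>z. g (z 0))" by (rule planar_fibres(1)[OF g])
  have R: "dfam (\<lambda>z y. y \<in> F (z 0))" unfolding F_def by (rule dfam_brk[OF c])
  have fin: "finite {y. y \<in> F x}" for x using finF by simp
  from uniform_finiteness[where R = "\<lambda>z y. y \<in> F (z 0)", OF R fin]
  obtain N where N: "\<forall>z :: nat \<Rightarrow> real. card {y. y \<in> F (z 0)} \<le> N" ..
  have cardF: "card (F x) \<le> N" for x using spec[OF N, of "\<lambda>_. x"] by simp
  have dF: "dpred (\<lambda>s. e2 s \<in> F (e1 s))" if "dfun e1" "dfun e2" for e1 e2
    using dfamD[OF R, of "\<lambda>s i. e1 s" e2] that by (simp add: dseq_def)
  have drnk: "dpred (\<lambda>s. rnk (F (e1 s)) (e2 s) = i)" if "dfun e1" "dfun e2" for e1 e2 i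
    using dfamD[OF dfam_rnk_eq[where R = "\<lambda>z y. y \<in> F (z 0)", OF R fin], of "\<lambda>s i. e1 s" e2] that by (simp add: dseq_def)
  have f: "dfun (\<lambda>s. elt (F (s 0)) i)" for i
    using dfun_elt[where R = "\<lambda>z y. y \<in> F (z 0)", OF R fin] by simp
  have le: "fubini (\<lambda>x y. \<beta> x * of_bool (rnk (F x) y \<le> i))" if \<beta>: "univ \<beta>" for \<beta> i
  proof -
    \<comment> \<open>Where \<open>F x\<close> has at most \<open>i\<close> points there is no
      element of index \<open>i\<close>, counted from \<open>0\<close>, and rank at most
      \<open>i\<close> holds on the whole line.\<close>
    define \<beta>1 \<beta>2 where "\<beta>1 x = (if Suc i \<le> card (F x) then \<beta> x else 0)"
      and "\<beta>2 x = (if Suc i \<le> card (F x) then 0 else \<beta> x)" for x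
    have "dpred (\<lambda>s. Suc i \<le> card {y. y \<in> F (s 0)})" by (rule dpred_card_ge[where R = "\<lambda>z y. y \<in> F (z 0)", OF R fin])
    then have d: "dpred (\<lambda>s. Suc i \<le> card (F (s 0)))" by simp
    have u: "univ \<beta>1" "univ \<beta>2"
      unfolding univ_def \<beta>1_def \<beta>2_def by (intro cfun_intros univD[OF \<beta>] dfun_var d)+
    have "fubini (\<lambda>x y. \<beta>2 x * 1)"
      by (rule fubini_prod[OF u(2)]) (simp add: univ_def cfun_const)
    from fubini_add[OF this fubini_add[OF fubini_below[OF u(1) f[of i]] fubini_on[OF u(1) f[of i]]]]
    show ?thesis
    proof (rule back_subst[of fubini], intro ext)
      fix x y
      show "\<beta>2 x * 1 + (\<beta>1 x * of_bool (y < elt (F x) i) + \<beta>1 x * of_bool (y = elt (F x) i)) =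
        \<beta> x * of_bool (rnk (F x) y \<le> i)"
      proof (cases "Suc i \<le> card (F x)")
        case True
        then have "rnk (F x) y \<le> i \<longleftrightarrow> y < elt (F x) i \<or> y = elt (F x) i"
          using le_elt_iff[OF finF, of i x y] by (auto simp: le_less)
        with True show ?thesis by (auto simp: \<beta>1_def \<beta>2_def)
      next
        case False
        with rnk_le_card[OF finF, of x y] show ?thesis by (simp add: \<beta>1_def \<beta>2_def)
      qed
    qed
  qed
  have eq: "fubini (\<lambda>x y. \<beta> x * of_bool (rnk (F x) y = i))" if \<beta>: "univ \<beta>" for \<beta> i
  proof (cases i)
    case 0
    then show ?thesis using le[OF \<beta>, of 0] by simp
  next
    case (Suc j)
    from fubini_diff[OF le[OF \<beta>, of i] le[OF \<beta>, of j]] show ?thesis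
    proof (rule back_subst[of fubini], intro ext)
      fix x y
      show "\<beta> x * of_bool (rnk (F x) y \<le> i) - \<beta> x * of_bool (rnk (F x) y \<le> j) = \<beta> x * of_bool (rnk (F x) y = i)"
        using Suc by (auto simp: le_Suc_eq)
    qed
  qed
  \<comment> \<open>A set of constant rank can contain one break point, namely its upper end;
    \<open>W\<close> leaves it out.\<close>
  define W where "W i x y \<longleftrightarrow> y \<notin> F x \<and> rnk (F x) y = i" for i x y
  define \<gamma> where "\<gamma> i x = (if \<exists>y. W i x y then g x (SOME y. W i x y) else 0)" for i x
  have const: "g x y = g x y'" if "W i x y" "W i x y'" for i x y y'
  proof -
    have *: "g x y = g x y'" if w: "W i x y" "W i x y'" "y \<le> y'" for y y'
    proof (rule brk_const[OF w(3)])
      have "p \<notin> F x" if p: "y \<le> p" "p \<le> y'" for p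
      proof
        assume "p \<in> F x"
        moreover from this have "p \<noteq> y'" using w(2) by (auto simp: W_def)
        ultimately have "rnk (F x) p < rnk (F x) y'" using p finF by (intro rnk_less) auto
        moreover have "rnk (F x) y \<le> rnk (F x) p" using p finF by (intro rnk_mono) auto
        ultimately show False using w(1,2) by (simp add: W_def)
      qed
      then show "{y..y'} \<inter> brk (g x) = {}" by (auto simp: F_def)
    qed
    show ?thesis using *[OF that] *[OF that(2,1), symmetric] linear[of y y'] by blast
  qed
  have \<gamma>: "\<gamma> i x = g x y" if "W i x y" for i x y
    unfolding \<gamma>_def using that const someI[of "W i x" y] by (metis (no_types, lifting))
  \<comment> \<open>Trades the choice operator for a first-order condition, which is possible
    because \<open>g x\<close> is constant on the band.\<close>
  have \<gamma>_iff: "\<gamma> i x = k \<longleftrightarrow> (\<exists>y. W i x y \<and> g x y = k) \<or> ((\<forall>y. \<not> W i x y) \<and> k = 0)" for i x k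
    using \<gamma>[of i x] by (cases "\<exists>y. W i x y") (auto simp: \<gamma>_def)
  have dW: "dpred (\<lambda>s. W i (e1 s) (e2 s))" if "dfun e1" "dfun e2" for i e1 e2
    unfolding W_def using that by (intro dpred_intros dF drnk)
  have univ_\<gamma>: "univ (\<gamma> i)" for i
  proof -
    obtain V where V: "finite V" "\<And>(z :: nat \<Rightarrow> real) y. g (z 0) y \<in> V" using cfam_range[OF c] by blast
    have "g x y \<in> V" for x y using V(2)[of "\<lambda>_. x"] by simp
    then have "\<gamma> i x \<in> insert 0 V" for x unfolding \<gamma>_def by simp
    then have "finite (range (\<lambda>s. \<gamma> i (s 0)))"
      by (intro finite_subset[OF _ finite.insertI[OF V(1), of 0]]) auto
    moreover have "dpred (\<lambda>s. \<gamma> i (s 0) = k)" for k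
      unfolding \<gamma>_iff
      by (intro dpred_intros dW cfun_eq[OF planarD[OF g]] cfun_const)
    ultimately show ?thesis unfolding univ_def cfun_def by blast
  qed
  have on: "fubini (\<lambda>x y. of_bool (y \<in> F x) * h x y)" if "planar h" for h
  proof (rule fubini_finite_fibres)
    show "planar (\<lambda>x y. of_bool (y \<in> F x) * h x y)"
      unfolding planar_def by (intro cfun_intros dF planarD[OF that] dpred_intros)
    show "finite {y. of_bool (y \<in> F x) * h x y \<noteq> 0}" for x
      by (rule finite_subset[OF _ finF[of x]]) auto
  qed
  have "planar (\<lambda>x y. \<gamma> i x * of_bool (rnk (F x) y = i))" for i
    unfolding planar_def by (intro cfun_intros univD[OF univ_\<gamma>] drnk dpred_intros)
  \<comment> \<open>On break points the sum cancels and the first term gives \<open>g\<close>; off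
    them the first and the subtracted terms vanish, and only the band with
    \<open>i = rnk (F x) y\<close> is left.\<close>
  then have "fubini (\<lambda>x y. of_bool (y \<in> F x) * g x y + (\<Sum>i\<le>N. \<gamma> i x * of_bool (rnk (F x) y = i) -
      of_bool (y \<in> F x) * (\<gamma> i x * of_bool (rnk (F x) y = i))))"
    using g univ_\<gamma> by (intro fubini_add fubini_sum fubini_diff on eq) auto
  then show ?thesis
  proof (rule back_subst[of fubini], intro ext)
    fix x y
    show "of_bool (y \<in> F x) * g x y + (\<Sum>i\<le>N. \<gamma> i x * of_bool (rnk (F x) y = i) -
      of_bool (y \<in> F x) * (\<gamma> i x * of_bool (rnk (F x) y = i))) = g x y"
    proof (cases "y \<in> F x")
      case False
      let ?i = "rnk (F x) y"
      have "(\<Sum>i\<le>N. \<gamma> i x * of_bool (?i = i)) = (\<Sum>i\<le>N. if ?i = i then \<gamma> i x else 0)"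
        by (intro sum.cong) auto
      also have "\<dots> = \<gamma> ?i x"
        using rnk_le_card[OF finF, of x y] cardF[of x] by simp
      also have "\<dots> = g x y" using False by (intro \<gamma>) (simp add: W_def)
      finally show ?thesis using False by simp
    qed simp
  qed
qed

end

subsection \<open>Iterated Euler integrals\<close>

primrec EI :: "nat \<Rightarrow> ((nat \<Rightarrow> real) \<Rightarrow> int) \<Rightarrow> int" where
  "EI 0 F = F (\<lambda>_. 0)"
| "EI (Suc n) F = eul (\<lambda>t. EI n (\<lambda>x. F (t ## x)))"

lemma EI_cong: "(\<And>x. x \<in> RR n \<Longrightarrow> F x = G x) \<Longrightarrow> EI n F = EI n G"
proof (induction n arbitrary: F G)
  case 0
  then show ?case by (simp add: RR_0)
next
  case (Suc n)
  have "EI n (\<lambda>x. F (t ## x)) = EI n (\<lambda>x. G (t ## x))" for t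
    by (rule Suc.IH) (simp add: Suc.prems)
  then show ?case by simp
qed

lemma EI_const: "EI n (\<lambda>x. k) = (- 1) ^ n * k"
  by (induction n) (simp_all add: eul_const)

lemma EI_zero [simp]: "EI n (\<lambda>x. 0) = 0"
  by (simp add: EI_const)

lemma EI_point: "a \<in> RR n \<Longrightarrow> EI n (\<lambda>x. of_bool (x = a)) = 1"
proof (induction n arbitrary: a)
  case 0
  then show ?case by (simp add: RR_0)
next
  case (Suc n)
  obtain u b where a: "a = u ## b" "b \<in> RR n" using RR_SucE[OF Suc.prems] by metis
  have eq: "t ## x = u ## b \<longleftrightarrow> t = u \<and> x = b" for t x
    by (metis scons_simps ext)
  have "EI n (\<lambda>x. of_bool (t ## x = a)) = of_bool (t = u)" for t
    using Suc.IH[OF a(2)] unfolding a(1) eq by (cases "t = u") simp_all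
  then show ?case by (simp add: eul_point)
qed

text \<open>If some coefficient is nonzero the solutions form a cell of dimension
  \<open>d - 1\<close>; otherwise they are everything or nothing. The constant \<open>h\<close> is
  general because fixing the first coordinate changes it.\<close>

lemma EI_hyperplane:
  "EI d (\<lambda>v. of_bool ((\<Sum>i<d. z i * v i) = h)) =
    (if \<exists>i<d. z i \<noteq> 0 then (- 1) ^ (d - 1) else of_bool (h = 0) * (- 1) ^ d)"
proof (induction d arbitrary: z h)
  case (Suc n)
  have eq: "(\<Sum>i<Suc n. z i * (t ## v) i) = h \<longleftrightarrow> (\<Sum>i<n. z (Suc i) * v i) = h - z 0 * t" for t v
    by (subst sum.lessThan_Suc_shift) (auto simp: algebra_simps)
  have *: "EI (Suc n) (\<lambda>v. of_bool ((\<Sum>i<Suc n. z i * v i) = h)) =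
    eul (\<lambda>t. if \<exists>i<n. z (Suc i) \<noteq> 0 then (- 1) ^ (n - 1) else of_bool (h - z 0 * t = 0) * (- 1) ^ n)"
    unfolding EI.simps eq Suc.IH ..
  have ex: "(\<exists>i<Suc n. z i \<noteq> 0) \<longleftrightarrow> z 0 \<noteq> 0 \<or> (\<exists>i<n. z (Suc i) \<noteq> 0)"
    by (auto simp: less_Suc_eq_0_disj)
  consider "\<exists>i<n. z (Suc i) \<noteq> 0" | "\<not> (\<exists>i<n. z (Suc i) \<noteq> 0)" "z 0 \<noteq> 0"
    | "\<not> (\<exists>i<n. z (Suc i) \<noteq> 0)" "z 0 = 0" by blast
  then show ?case
  proof cases
    case 1
    \<comment> \<open>With \<open>n\<close> positive, \<open>- (- 1) ^ (n - 1)\<close> is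
      \<open>(- 1) ^ n\<close> despite the truncated subtraction.\<close>
    then obtain m where "n = Suc m" by (cases n) auto
    then show ?thesis unfolding * ex if_P[OF 1] using 1 by (simp add: eul_const)
  next
    case 2
    have "(h - z 0 * t = 0) = (t = h / z 0)" for t using 2(2) by (auto simp: field_simps)
    then have "eul (\<lambda>t. of_bool (h - z 0 * t = 0) * (- 1) ^ n) = eul (\<lambda>t. (- 1) ^ n * of_bool (t = h / z 0))"
      by (simp only: mult.commute)
    also have "\<dots> = (- 1) ^ n"
      using eul_cmult[OF tame_map[OF tame_point], of "(- 1) ^ n" of_bool "h / z 0"] by (simp add: eul_point)
    finally show ?thesis unfolding * ex if_not_P[OF 2(1)] using 2(2) by simp
  next
    case 3
    then show ?thesis unfolding * ex if_not_P[OF 3(1)] by (simp add: eul_const)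
  qed
qed simp

text \<open>An open simplex in corner coordinates; the bound \<open>r\<close> is general because
  fixing the first coordinate at \<open>t\<close> lowers it to \<open>r - t\<close>.\<close>

lemma EI_corner:
  "EI k (\<lambda>c. of_bool ((\<forall>j<k. c j > 0) \<and> (\<Sum>j<k. c j) < r)) = of_bool (r > 0) * (- 1) ^ k"
proof (induction k arbitrary: r)
  case (Suc k)
  have eq: "(\<forall>j<Suc k. (t ## c) j > 0) \<and> (\<Sum>j<Suc k. (t ## c) j) < r \<longleftrightarrow>
      t > 0 \<and> (\<forall>j<k. c j > 0) \<and> (\<Sum>j<k. c j) < r - t" for t c
    by (subst sum.lessThan_Suc_shift) (auto simp: less_Suc_eq_0_disj algebra_simps)
  have "EI k (\<lambda>c. of_bool (t > 0 \<and> (\<forall>j<k. c j > 0) \<and> (\<Sum>j<k. c j) < r - t)) =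
      (- 1) ^ k * of_bool (t \<in> {0<..<r})" for t
    using Suc.IH[of "r - t"] by (cases "t > 0") auto
  then have "EI (Suc k) (\<lambda>c. of_bool ((\<forall>j<Suc k. c j > 0) \<and> (\<Sum>j<Suc k. c j) < r)) =
      eul (\<lambda>t. (- 1) ^ k * of_bool (t \<in> {0<..<r}))"
    unfolding EI.simps eq by presburger
  also have "\<dots> = (- 1) ^ k * eul (\<lambda>t. of_bool (t \<in> {0<..<r}))"
    by (intro eul_cmult tame_map[OF tame_interval]) (simp add: is_interval_1)
  also have "eul (\<lambda>t. of_bool (t \<in> {0<..<r})) = - of_bool ({0<..<r} \<noteq> {})"
    by (intro eul_ival) (auto simp: ival_def is_interval_1)
  finally show ?case by simp
qed simp

lemma cat_eq_iff:
  assumes "x \<in> RR n" "x' \<in> RR n"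
  shows "cat n x y = cat n x' y' \<longleftrightarrow> x = x' \<and> y = y'"
proof
  assume eq: "cat n x y = cat n x' y'"
  have "x i = x' i" for i
    using fun_cong[OF eq, of i] assms by (cases "i < n") (auto simp: cat_def RR_iff)
  moreover have "y i = y' i" for i
    using fun_cong[OF eq, of "n + i"] by (simp add: cat_def)
  ultimately show "x = x' \<and> y = y'" by auto
qed simp

lemma cat_in_RR: "y \<in> RR m \<Longrightarrow> cat n x y \<in> RR (n + m)"
  by (auto simp: cat_def RR_iff)

section \<open>Interchange of iterated integrals and invariance under definable bijections\<close>

context o_minimal_structure
begin

text \<open>A pair of sequences is encoded by interleaving.\<close>

definition cfun2 :: "((nat \<Rightarrow> real) \<Rightarrow> (nat \<Rightarrow> real) \<Rightarrow> 'b) \<Rightarrow> bool" where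
  "cfun2 G \<longleftrightarrow> cfun (\<lambda>s. G (\<lambda>i. s (2 * i)) (\<lambda>i. s (2 * i + 1)))"

lemma cfun2D:
  assumes "cfun2 G" "dseq w" "dseq v"
  shows "cfun (\<lambda>s. G (w s) (v s))"
proof -
  let ?u = "\<lambda>s j. if even j then w s (j div 2) else v s (j div 2)"
  have "dfun (\<lambda>s. ?u s j)" for j
    by (cases "even j") (use assms in \<open>simp_all add: dseq_def\<close>)
  then have "dseq ?u" by (simp add: dseq_def)
  from cfun_comp[OF assms(1)[unfolded cfun2_def] this] show ?thesis by simp
qed

lemma cfun_EI: "cfun2 G \<Longrightarrow> cfun (\<lambda>z. EI n (G z))"
proof (induction n arbitrary: G)
  case 0
  then show ?case unfolding EI.simps by (rule cfun2D[OF _ dseq_id dseq_const])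
next
  case (Suc n)
  have "cfun2 (\<lambda>z x. G (\<lambda>i. z (Suc i)) (z 0 ## x))"
    unfolding cfun2_def by (intro cfun2D[OF Suc.prems] dpred_intros)
  from Suc.IH[OF this] have "cfam (\<lambda>z t. EI n (\<lambda>x. G z (t ## x)))"
    unfolding cfam_def .
  from cfun_eul[OF this] show ?case by simp
qed

lemma EI_tame:
  assumes "cfun F"
  shows "tame (\<lambda>t. EI n (\<lambda>x. F (t ## x)))"
proof (rule cfun_tame, rule cfun_EI)
  show "cfun2 (\<lambda>z x. F (z 0 ## x))"
    unfolding cfun2_def by (intro cfun_comp[OF assms] dpred_intros)
qed

lemma cfun_scons: "cfun F \<Longrightarrow> cfun (\<lambda>x. F (t ## x))"
  by (erule cfun_comp) (intro dpred_intros)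

lemma EI_add: "cfun F \<Longrightarrow> cfun G \<Longrightarrow> EI n (\<lambda>x. F x + G x) = EI n F + EI n G"
proof (induction n arbitrary: F G)
  case (Suc n)
  from Suc.IH[OF cfun_scons cfun_scons, OF Suc.prems] show ?case
    by (simp add: eul_add EI_tame Suc.prems)
qed simp

lemma EI_cmult: "cfun F \<Longrightarrow> EI n (\<lambda>x. k * F x) = k * EI n F"
proof (induction n arbitrary: F)
  case (Suc n)
  from Suc.IH[OF cfun_scons, OF Suc.prems] show ?case
    by (simp add: eul_cmult EI_tame Suc.prems)
qed simp

lemma EI_diff:
  assumes "cfun F" "cfun G"
  shows "EI n (\<lambda>x. F x - G x) = EI n F - EI n G"
proof -
  have "cfun (\<lambda>x. (- 1) * G x)" by (intro cfun_intros assms)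
  from EI_add[OF assms(1) this, of n] EI_cmult[OF assms(2), of n "- 1"] show ?thesis by simp
qed

lemma EI_sum:
  assumes "finite I" "\<And>i. i \<in> I \<Longrightarrow> cfun (F i)"
  shows "EI n (\<lambda>x. \<Sum>i\<in>I. F i x) = (\<Sum>i\<in>I. EI n (F i))"
  using assms
proof (induction I)
  case (insert i I)
  then have "EI n (\<lambda>x. F i x + (\<Sum>i\<in>I. F i x)) = EI n (F i) + EI n (\<lambda>x. \<Sum>i\<in>I. F i x)"
    by (intro EI_add cfun_sum) auto
  with insert show ?case by simp
qed simp

text \<open>The outer integration is moved past the coordinates one by one; each exchange is
  \<open>fubini_planar\<close> for the function of two reals left after integrating out the
  remaining coordinates.\<close>

lemma eul_EI_swap:
  assumes "cfun (\<lambda>s. G (s 0) (\<lambda>i. s (Suc i)))"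
  shows "eul (\<lambda>t. EI n (G t)) = EI n (\<lambda>y. eul (\<lambda>t. G t y))"
  using assms
proof (induction n arbitrary: G)
  case (Suc n)
  have G: "cfun (\<lambda>s. G (e s) (w s))" if "dfun e" "dseq w" for e w
    using cfun_comp[OF Suc.prems dseq_scons[OF that]] by simp
  have "cfun2 (\<lambda>z y. G (z 0) (z 1 ## y))"
    unfolding cfun2_def by (intro G dpred_intros)
  then have "planar (\<lambda>t u. EI n (\<lambda>y. G t (u ## y)))"
    unfolding planar_def by (rule cfun_EI)
  from fubini_planar[OF this]
  have "eul (\<lambda>t. EI (Suc n) (G t)) = eul (\<lambda>u. eul (\<lambda>t. EI n (\<lambda>y. G t (u ## y))))"
    by (simp add: fubini_def)
  moreover have "eul (\<lambda>t. EI n (\<lambda>y. G t (u ## y))) = EI n (\<lambda>y. eul (\<lambda>t. G t (u ## y)))" for u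
    by (rule Suc.IH) (intro G dpred_intros)
  ultimately show ?case by simp
qed simp

theorem EI_swap:
  assumes "cfun2 F"
  shows "EI m (\<lambda>x. EI n (F x)) = EI n (\<lambda>y. EI m (\<lambda>x. F x y))"
  using assms
proof (induction m arbitrary: F)
  case (Suc m)
  have "EI m (\<lambda>x. EI n (F (t ## x))) = EI n (\<lambda>y. EI m (\<lambda>x. F (t ## x) y))" for t
  proof (rule Suc.IH)
    show "cfun2 (\<lambda>x. F (t ## x))"
      unfolding cfun2_def by (intro cfun2D[OF Suc.prems] dpred_intros)
  qed
  moreover have "eul (\<lambda>t. EI n (\<lambda>y. EI m (\<lambda>x. F (t ## x) y))) = EI n (\<lambda>y. eul (\<lambda>t. EI m (\<lambda>x. F (t ## x) y)))"
  proof (rule eul_EI_swap, rule cfun_EI)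
    show "cfun2 (\<lambda>s x. F (s 0 ## x) (\<lambda>i. s (Suc i)))"
      unfolding cfun2_def by (intro cfun2D[OF Suc.prems] dpred_intros)
  qed
  ultimately show ?case by simp
qed simp

text \<open>The indicator of a one-to-one correspondence is integrated in both orders: every
  nonempty fibre is a single point and contributes \<open>1\<close>.\<close>

lemma EI_correspondence:
  assumes G: "cfun2 G"
    and GD: "\<And>x y. x \<in> RR m \<Longrightarrow> y \<in> RR n \<Longrightarrow> G x y \<Longrightarrow> X x \<and> Y y"
    and X: "\<And>x. x \<in> RR m \<Longrightarrow> X x \<Longrightarrow> \<exists>!y. y \<in> RR n \<and> G x y"
    and Y: "\<And>y. y \<in> RR n \<Longrightarrow> Y y \<Longrightarrow> \<exists>!x. x \<in> RR m \<and> G x y"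
  shows "EI m (\<lambda>x. of_bool (X x)) = EI n (\<lambda>y. of_bool (Y y))"
proof -
  have "EI n (\<lambda>y. of_bool (G x y)) = of_bool (X x)" if x: "x \<in> RR m" for x
  proof (cases "X x")
    case True
    then obtain y0 where y0: "y0 \<in> RR n" "G x y0" "\<And>y. y \<in> RR n \<Longrightarrow> G x y \<Longrightarrow> y = y0"
      using X[OF x] by blast
    then have eq: "G x y \<longleftrightarrow> y = y0" if "y \<in> RR n" for y using that by blast
    have "EI n (\<lambda>y. of_bool (G x y)) = EI n (\<lambda>y. of_bool (y = y0))"
      by (intro EI_cong) (simp add: eq)
    then show ?thesis using EI_point[OF y0(1)] True by simp
  next
    case False
    have "EI n (\<lambda>y. of_bool (G x y)) = EI n (\<lambda>y. 0)"
      using GD[OF x] False by (intro EI_cong) auto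
    then show ?thesis using False by simp
  qed
  moreover have "EI m (\<lambda>x. of_bool (G x y)) = of_bool (Y y)" if y: "y \<in> RR n" for y
  proof (cases "Y y")
    case True
    then obtain x0 where x0: "x0 \<in> RR m" "G x0 y" "\<And>x. x \<in> RR m \<Longrightarrow> G x y \<Longrightarrow> x = x0"
      using Y[OF y] by blast
    then have eq: "G x y \<longleftrightarrow> x = x0" if "x \<in> RR m" for x using that by blast
    have "EI m (\<lambda>x. of_bool (G x y)) = EI m (\<lambda>x. of_bool (x = x0))"
      by (intro EI_cong) (simp add: eq)
    then show ?thesis using EI_point[OF x0(1)] True by simp
  next
    case False
    have "EI m (\<lambda>x. of_bool (G x y)) = EI m (\<lambda>x. 0)"
      using GD[OF _ y] False by (intro EI_cong) auto
    then show ?thesis using False by simp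
  qed
  moreover have "cfun2 (\<lambda>x y. of_bool (G x y) :: int)"
    using G unfolding cfun2_def by (rule cfun_map)
  from EI_swap[OF this]
  have "EI m (\<lambda>x. EI n (\<lambda>y. of_bool (G x y))) = EI n (\<lambda>y. EI m (\<lambda>x. of_bool (G x y)))" .
  ultimately show ?thesis
    using EI_cong[of m "\<lambda>x. EI n (\<lambda>y. of_bool (G x y))" "\<lambda>x. of_bool (X x)"]
      EI_cong[of n "\<lambda>y. EI m (\<lambda>x. of_bool (G x y))" "\<lambda>y. of_bool (Y y)"] by simp
qed

lemma EI_graph:
  assumes \<phi>: "definable_map \<O> n X N Y \<phi>" and bij: "bij_betw \<phi> X Y"
  shows "EI n (\<lambda>x. of_bool (x \<in> X)) = EI N (\<lambda>y. of_bool (y \<in> Y))"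
proof -
  let ?\<Gamma> = "{cat n x (\<phi> x) |x. x \<in> X}"
  have \<Gamma>: "?\<Gamma> \<in> \<O> (n + N)" and X: "X \<subseteq> RR n" and Y: "Y \<subseteq> RR N"
    using \<phi> subset unfolding definable_map_def by auto
  define G where "G x y \<longleftrightarrow> cut (n + N) (cat n x y) \<in> ?\<Gamma>" for x y
  have G: "G x y \<longleftrightarrow> x \<in> X \<and> y = \<phi> x" if "x \<in> RR n" "y \<in> RR N" for x y
  proof -
    have "cat n x y = cat n x' (\<phi> x') \<longleftrightarrow> x = x' \<and> y = \<phi> x'" if "x' \<in> X" for x'
      using that X by (intro cat_eq_iff \<open>x \<in> RR n\<close>) blast
    then show ?thesis unfolding G_def cut_id[OF cat_in_RR[OF that(2)]] mem_Collect_eq by blast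
  qed
  have img: "\<phi> x \<in> Y" if "x \<in> X" for x using bij that bij_betwE by blast
  show ?thesis
  proof (rule EI_correspondence)
    have "dseq (\<lambda>s. cat n (\<lambda>i. s (2 * i)) (\<lambda>i. s (2 * i + 1)))"
      unfolding dseq_def cat_def by (auto intro: dpred_intros)
    from dpred_comp[OF dpred_set[OF \<Gamma>] this] show "cfun2 G"
      unfolding cfun2_def G_def by (rule cfun_bool)
    show "x \<in> X \<and> y \<in> Y" if "x \<in> RR n" "y \<in> RR N" "G x y" for x y
      using G that img by blast
    show "\<exists>!y. y \<in> RR N \<and> G x y" if "x \<in> RR n" "x \<in> X" for x
    proof (rule ex1I[of _ "\<phi> x"])
      have "\<phi> x \<in> RR N" using img[OF that(2)] Y by blast
      then show "\<phi> x \<in> RR N \<and> G x (\<phi> x)" using G that by blast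
      show "y = \<phi> x" if "y \<in> RR N \<and> G x y" for y using G \<open>x \<in> RR n\<close> that by blast
    qed
    show "\<exists>!x. x \<in> RR n \<and> G x y" if y: "y \<in> RR N" "y \<in> Y" for y
    proof -
      obtain x where x: "x \<in> X" "y = \<phi> x" using bij y(2) unfolding bij_betw_def by blast
      show ?thesis
      proof (rule ex1I[of _ x])
        show "x \<in> RR n \<and> G x y" using G y(1) x X by blast
        fix x' assume "x' \<in> RR n \<and> G x' y"
        then have "x' \<in> X \<and> y = \<phi> x'" using G[OF _ y(1), of x'] by simp
        then have "x' \<in> X" "\<phi> x' = \<phi> x" using x(2) by auto
        then show "x' = x" using bij x(1) unfolding bij_betw_def inj_on_def by blast
      qed
    qed
  qed
qed

end

subsection \<open>Open simplices\<close>

text \<open>Barycentric coordinates over an affinely independent set are unique, and those of a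
  point of the open simplex are all positive, so no vertex can be missing from
  \<open>W\<close>.\<close>

lemma closed_simplex_coords:
  assumes V: "finite V" "affinely_independent V" and y: "y \<in> open_simplex V"
    and W: "W \<subseteq> V" "y \<in> closed_simplex W"
  shows "V \<subseteq> W"
proof
  fix v assume v: "v \<in> V"
  obtain a where a: "y = (\<lambda>i. \<Sum>v\<in>V. a v * v i)" "\<forall>v\<in>V. a v > 0" "(\<Sum>v\<in>V. a v) = 1"
    using y unfolding open_simplex_def by blast
  obtain b where b: "y = (\<lambda>i. \<Sum>v\<in>W. b v * v i)" "(\<Sum>v\<in>W. b v) = 1"
    using W(2) unfolding closed_simplex_def by blast
  define c where "c v = (if v \<in> W then b v else 0)" for v
  have c1: "(\<Sum>v\<in>V. c v) = 1"
    using b(2) W(1) V(1) unfolding c_def by (simp add: sum.inter_restrict[symmetric] Int_absorb1)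
  have c2: "(\<Sum>v\<in>V. c v * v i) = y i" for i
  proof -
    have "(\<Sum>v\<in>V. c v * v i) = (\<Sum>v\<in>V. if v \<in> W then b v * v i else 0)"
      by (rule sum.cong) (auto simp: c_def)
    also have "\<dots> = (\<Sum>v\<in>W. b v * v i)"
      using W(1) V(1) by (simp add: sum.inter_restrict[symmetric] Int_absorb1)
    finally show ?thesis by (simp add: b(1))
  qed
  have "(\<Sum>v\<in>V. a v - c v) = 0" using a(3) c1 by (simp add: sum_subtractf)
  moreover have "(\<Sum>v\<in>V. (a v - c v) * v i) = 0" for i
    using c2[of i] fun_cong[OF a(1), of i] by (simp add: left_diff_distrib sum_subtractf)
  ultimately have "\<forall>v\<in>V. a v - c v = 0"
    using V(2) unfolding affinely_independent_def by blast
  then have "c v > 0" using a(2) v by force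
  then show "v \<in> W" unfolding c_def by (simp split: if_splits)
qed

lemma open_simplex_closed: "open_simplex V \<subseteq> closed_simplex V"
  unfolding open_simplex_def closed_simplex_def using less_imp_le by blast

lemma euclidean_complexD:
  assumes "euclidean_complex N K"
  shows "finite K" "\<And>V. V \<in> K \<Longrightarrow> finite V" "\<And>V. V \<in> K \<Longrightarrow> V \<noteq> {}"
    "\<And>V. V \<in> K \<Longrightarrow> V \<subseteq> RR N" "\<And>V. V \<in> K \<Longrightarrow> affinely_independent V"
    "\<And>V W. V \<in> K \<Longrightarrow> W \<in> K \<Longrightarrow> closed_simplex V \<inter> closed_simplex W = closed_simplex (V \<inter> W)"
proof -
  have *: "finite K" "\<forall>V\<in>K. finite V \<and> V \<noteq> {} \<and> V \<subseteq> RR N \<and> affinely_independent V"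
    "\<forall>V\<in>K. \<forall>W\<in>K. closed_simplex V \<inter> closed_simplex W = closed_simplex (V \<inter> W)"
    using assms unfolding euclidean_complex_def by - (elim conjE, assumption)+
  show "finite K" by (rule *(1))
  show "finite V" "V \<noteq> {}" "V \<subseteq> RR N" "affinely_independent V" if "V \<in> K" for V
    using bspec[OF *(2) that] by - (elim conjE, assumption)+
  show "closed_simplex V \<inter> closed_simplex W = closed_simplex (V \<inter> W)" if "V \<in> K" "W \<in> K" for V W
    by (rule bspec[OF bspec[OF *(3) that(1)] that(2)])
qed

text \<open>A common point lies in the closed simplex on \<open>V \<inter> W\<close>, a face of
  both, and a point of an open simplex lies on no proper face.\<close>

lemma open_simplices_disjoint:
  assumes K: "euclidean_complex N K" "V \<in> K" "W \<in> K"
    and y: "y \<in> open_simplex V" "y \<in> open_simplex W"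
  shows "V = W"
proof -
  have "y \<in> closed_simplex V \<inter> closed_simplex W" using y open_simplex_closed by blast
  moreover have "closed_simplex V \<inter> closed_simplex W = closed_simplex (V \<inter> W)"
    by (rule euclidean_complexD(6)[OF K])
  ultimately have "y \<in> closed_simplex (V \<inter> W)" by blast
  note closed_simplex_coords[OF _ _ _ _ this]
  moreover note euclidean_complexD(2,5)[OF K(1)] K(2,3) y
  ultimately have "V \<subseteq> V \<inter> W" "W \<subseteq> V \<inter> W" by simp_all
  then show ?thesis by blast
qed

context o_minimal_structure
begin

text \<open>The first \<open>k\<close> barycentric coordinates put the open simplex in bijection
  with the corner of \<open>EI_corner\<close> at \<open>r = 1\<close>; the last weight is what is
  missing to \<open>1\<close>.\<close>

lemma open_simplex_EI:
  assumes V: "finite V" "V \<noteq> {}" "V \<subseteq> RR N" "affinely_independent V"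
  shows cfun_open_simplex: "cfun (\<lambda>y. of_bool (cut N y \<in> open_simplex V) :: int)"
    and EI_open_simplex: "EI N (\<lambda>y. of_bool (y \<in> open_simplex V)) = (- 1) ^ (card V - 1)"
proof -
  define k where "k = card V - 1"
  have "card V = Suc k" using V(1,2) by (simp add: k_def card_gt_0_iff)
  then obtain e where e: "bij_betw e {..k} V"
    using ex_bij_betw_nat_finite[OF V(1)] by (auto simp: atLeast0LessThan lessThan_Suc_atMost)
  define w where "w c j = (if j < k then c j else 1 - (\<Sum>j<k. c j))" for c :: "nat \<Rightarrow> real" and j
  define pnt where "pnt c i = (\<Sum>j\<le>k. w c j * e j i)" for c i
  define P where "P c \<longleftrightarrow> (\<forall>j\<in>{..<k}. c j > 0) \<and> (\<Sum>j<k. c j) < 1" for c :: "nat \<Rightarrow> real"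
  \<comment> \<open>Comparing only the coordinates below \<open>N\<close> keeps the conjunction
    finite; on \<open>RR N\<close> it amounts to equality.\<close>
  define G where "G c y \<longleftrightarrow> P c \<and> (\<forall>i\<in>{..<N}. y i = pnt c i)" for c y
  have reidx: "(\<Sum>v\<in>V. f v) = (\<Sum>j\<le>k. f (e j))" for f :: "(nat \<Rightarrow> real) \<Rightarrow> real"
    using sum.reindex_bij_betw[OF e] by metis
  have eV: "e j \<in> V" if "j \<le> k" for j using e that bij_betwE by blast
  have indep: "\<forall>j\<le>k. d j = 0" if "(\<Sum>j\<le>k. d j) = 0" "\<And>i. (\<Sum>j\<le>k. d j * e j i) = 0" for d
  proof -
    define c where "c v = d (inv_into {..k} e v)" for v
    have c: "c (e j) = d j" if "j \<le> k" for j
      using e that unfolding c_def bij_betw_def by simp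
    have "(\<Sum>v\<in>V. c v) = 0" "(\<Sum>v\<in>V. c v * v i) = 0" for i
      unfolding reidx using that by (simp_all add: c)
    then have "\<forall>v\<in>V. c v = 0" using V(4) unfolding affinely_independent_def by blast
    then show ?thesis using c eV by fastforce
  qed
  have w_sum: "(\<Sum>j\<le>k. w c j) = 1" for c
    by (simp add: lessThan_Suc_atMost[symmetric] w_def)
  have pnt_RR: "pnt c \<in> RR N" for c
  proof -
    have "e j i = 0" if "j \<le> k" "N \<le> i" for j i
      using subsetD[OF V(3) eV[OF that(1)]] that(2) unfolding RR_iff by simp
    then show ?thesis unfolding RR_iff pnt_def by simp
  qed
  have pnt_open: "pnt c \<in> open_simplex V" if "P c" for c
  proof -
    define a where "a v = w c (inv_into {..k} e v)" for v
    have a: "a (e j) = w c j" if "j \<le> k" for j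
      using e that unfolding a_def bij_betw_def by simp
    have "w c j > 0" for j using that by (simp add: w_def P_def)
    then have "\<forall>v\<in>V. a v > 0" by (simp add: a_def)
    moreover have "(\<Sum>v\<in>V. a v) = 1" unfolding reidx using w_sum by (simp add: a)
    moreover have "pnt c = (\<lambda>i. \<Sum>v\<in>V. a v * v i)" unfolding reidx pnt_def by (simp add: a)
    ultimately show ?thesis unfolding open_simplex_def by blast
  qed
  have open_pnt: "\<exists>c\<in>RR k. P c \<and> y = pnt c" if "y \<in> open_simplex V" for y
  proof -
    obtain a where a: "y = (\<lambda>i. \<Sum>v\<in>V. a v * v i)" "\<forall>v\<in>V. a v > 0" "(\<Sum>v\<in>V. a v) = 1"
      using \<open>y \<in> open_simplex V\<close> unfolding open_simplex_def by blast
    define c where "c = cut k (\<lambda>j. a (e j))"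
    have a1: "(\<Sum>j<k. a (e j)) + a (e k) = 1"
      using a(3) unfolding reidx by (simp add: lessThan_Suc_atMost[symmetric])
    have ak: "a (e k) > 0" using a(2) eV by simp
    have cj: "(\<Sum>j<k. c j) = (\<Sum>j<k. a (e j))" by (simp add: c_def cut_def)
    have wk: "w c j = a (e j)" if "j \<le> k" for j
      using that a1 cj by (auto simp: w_def c_def cut_def)
    have "P c" unfolding P_def cj
    proof
      show "\<forall>j\<in>{..<k}. c j > 0" using a(2) eV by (simp add: c_def cut_def)
      show "(\<Sum>j<k. a (e j)) < 1" using a1 ak by linarith
    qed
    moreover have "y = pnt c" unfolding a(1) pnt_def reidx by (intro ext sum.cong) (auto simp: wk)
    ultimately show ?thesis using cut_in_RR unfolding c_def by blast
  qed
  have pnt_inj: "c = c'" if "c \<in> RR k" "c' \<in> RR k" "pnt c = pnt c'" for c c'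
  proof -
    have "(\<Sum>j\<le>k. w c j - w c' j) = 0" by (simp add: sum_subtractf w_sum)
    moreover have "(\<Sum>j\<le>k. (w c j - w c' j) * e j i) = 0" for i
      using fun_cong[OF that(3), of i] by (simp add: left_diff_distrib sum_subtractf pnt_def)
    ultimately have "\<forall>j\<le>k. w c j - w c' j = 0" by (rule indep)
    then have "c j = c' j" if "j < k" for j using that by (auto simp: w_def dest!: spec[of _ j])
    moreover have "c j = c' j" if "\<not> j < k" for j using that \<open>c \<in> _\<close> \<open>c' \<in> _\<close> by (simp add: RR_iff)
    ultimately show ?thesis by blast
  qed
  have G_iff: "G c y \<longleftrightarrow> P c \<and> y = pnt c" if "y \<in> RR N" for c y
  proof -
    have "(\<forall>i\<in>{..<N}. y i = pnt c i) \<longleftrightarrow> y = pnt c"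
      using that pnt_RR[of c] unfolding RR_iff fun_eq_iff by (metis lessThan_iff not_le)
    then show ?thesis by (simp add: G_def)
  qed
  have dw: "dfun (\<lambda>s. w (\<lambda>i. s (2 * i)) j)" for j
    unfolding w_def by (cases "j < k") (auto intro!: dpred_intros)
  have G: "cfun2 G"
    unfolding cfun2_def G_def P_def pnt_def
    by (intro cfun_bool dpred_conj dpred_fin_all dpred_eq dpred_less dfun_sum dfun_mult dw
        dfun_var dfun_const finite_lessThan finite_atMost)
  have P_EI: "EI k (\<lambda>c. of_bool (P c)) = (- 1) ^ k"
    using EI_corner[of k 1] unfolding P_def Ball_def lessThan_iff by simp
  have ex1: "\<exists>!c. c \<in> RR k \<and> G c y" if y: "y \<in> RR N" "y \<in> open_simplex V" for y
  proof -
    obtain c where "c \<in> RR k" "P c" "y = pnt c" using open_pnt[OF y(2)] by blast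
    then show ?thesis using G_iff[OF y(1)] pnt_inj by (intro ex1I[of _ c]) auto
  qed
  have GD: "P c \<and> y \<in> open_simplex V" if "c \<in> RR k" "y \<in> RR N" "G c y" for c y
  proof -
    have "P c \<and> y = pnt c" using G_iff[OF that(2)] that(3) by simp
    then show ?thesis using pnt_open by simp
  qed
  have ex1': "\<exists>!y. y \<in> RR N \<and> G c y" if "c \<in> RR k" "P c" for c
  proof (rule ex1I[of _ "pnt c"])
    show "pnt c \<in> RR N \<and> G c (pnt c)" using pnt_RR G_iff[OF pnt_RR] that(2) by simp
    show "y = pnt c" if "y \<in> RR N \<and> G c y" for y using that G_iff[of y c] by simp
  qed
  have "EI k (\<lambda>c. of_bool (P c)) = EI N (\<lambda>y. of_bool (y \<in> open_simplex V))"
    by (rule EI_correspondence[OF G GD ex1' ex1])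
  then show "EI N (\<lambda>y. of_bool (y \<in> open_simplex V)) = (- 1) ^ (card V - 1)"
    using P_EI k_def by simp
  \<comment> \<open>Membership in the open simplex is the integral over \<open>c\<close> of the
    correspondence, whose fibres have at most one point; constructibility follows without
    eliminating \<open>c\<close> by hand.\<close>
  have "cfun2 (\<lambda>y c. of_bool (G c y) :: int)"
    unfolding cfun2_def by (intro cfun_map[OF cfun2D[OF G]] dpred_intros)
  then have F: "cfun (\<lambda>y. EI k (\<lambda>c. of_bool (G c (cut N y))))"
    by (rule cfun_comp[OF cfun_EI]) (intro dpred_intros)
  have "EI k (\<lambda>c. of_bool (G c y)) = of_bool (y \<in> open_simplex V)" if y: "y \<in> RR N" for y
  proof (cases "y \<in> open_simplex V")
    case True
    then obtain c where c: "c \<in> RR k" "G c y" "\<And>c'. c' \<in> RR k \<Longrightarrow> G c' y \<Longrightarrow> c' = c"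
      using ex1[OF y] by blast
    then have eq: "G c' y \<longleftrightarrow> c' = c" if "c' \<in> RR k" for c' using that by blast
    have "EI k (\<lambda>c. of_bool (G c y)) = EI k (\<lambda>c'. of_bool (c' = c))"
      by (intro EI_cong) (simp add: eq)
    then show ?thesis using EI_point[OF c(1)] True by simp
  next
    case False
    have "EI k (\<lambda>c. of_bool (G c y)) = EI k (\<lambda>c. 0)"
      using GD[OF _ y] False by (intro EI_cong) auto
    then show ?thesis using False by simp
  qed
  with F show "cfun (\<lambda>y. of_bool (cut N y \<in> open_simplex V) :: int)" by simp
qed

text \<open>The alternating sum is the integral over a disjoint union of open simplices, and the
  bijection carries this integral back to \<open>X\<close>. As the right-hand side does not mention
  the complex, uniqueness follows.\<close>

theorem has_euler_char_EI:
  assumes "has_euler_char \<O> n X k"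
  shows "k = EI n (\<lambda>x. of_bool (x \<in> X))"
proof -
  obtain N K T \<phi> where K: "euclidean_complex N K" "T \<subseteq> K"
    and \<phi>: "definable_map \<O> n X N (\<Union>V\<in>T. open_simplex V) \<phi>"
      "bij_betw \<phi> X (\<Union>V\<in>T. open_simplex V)"
    and k: "k = (\<Sum>V\<in>T. (- 1) ^ (card V - 1))"
    using assms unfolding has_euler_char_def by (elim exE conjE)
  have T: "finite T" using finite_subset[OF K(2)] euclidean_complexD(1)[OF K(1)] by simp
  have V: "finite V" "V \<noteq> {}" "V \<subseteq> RR N" "affinely_independent V" if "V \<in> T" for V
    using euclidean_complexD(2-5)[OF K(1)] subsetD[OF K(2) that] by simp_all
  have "of_bool (y \<in> (\<Union>V\<in>T. open_simplex V)) = (\<Sum>V\<in>T. of_bool (y \<in> open_simplex V) :: int)" for y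
  proof (cases "\<exists>V\<in>T. y \<in> open_simplex V")
    case True
    then obtain V where V: "V \<in> T" "y \<in> open_simplex V" by blast
    have uniq: "W = V" if "W \<in> T" "y \<in> open_simplex W" for W
      using open_simplices_disjoint[OF K(1) _ _ that(2) V(2)] that(1) V(1) K(2) by blast
    have "of_bool (y \<in> open_simplex W) = (if W = V then 1 else 0 :: int)" if "W \<in> T" for W
    proof (cases "y \<in> open_simplex W")
      case True
      from uniq[OF that True] True show ?thesis by simp
    next
      case False
      then have "W \<noteq> V" using V(2) by blast
      with False show ?thesis by simp
    qed
    then have "(\<Sum>W\<in>T. of_bool (y \<in> open_simplex W) :: int) = (\<Sum>W\<in>T. if W = V then 1 else 0)"
      by (rule sum.cong[OF refl])
    then show ?thesis using V T by auto
  qed auto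
  then have "EI N (\<lambda>y. of_bool (y \<in> (\<Union>V\<in>T. open_simplex V))) =
      EI N (\<lambda>y. \<Sum>V\<in>T. of_bool (cut N y \<in> open_simplex V))"
    by (intro EI_cong) (simp add: cut_id)
  also have "\<dots> = (\<Sum>V\<in>T. EI N (\<lambda>y. of_bool (cut N y \<in> open_simplex V)))"
    using V by (intro EI_sum T cfun_open_simplex)
  also have "\<dots> = k"
    unfolding k
  proof (rule sum.cong[OF refl])
    fix V assume "V \<in> T"
    have "EI N (\<lambda>y. of_bool (cut N y \<in> open_simplex V)) = EI N (\<lambda>y. of_bool (y \<in> open_simplex V))"
      by (intro EI_cong) (simp add: cut_id)
    then show "EI N (\<lambda>y. of_bool (cut N y \<in> open_simplex V)) = (- 1) ^ (card V - 1)"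
      using EI_open_simplex[OF V, OF \<open>V \<in> T\<close> \<open>V \<in> T\<close> \<open>V \<in> T\<close> \<open>V \<in> T\<close>] by simp
  qed
  finally show ?thesis using EI_graph[OF \<phi>] by simp
qed

end

subsection \<open>Decomposition into cells\<close>

lemma unbounded_rays: "\<not> bdd_below {..<b}" "\<not> bdd_above {b<..}" for b :: real
proof -
  have "\<exists>x<b. x < m" for m by (rule exI[of _ "min m b - 1"]) (auto simp: min_def)
  moreover have "\<exists>x>b. m < x" for m by (rule exI[of _ "max m b + 1"]) (auto simp: max_def)
  ultimately show "\<not> bdd_below {..<b}" "\<not> bdd_above {b<..}"
    unfolding bdd_below_def bdd_above_def by (meson greaterThan_iff lessThan_iff not_le)+
qed

text \<open>Rays are translated or reflected onto the positive half-line, bounded intervals are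
  mapped by a fraction. The formulas are rational in \<open>t\<close> and the end points, of which
  the whole line has none.\<close>

lemma cell_coordinate_change:
  assumes "ival A" "A \<noteq> {}" "A \<noteq> UNIV"
    and bounds: "\<And>a. A = {a<..} \<Longrightarrow> l = a" "\<And>a b. a < b \<Longrightarrow> A = {a<..<b} \<Longrightarrow> l = a \<and> u = b"
      "\<And>b. A = {..<b} \<Longrightarrow> u = b"
  shows "bij_betw (\<lambda>t. if bdd_below A then if bdd_above A then (t - l) / (u - t) else t - l else u - t) A {0<..}"
  using assms(1,2)
proof (cases rule: ival_cases)
  case 1
  then show ?thesis using assms(3) by simp
next
  case (2 b)
  then have "u = b" "\<not> bdd_below A" using bounds(3) unbounded_rays by auto
  then show ?thesis
    by (intro bij_betw_byWitness[where f' = "\<lambda>s. u - s"]) (auto simp: 2)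
next
  case (3 a)
  then have "l = a" "bdd_below A" "\<not> bdd_above A" using bounds(1) unbounded_rays by auto
  then show ?thesis
    by (intro bij_betw_byWitness[where f' = "\<lambda>s. s + l"]) (auto simp: 3)
next
  case (4 a b)
  then have lu: "l = a" "u = b" "bdd_below A" "bdd_above A" using bounds(2) by auto
  have "bij_betw (\<lambda>t. (t - a) / (b - t)) {a<..<b} {0<..}"
  \<comment> \<open>The witness solves \<open>s = (t - a) / (b - t)\<close> for
    \<open>t\<close>.\<close>
  proof (rule bij_betw_byWitness[where f' = "\<lambda>s. (a + s * b) / (1 + s)"])
    show "\<forall>t\<in>{a<..<b}. (a + (t - a) / (b - t) * b) / (1 + (t - a) / (b - t)) = t"
    proof
      fix t assume "t \<in> {a<..<b}"
      then have t: "b - t > 0" by simp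
      have "a + (t - a) / (b - t) * b = t * (b - a) / (b - t)" "1 + (t - a) / (b - t) = (b - a) / (b - t)"
        using t by (simp_all add: field_simps)
      then show "(a + (t - a) / (b - t) * b) / (1 + (t - a) / (b - t)) = t"
        using t 4(1) by simp
    qed
    show "\<forall>s\<in>{0<..}. ((a + s * b) / (1 + s) - a) / (b - (a + s * b) / (1 + s)) = s"
    proof
      fix s :: real assume "s \<in> {0<..}"
      then have s: "1 + s > 0" by simp
      have "(a + s * b) / (1 + s) - a = s * (b - a) / (1 + s)"
        "b - (a + s * b) / (1 + s) = (b - a) / (1 + s)"
        using s by (simp_all add: field_simps)
      then show "((a + s * b) / (1 + s) - a) / (b - (a + s * b) / (1 + s)) = s"
        using s 4(1) by simp
    qed
    show "(\<lambda>t. (t - a) / (b - t)) ` {a<..<b} \<subseteq> {0<..}" by auto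
    show "(\<lambda>s. (a + s * b) / (1 + s)) ` {0<..} \<subseteq> {a<..<b}"
    proof
      fix x assume "x \<in> (\<lambda>s. (a + s * b) / (1 + s)) ` {0<..}"
      then obtain s where s: "s > 0" "x = (a + s * b) / (1 + s)" by auto
      then have "a * (1 + s) < a + s * b" "a + s * b < b * (1 + s)"
        using 4(1) by (simp_all add: algebra_simps)
      then show "x \<in> {a<..<b}" using s by (simp add: pos_less_divide_eq pos_divide_less_eq)
    qed
  qed
  then show ?thesis using lu 4 by simp
qed

text \<open>Boundedness is spelled out by quantifiers over reals and the value defaults to
  \<open>0\<close>, so that \<open>lo (R z)\<close> is a definable function of the parameters for
  every definable family.\<close>

definition lo :: "(real \<Rightarrow> bool) \<Rightarrow> real" where
  "lo A = (if (\<exists>t. A t) \<and> (\<exists>m. \<forall>t. A t \<longrightarrow> m \<le> t) then Inf {t. A t} else 0)"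

definition hi :: "(real \<Rightarrow> bool) \<Rightarrow> real" where
  "hi A = - lo (\<lambda>t. A (- t))"

lemma lo_eqI:
  assumes "{t. A t} = {a<..} \<or> (a < b \<and> {t. A t} = {a<..<b})"
  shows "lo A = a"
proof -
  have iff: "(\<forall>t. A t \<longleftrightarrow> a < t) \<or> (a < b \<and> (\<forall>t. A t \<longleftrightarrow> a < t \<and> t < b))"
    using assms unfolding set_eq_iff by simp
  then have "A (a + 1) \<or> A ((a + b) / 2)" by (elim disjE conjE) simp_all
  then have "\<exists>t. A t" by blast
  moreover have "a \<le> t" if "A t" for t using iff that by (elim disjE conjE) simp_all
  then have "\<exists>m. \<forall>t. A t \<longrightarrow> m \<le> t" by blast
  moreover have "Inf {t. A t} = a" using assms by (elim disjE conjE) simp_all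
  ultimately show ?thesis unfolding lo_def by simp
qed

lemma hi_eqI:
  assumes "{t. A t} = {..<b} \<or> (a < b \<and> {t. A t} = {a<..<b})"
  shows "hi A = b"
proof -
  have "{t. A (- t)} = {-b<..} \<or> (-b < -a \<and> {t. A (- t)} = {-b<..< -a})"
    using assms unfolding set_eq_iff by (elim disjE conjE) (simp_all add: minus_less_iff less_minus_iff conj_commute)
  from lo_eqI[OF this] show ?thesis by (simp add: hi_def)
qed

definition flat :: "(real \<Rightarrow> bool) \<Rightarrow> real \<Rightarrow> real" where
  "flat A t = (if \<exists>m. \<forall>t. A t \<longrightarrow> m \<le> t then
     if \<exists>m. \<forall>t. A t \<longrightarrow> t \<le> m then (t - lo A) / (hi A - t) else t - lo A else hi A - t)"

lemma bij_betw_flat: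
  assumes "ival {t. A t}" "\<exists>t. A t" "\<exists>t. \<not> A t"
  shows "bij_betw (flat A) {t. A t} {0<..}"
proof -
  have "bij_betw (\<lambda>t. if bdd_below {t. A t} then if bdd_above {t. A t} then (t - lo A) / (hi A - t)
      else t - lo A else hi A - t) {t. A t} {0<..}"
    using assms lo_eqI[of A] hi_eqI[of A] by (intro cell_coordinate_change) auto
  then show ?thesis unfolding flat_def bdd_below_def bdd_above_def Ball_def mem_Collect_eq .
qed

text \<open>Open orthants serve as model cells, since prefixing a half-line to one of them gives the
  next.\<close>

definition pos :: "nat \<Rightarrow> (nat \<Rightarrow> real) set" where
  "pos k = {u \<in> RR k. \<forall>i<k. u i > 0}"

lemma scons_in_pos: "t ## u \<in> pos (Suc k) \<longleftrightarrow> t > 0 \<and> u \<in> pos k"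
  by (auto simp: pos_def less_Suc_eq_0_disj)

context o_minimal_structure
begin

text \<open>Only a definable bijection with an orthant is asked for, in keeping with an Euler
  characteristic defined through arbitrary definable bijections.\<close>

definition cell :: "nat \<Rightarrow> (nat \<Rightarrow> real) set \<Rightarrow> bool" where
  "cell n c \<longleftrightarrow> (\<exists>P \<phi> k. dpred P \<and> dseq \<phi> \<and> c = {x \<in> RR n. P x} \<and> bij_betw \<phi> c (pos k))"

definition cellular :: "nat \<Rightarrow> (nat \<Rightarrow> real) set \<Rightarrow> bool" where
  "cellular n S \<longleftrightarrow> (\<exists>C. finite C \<and> disjoint C \<and> \<Union>C = S \<and> (\<forall>c\<in>C. cell n c))"

lemma cellular_empty: "cellular n {}"
  unfolding cellular_def by (intro exI[of _ "{}"]) auto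

lemma cellular_Un:
  assumes "cellular n S" "cellular n T" "S \<inter> T = {}"
  shows "cellular n (S \<union> T)"
proof -
  obtain C where C: "finite C" "disjoint C" "\<Union>C = S" "\<forall>c\<in>C. cell n c"
    using assms(1) unfolding cellular_def by blast
  obtain D where D: "finite D" "disjoint D" "\<Union>D = T" "\<forall>c\<in>D. cell n c"
    using assms(2) unfolding cellular_def by blast
  have "disjoint (C \<union> D)" using C D assms(3) by (intro disjoint_union) auto
  then show ?thesis
    unfolding cellular_def using C D by (intro exI[of _ "C \<union> D"]) auto
qed

lemma cellular_UN:
  assumes "finite I" "\<And>i. i \<in> I \<Longrightarrow> cellular n (S i)" "disjoint_family_on S I"
  shows "cellular n (\<Union>i\<in>I. S i)"
  using assms
proof (induction I)
  case (insert i I)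
  have "S i \<inter> (\<Union>i\<in>I. S i) = {}"
    using insert.prems(2) insert.hyps(2) by (auto simp: disjoint_family_on_def)
  moreover have "disjoint_family_on S I"
    using insert.prems(2) by (simp add: disjoint_family_on_def)
  ultimately have "cellular n (S i \<union> (\<Union>i\<in>I. S i))"
    using insert.IH insert.prems(1) by (intro cellular_Un) simp_all
  then show ?case by simp
qed (simp add: cellular_empty)

text \<open>Decompositions are transported backwards along a bijection: the preimage of a cell is a
  cell, with the composed coordinates.\<close>

lemma cellular_pullback:
  assumes P: "dpred P" and \<psi>: "dseq \<psi>" "bij_betw \<psi> {x \<in> RR n. P x} S" and S: "cellular m S"
  shows "cellular n {x \<in> RR n. P x}"
proof -
  let ?X = "{x \<in> RR n. P x}"
  obtain C where C: "finite C" "disjoint C" "\<Union>C = S" "\<And>c. c \<in> C \<Longrightarrow> cell m c"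
    using S unfolding cellular_def by blast
  define pre where "pre c = {x \<in> ?X. \<psi> x \<in> c}" for c
  have img: "\<psi> x \<in> S" if "x \<in> ?X" for x using \<psi>(2) that bij_betwE by blast
  have "cell n (pre c)" if c: "c \<in> C" for c
  proof -
    obtain Q \<phi> k where Q: "dpred Q" "dseq \<phi>" "c = {x \<in> RR m. Q x}" "bij_betw \<phi> c (pos k)"
      using C(4)[OF c] unfolding cell_def by (elim exE conjE)
    have "\<psi> x \<in> RR m" if x: "x \<in> ?X" for x
    proof -
      obtain d where d: "d \<in> C" "\<psi> x \<in> d" using img[OF x] C(3) by blast
      obtain P' where "d = {x \<in> RR m. P' x}" using C(4)[OF d(1)] unfolding cell_def by (elim exE conjE)
      with d(2) show ?thesis by simp
    qed
    then have eq: "pre c = {x \<in> RR n. P x \<and> Q (\<psi> x)}" unfolding pre_def Q(3) by blast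
    have "bij_betw \<psi> (pre c) c"
    proof (rule bij_betw_subset[OF \<psi>(2)])
      show "pre c \<subseteq> ?X" by (auto simp: pre_def)
      have "c \<subseteq> S" using c C(3) by blast
      then show "\<psi> ` pre c = c"
        using \<psi>(2) unfolding pre_def bij_betw_def by force
    qed
    then have "bij_betw (\<phi> \<circ> \<psi>) (pre c) (pos k)" using Q(4) by (rule bij_betw_trans)
    moreover have "dpred (\<lambda>x. P x \<and> Q (\<psi> x))" by (intro dpred_conj P dpred_comp[OF Q(1) \<psi>(1)])
    moreover have "dseq (\<phi> \<circ> \<psi>)" using dseq_comp[OF Q(2) \<psi>(1)] by (simp add: o_def)
    ultimately show ?thesis unfolding cell_def using eq by blast
  qed
  moreover have "disjoint (pre ` C)"
  proof (rule disjointI)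
    fix a b assume "a \<in> pre ` C" "b \<in> pre ` C" "a \<noteq> b"
    then obtain c d where "c \<in> C" "d \<in> C" "a = pre c" "b = pre d" "c \<noteq> d" by blast
    moreover from this have "c \<inter> d = {}" using C(2) disjointD by blast
    ultimately show "a \<inter> b = {}" unfolding pre_def by blast
  qed
  moreover have "\<Union>(pre ` C) = ?X" using img C(3) unfolding pre_def by blast
  ultimately show ?thesis
    unfolding cellular_def using C(1) by (intro exI[of _ "pre ` C"]) auto
qed

lemma cellular_half_line_times:
  assumes "cellular n Q"
  shows "cellular (Suc n) {t ## x |t x. t > 0 \<and> x \<in> Q}"
proof -
  obtain C where C: "finite C" "disjoint C" "\<Union>C = Q" "\<And>c. c \<in> C \<Longrightarrow> cell n c"
    using assms unfolding cellular_def by blast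
  define up where "up c = {t ## x |t x. t > 0 \<and> x \<in> c}" for c
  have inj: "t ## x = t' ## x' \<longleftrightarrow> t = t' \<and> x = x'" for t t' x x' by (metis scons_simps ext)
  have "cell (Suc n) (up c)" if c: "c \<in> C" for c
  proof -
    obtain P \<phi> k where P: "dpred P" "dseq \<phi>" "c = {x \<in> RR n. P x}" "bij_betw \<phi> c (pos k)"
      using C(4)[OF c] unfolding cell_def by (elim exE conjE)
    define \<Phi> where "\<Phi> s = s 0 ## \<phi> (\<lambda>i. s (Suc i))" for s
    have \<Phi>: "\<Phi> (t ## x) = t ## \<phi> x" for t x by (simp add: \<Phi>_def)
    have "up c = {s \<in> RR (Suc n). s 0 > 0 \<and> P (\<lambda>i. s (Suc i))}"
    proof (intro subset_antisym subsetI)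
      fix s assume "s \<in> {s \<in> RR (Suc n). s 0 > 0 \<and> P (\<lambda>i. s (Suc i))}"
      moreover obtain t x where s: "s = t ## x" "x \<in> RR n" using RR_SucE calculation by blast
      ultimately show "s \<in> up c" unfolding up_def P(3) by auto
    qed (auto simp: up_def P(3))
    moreover have "bij_betw \<Phi> (up c) (pos (Suc k))"
      unfolding bij_betw_def
    proof (intro conjI inj_onI subset_antisym subsetI)
      fix a b assume "a \<in> up c" "b \<in> up c" "\<Phi> a = \<Phi> b"
      then obtain t x t' x' where ab: "a = t ## x" "x \<in> c" "b = t' ## x'" "x' \<in> c" "t ## \<phi> x = t' ## \<phi> x'"
        unfolding up_def using \<Phi> by (elim CollectE exE conjE) simp
      then have "x = x'" using P(4) unfolding inj bij_betw_def inj_on_def by blast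
      then show "a = b" using ab inj by simp
    next
      fix s assume "s \<in> \<Phi> ` up c"
      then show "s \<in> pos (Suc k)"
        using P(4) unfolding up_def bij_betw_def by (auto simp: \<Phi> scons_in_pos)
    next
      fix s assume s: "s \<in> pos (Suc k)"
      then obtain t u where tu: "s = t ## u" using scons_tail[of s] by metis
      then have "t > 0" "u \<in> pos k" using s scons_in_pos by auto
      moreover from this obtain x where "x \<in> c" "u = \<phi> x" using P(4) unfolding bij_betw_def by blast
      ultimately have "t ## x \<in> up c" "s = \<Phi> (t ## x)" unfolding up_def using tu \<Phi> by auto
      then show "s \<in> \<Phi> ` up c" by blast
    qed
    moreover have "dpred (\<lambda>s. s 0 > 0 \<and> P (\<lambda>i. s (Suc i)))"
      by (intro dpred_intros dpred_reindex[OF P(1)])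
    moreover have "dseq \<Phi>"
      unfolding \<Phi>_def by (intro dseq_scons dseq_comp[OF P(2)] dpred_intros)
    ultimately show ?thesis unfolding cell_def by blast
  qed
  moreover have "disjoint (up ` C)"
  proof (rule disjointI)
    fix a b assume "a \<in> up ` C" "b \<in> up ` C" "a \<noteq> b"
    then obtain c d where cd: "c \<in> C" "d \<in> C" "a = up c" "b = up d" "c \<noteq> d" by blast
    then have "c \<inter> d = {}" using C(2) disjointD by blast
    then show "a \<inter> b = {}" unfolding cd(3,4) up_def by (auto simp: inj)
  qed
  moreover have "\<Union>(up ` C) = {t ## x |t x. t > 0 \<and> x \<in> Q}"
    unfolding up_def C(3)[symmetric] by blast
  ultimately show ?thesis
    unfolding cellular_def using C(1) by (intro exI[of _ "up ` C"]) auto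
qed

lemma dfun_lo:
  assumes "dfam R"
  shows "dfun (\<lambda>z. lo (R z))"
proof (rule dfunI[where R = "\<lambda>z y. (((\<exists>t. R z t) \<and> (\<exists>m. \<forall>t. R z t \<longrightarrow> m \<le> t)) \<and>
    (\<forall>t. R z t \<longrightarrow> y \<le> t) \<and> (\<forall>u. (\<forall>t. R z t \<longrightarrow> u \<le> t) \<longrightarrow> u \<le> y)) \<or>
    (\<not> ((\<exists>t. R z t) \<and> (\<exists>m. \<forall>t. R z t \<longrightarrow> m \<le> t)) \<and> y = 0)"])
  show "dpred (\<lambda>s. (((\<exists>t. R (\<lambda>i. s (Suc i)) t) \<and> (\<exists>m. \<forall>t. R (\<lambda>i. s (Suc i)) t \<longrightarrow> m \<le> t)) \<and>
    (\<forall>t. R (\<lambda>i. s (Suc i)) t \<longrightarrow> s 0 \<le> t) \<and>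
    (\<forall>u. (\<forall>t. R (\<lambda>i. s (Suc i)) t \<longrightarrow> u \<le> t) \<longrightarrow> u \<le> s 0)) \<or>
    (\<not> ((\<exists>t. R (\<lambda>i. s (Suc i)) t) \<and> (\<exists>m. \<forall>t. R (\<lambda>i. s (Suc i)) t \<longrightarrow> m \<le> t)) \<and> s 0 = 0))"
    by (intro dpred_intros dfamD[OF assms])
  fix z y
  show "(((\<exists>t. R z t) \<and> (\<exists>m. \<forall>t. R z t \<longrightarrow> m \<le> t)) \<and>
    (\<forall>t. R z t \<longrightarrow> y \<le> t) \<and> (\<forall>u. (\<forall>t. R z t \<longrightarrow> u \<le> t) \<longrightarrow> u \<le> y)) \<or>
    (\<not> ((\<exists>t. R z t) \<and> (\<exists>m. \<forall>t. R z t \<longrightarrow> m \<le> t)) \<and> y = 0) \<longleftrightarrow> y = lo (R z)"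
  proof (cases "(\<exists>t. R z t) \<and> (\<exists>m. \<forall>t. R z t \<longrightarrow> m \<le> t)")
    case True
    have "(\<forall>t. R z t \<longrightarrow> y \<le> t) \<and> (\<forall>u. (\<forall>t. R z t \<longrightarrow> u \<le> t) \<longrightarrow> u \<le> y) \<longleftrightarrow> y = Inf {t. R z t}"
    proof
      assume "(\<forall>t. R z t \<longrightarrow> y \<le> t) \<and> (\<forall>u. (\<forall>t. R z t \<longrightarrow> u \<le> t) \<longrightarrow> u \<le> y)"
      then show "y = Inf {t. R z t}" using True by (intro cInf_eq_non_empty[symmetric]) auto
    next
      assume y: "y = Inf {t. R z t}"
      have "bdd_below {t. R z t}" using True by (auto simp: bdd_below_def)
      then show "(\<forall>t. R z t \<longrightarrow> y \<le> t) \<and> (\<forall>u. (\<forall>t. R z t \<longrightarrow> u \<le> t) \<longrightarrow> u \<le> y)"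
        unfolding y using True by (auto intro!: cInf_lower cInf_greatest)
    qed
    with True show ?thesis by (simp add: lo_def)
  next
    case False
    then show ?thesis unfolding lo_def by (simp only: if_False simp_thms)
  qed
qed

lemma dfun_flat:
  assumes "dfam R"
  shows "dfun (\<lambda>s. flat (R (\<lambda>i. s (Suc i))) (s 0))"
proof -
  have "dfam (\<lambda>z t. R z (- t))" unfolding dfam_def by (intro dfamD[OF assms] dpred_intros)
  note d = dfun_lo[OF assms] dfun_minus[OF dfun_lo[OF this]]
  show ?thesis
    unfolding flat_def hi_def
    by (intro dfun_if dfun_divide dfun_diff dpred_intros dfamD[OF assms] d[THEN dfun_reindex])
qed

text \<open>A fixed rank off \<open>F\<close> singles out one component of the complement of
  \<open>F\<close>, and \<open>X\<close> is constant there; the set is that component or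
  empty.\<close>

lemma component_ival:
  assumes F: "finite F" "brk X \<subseteq> F"
  shows "ival {t. X t \<and> rnk F t = i \<and> t \<notin> F}"
proof -
  have free: "X s = X t \<and> rnk F s = rnk F t" if st: "s \<le> t" "{s..t} \<inter> F = {}" for s t
  proof
    show "X s = X t" using st F(2) by (intro brk_const[OF st(1)]) blast
    have "p < s \<longleftrightarrow> p < t" if "p \<in> F" for p
    proof -
      have "p \<notin> {s..t}" using st(2) that by blast
      then show ?thesis using st(1) by auto
    qed
    then have "{p \<in> F. p < s} = {p \<in> F. p < t}" by blast
    then show "rnk F s = rnk F t" by (simp add: rnk_def)
  qed
  have "open {t. X t \<and> rnk F t = i \<and> t \<notin> F}"
    unfolding open_dist
  proof
    fix t assume t: "t \<in> {t. X t \<and> rnk F t = i \<and> t \<notin> F}"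
    have "open (- F)" using F(1) by (simp add: finite_imp_closed open_Compl)
    then have "\<exists>e>0. \<forall>y. dist y t < e \<longrightarrow> y \<in> - F" using t unfolding open_dist by blast
    then obtain e where e: "e > 0" "\<And>y. dist y t < e \<Longrightarrow> y \<notin> F" by blast
    show "\<exists>e>0. \<forall>y. dist y t < e \<longrightarrow> y \<in> {t. X t \<and> rnk F t = i \<and> t \<notin> F}"
    proof (intro exI[of _ e] conjI allI impI e(1))
      fix y assume y: "dist y t < e"
      have "p \<notin> F" if "p \<in> {min y t..max y t}" for p
        using that y by (intro e(2)) (auto simp: dist_real_def)
      then have "{min y t..max y t} \<inter> F = {}" by blast
      then have "X (min y t) = X (max y t) \<and> rnk F (min y t) = rnk F (max y t)"
        by (intro free) simp_all
      then have "X y = X t \<and> rnk F y = rnk F t" by (cases "y \<le> t") (auto simp: min_def max_def)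
      then show "y \<in> {t. X t \<and> rnk F t = i \<and> t \<notin> F}" using t e(2)[OF y] by simp
    qed
  qed
  moreover have "is_interval {t. X t \<and> rnk F t = i \<and> t \<notin> F}"
    unfolding is_interval_1
  proof (intro ballI allI impI)
    fix a b x
    assume a: "a \<in> {t. X t \<and> rnk F t = i \<and> t \<notin> F}" and b: "b \<in> {t. X t \<and> rnk F t = i \<and> t \<notin> F}"
      and x: "a \<le> x \<and> x \<le> b"
    have "p \<notin> F" if p: "a \<le> p" "p \<le> b" for p
    proof
      assume "p \<in> F"
      moreover from this have "p \<noteq> b" using b by auto
      ultimately have "rnk F p < rnk F b" using p F(1) by (intro rnk_less) auto
      moreover have "rnk F a \<le> rnk F p" using p F(1) by (intro rnk_mono) auto
      ultimately show False using a b by simp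
    qed
    then have "{a..x} \<inter> F = {}" "x \<notin> F" using x by auto
    then show "x \<in> {t. X t \<and> rnk F t = i \<and> t \<notin> F}" using free[of a x] x a by simp
  qed
  ultimately show ?thesis by (simp add: ival_def)
qed

text \<open>Induction on the dimension along lines in the direction of coordinate \<open>0\<close>.
  The \<open>i\<close>-th break points lying in \<open>X\<close> form a graph over a subset of the
  base; the \<open>i\<close>-th open intervals in \<open>X\<close>, straightened by
  \<open>flat\<close>, form a half-line times such a subset. Uniform finiteness bounds
  \<open>i\<close>.\<close>

theorem cellular_definable:
  assumes "dpred X"
  shows "cellular n {x \<in> RR n. X x}"
  using assms
proof (induction n arbitrary: X)
  case 0
  show ?case
  proof (cases "X (\<lambda>_. 0)")
    case True
    have "pos 0 = {\<lambda>_. 0}" by (auto simp: pos_def RR_0)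
    moreover have "{x \<in> RR 0. X x} = {\<lambda>_. 0}" using True by (auto simp: RR_0)
    ultimately have "bij_betw (\<lambda>x. x) {x \<in> RR 0. X x} (pos 0)" by (simp add: bij_betw_def)
    then have "cell 0 {x \<in> RR 0. X x}" unfolding cell_def using 0 dseq_id by blast
    then show ?thesis unfolding cellular_def by (intro exI[of _ "{{x \<in> RR 0. X x}}"]) auto
  next
    case False
    then have "{x \<in> RR 0. X x} = {}" by (auto simp: RR_0)
    then show ?thesis by (simp only: cellular_empty)
  qed
next
  case (Suc n)
  \<comment> \<open>The extra point \<open>0\<close> prevents a component from being the whole line,
    as \<open>bij_betw_flat\<close> demands.\<close>
  define F where "F z = insert 0 (brk (\<lambda>t. X (t ## z)))" for z
  have "cfam (\<lambda>z t. X (t ## z))"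
    unfolding cfam_def by (intro cfun_bool dpred_comp[OF Suc.prems] dpred_intros)
  note brk = dfam_brk[OF this] and fb = finite_brk[OF this]
  have R: "dfam (\<lambda>z t. t \<in> F z)"
    unfolding F_def insert_iff dfam_def by (intro dpred_intros dfamD[OF brk])
  have finF: "finite (F z)" for z using fb by (simp add: F_def)
  have fin: "finite {t. t \<in> F z}" for z using finF by simp
  obtain N where N: "\<forall>z. card {t. t \<in> F z} \<le> N" using uniform_finiteness[OF R fin] ..
  have rnkF: "dfam (\<lambda>z t. rnk (F z) t = i)" for i using dfam_rnk_eq[OF R fin] by simp
  have inj: "t ## x = t' ## x' \<longleftrightarrow> t = t' \<and> x = x'" for t t' x x' by (metis scons_simps ext)
  define on where "on i z t \<longleftrightarrow> X (t ## z) \<and> rnk (F z) t = i \<and> t \<in> F z" for i z t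
  define off where "off i z t \<longleftrightarrow> X (t ## z) \<and> rnk (F z) t = i \<and> t \<notin> F z" for i z t
  have d: "dfam (on i)" "dfam (off i)" for i
    unfolding dfam_def on_def off_def
    by (intro dpred_intros dpred_comp[OF Suc.prems] dfamD[OF R] dfamD[OF rnkF])+
  define Son where "Son i = {s \<in> RR (Suc n). on i (\<lambda>j. s (Suc j)) (s 0)}" for i
  define Soff where "Soff i = {s \<in> RR (Suc n). off i (\<lambda>j. s (Suc j)) (s 0)}" for i
  have tail: "(\<lambda>j. s (Suc j)) \<in> RR n" if "s \<in> RR (Suc n)" for s
    using that by (auto simp: RR_iff)
  have "cellular (Suc n) (Son i)" for i
    unfolding Son_def
  proof (rule cellular_pullback)
    show "dpred (\<lambda>s. on i (\<lambda>j. s (Suc j)) (s 0))" using d(1) unfolding dfam_def .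
    show "dseq (\<lambda>s j. s (Suc j))" by (intro dpred_intros)
    show "cellular n {z \<in> RR n. \<exists>t. on i z t}" by (rule Suc.IH[OF dfam_ex[OF d(1)]])
    show "bij_betw (\<lambda>s j. s (Suc j)) {s \<in> RR (Suc n). on i (\<lambda>j. s (Suc j)) (s 0)} {z \<in> RR n. \<exists>t. on i z t}"
      unfolding bij_betw_def
    proof (intro conjI inj_onI subset_antisym subsetI)
      fix s s' assume s: "s \<in> {s \<in> RR (Suc n). on i (\<lambda>j. s (Suc j)) (s 0)}"
        "s' \<in> {s \<in> RR (Suc n). on i (\<lambda>j. s (Suc j)) (s 0)}" "(\<lambda>j. s (Suc j)) = (\<lambda>j. s' (Suc j))"
      then have "s 0 = s' 0"
        using inj_onD[OF inj_on_rnk[OF finF]] unfolding on_def by (metis (mono_tags, lifting) mem_Collect_eq)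
      with s(3) show "s = s'" using scons_tail by metis
    next
      fix z assume "z \<in> {z \<in> RR n. \<exists>t. on i z t}"
      then obtain t where "z \<in> RR n" "on i z t" by blast
      then show "z \<in> (\<lambda>s j. s (Suc j)) ` {s \<in> RR (Suc n). on i (\<lambda>j. s (Suc j)) (s 0)}"
        by (intro image_eqI[of _ _ "t ## z"]) auto
    qed (use tail in auto)
  qed
  moreover have "cellular (Suc n) (Soff i)" for i
    unfolding Soff_def
  proof (rule cellular_pullback)
    define \<psi> where "\<psi> s = flat (off i (\<lambda>j. s (Suc j))) (s 0) ## (\<lambda>j. s (Suc j))" for s
    have \<psi>: "\<psi> (t ## z) = flat (off i z) t ## z" for t z by (simp add: \<psi>_def)
    show "dpred (\<lambda>s. off i (\<lambda>j. s (Suc j)) (s 0))" using d(2) unfolding dfam_def .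
    show "dseq \<psi>" unfolding \<psi>_def by (intro dseq_scons dfun_flat d(2) dpred_intros)
    show "cellular (Suc n) {t ## z |t z. t > 0 \<and> z \<in> {z \<in> RR n. \<exists>t. off i z t}}"
      by (intro cellular_half_line_times Suc.IH dfam_ex d(2))
    have bij: "bij_betw (flat (off i z)) {t. off i z t} {0<..}" if "\<exists>t. off i z t" for z
    proof (rule bij_betw_flat[OF _ that])
      show "ival {t. off i z t}"
        unfolding off_def by (rule component_ival[OF finF]) (auto simp: F_def)
      show "\<exists>t. \<not> off i z t" by (intro exI[of _ 0]) (simp add: off_def F_def)
    qed
    show "bij_betw \<psi> {s \<in> RR (Suc n). off i (\<lambda>j. s (Suc j)) (s 0)}
        {t ## z |t z. t > 0 \<and> z \<in> {z \<in> RR n. \<exists>t. off i z t}}"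
      unfolding bij_betw_def
    proof (intro conjI inj_onI subset_antisym subsetI)
      fix s s' assume s: "s \<in> {s \<in> RR (Suc n). off i (\<lambda>j. s (Suc j)) (s 0)}"
        "s' \<in> {s \<in> RR (Suc n). off i (\<lambda>j. s (Suc j)) (s 0)}" "\<psi> s = \<psi> s'"
      obtain t z where tz: "s = t ## z" using scons_tail[of s] by metis
      obtain t' z' where tz': "s' = t' ## z'" using scons_tail[of s'] by metis
      have z: "z' = z" "flat (off i z) t = flat (off i z) t'" using s(3) unfolding tz tz' \<psi> inj by auto
      have "off i z t" "off i z t'" using s(1,2) unfolding tz tz' z(1) by auto
      then have "t = t'" using bij[of z] z(2) unfolding bij_betw_def inj_on_def by blast
      then show "s = s'" unfolding tz tz' z(1) by simp
    next
      fix s assume "s \<in> \<psi> ` {s \<in> RR (Suc n). off i (\<lambda>j. s (Suc j)) (s 0)}"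
      then obtain s' where s': "s' \<in> RR (Suc n)" "off i (\<lambda>j. s' (Suc j)) (s' 0)" "s = \<psi> s'" by blast
      obtain t z where tz: "s' = t ## z" "z \<in> RR n" using RR_SucE[OF s'(1)] by metis
      have t: "off i z t" using s'(2) tz(1) by simp
      then have "flat (off i z) t > 0" using bij[of z] unfolding bij_betw_def by blast
      then show "s \<in> {t ## z |t z. t > 0 \<and> z \<in> {z \<in> RR n. \<exists>t. off i z t}}"
        using s'(3) tz t \<psi> by blast
    next
      fix s assume "s \<in> {t ## z |t z. t > 0 \<and> z \<in> {z \<in> RR n. \<exists>t. off i z t}}"
      then obtain u z where u: "s = u ## z" "u > 0" "z \<in> RR n" "\<exists>t. off i z t" by blast
      then have "u \<in> flat (off i z) ` {t. off i z t}" using bij[of z] unfolding bij_betw_def by auto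
      then obtain t where t: "off i z t" "u = flat (off i z) t" by blast
      show "s \<in> \<psi> ` {s \<in> RR (Suc n). off i (\<lambda>j. s (Suc j)) (s 0)}"
      proof (rule image_eqI[of _ _ "t ## z"])
        show "s = \<psi> (t ## z)" using u(1) t(2) \<psi> by simp
      qed (use u t in auto)
    qed
  qed
  ultimately have "cellular (Suc n) (\<Union>i\<in>{..N}. Son i)" "cellular (Suc n) (\<Union>i\<in>{..N}. Soff i)"
    by (auto intro!: cellular_UN simp: disjoint_family_on_def Son_def Soff_def on_def off_def)
  then have "cellular (Suc n) ((\<Union>i\<in>{..N}. Son i) \<union> (\<Union>i\<in>{..N}. Soff i))"
    by (rule cellular_Un) (auto simp: Son_def Soff_def on_def off_def)
  moreover have "(\<Union>i\<in>{..N}. Son i) \<union> (\<Union>i\<in>{..N}. Soff i) = {x \<in> RR (Suc n). X x}"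
  proof (intro subset_antisym subsetI)
    fix s assume "s \<in> {x \<in> RR (Suc n). X x}"
    then have s: "s \<in> RR (Suc n)" "X (s 0 ## (\<lambda>j. s (Suc j)))" by (simp_all add: scons_tail)
    let ?i = "rnk (F (\<lambda>j. s (Suc j))) (s 0)"
    have "?i \<le> card (F (\<lambda>j. s (Suc j)))" by (rule rnk_le_card[OF finF])
    also have "\<dots> \<le> N" using spec[OF N, of "\<lambda>j. s (Suc j)"] by simp
    finally have "?i \<in> {..N}" by simp
    moreover have "s \<in> Son ?i \<or> s \<in> Soff ?i"
      using s by (simp add: Son_def Soff_def on_def off_def)
    ultimately show "s \<in> (\<Union>i\<in>{..N}. Son i) \<union> (\<Union>i\<in>{..N}. Soff i)" by blast
  qed (auto simp: Son_def Soff_def on_def off_def scons_tail)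
  ultimately show ?case by simp
qed

end

subsection \<open>Faces of the standard simplex\<close>

definition unit :: "nat \<Rightarrow> nat \<Rightarrow> real" where
  "unit i = (\<lambda>j. if j = i then 1 else 0)"

lemma inj_unit: "inj unit"
  unfolding inj_def unit_def fun_eq_iff by (metis zero_neq_one)

lemma inj_on_unit: "inj_on unit J"
  using inj_unit subset_UNIV by (rule inj_on_subset)

lemma unit_combination:
  assumes "finite J"
  shows "(\<Sum>v\<in>unit ` J. c v * v i) = (if i \<in> J then c (unit i) else 0)"
proof -
  have "(\<Sum>v\<in>unit ` J. c v * v i) = (\<Sum>j\<in>J. c (unit j) * unit j i)"
    by (subst sum.reindex) (simp_all add: inj_on_unit)
  also have "\<dots> = (\<Sum>j\<in>J. if i = j then c (unit j) else 0)"
    by (rule sum.cong) (auto simp: unit_def)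
  also have "\<dots> = (if i \<in> J then c (unit i) else 0)" using assms by simp
  finally show ?thesis .
qed

text \<open>Over unit vectors, barycentric coordinates are the Cartesian ones. \<open>P\<close> is
  left open so that open and closed simplices are treated at once.\<close>

lemma unit_simplex:
  assumes "finite J"
  shows "{(\<lambda>i. \<Sum>v\<in>unit ` J. c v * v i) | c. (\<forall>v\<in>unit ` J. P (c v)) \<and> (\<Sum>v\<in>unit ` J. c v) = (1::real)} =
    {y. (\<forall>i\<in>J. P (y i)) \<and> (\<forall>i. i \<notin> J \<longrightarrow> y i = 0) \<and> (\<Sum>i\<in>J. y i) = 1}" (is "?L = ?R")
proof (intro subset_antisym subsetI)
  have s: "(\<Sum>v\<in>unit ` J. c v) = (\<Sum>j\<in>J. c (unit j))" for c :: "(nat \<Rightarrow> real) \<Rightarrow> real"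
    by (subst sum.reindex) (simp_all add: inj_on_unit)
  fix y assume "y \<in> ?L"
  then obtain c where c: "y = (\<lambda>i. if i \<in> J then c (unit i) else 0)" "\<forall>v\<in>unit ` J. P (c v)"
    "(\<Sum>v\<in>unit ` J. c v) = 1"
    unfolding unit_combination[OF assms] by blast
  then show "y \<in> ?R" using c(3)[unfolded s] by simp
next
  have s: "(\<Sum>v\<in>unit ` J. c v) = (\<Sum>j\<in>J. c (unit j))" for c :: "(nat \<Rightarrow> real) \<Rightarrow> real"
    by (subst sum.reindex) (simp_all add: inj_on_unit)
  fix y assume y: "y \<in> ?R"
  define c where "c v = y (inv unit v)" for v
  have c: "c (unit i) = y i" for i using inj_unit by (simp add: c_def)
  have "y = (\<lambda>i. \<Sum>v\<in>unit ` J. c v * v i)" unfolding unit_combination[OF assms] c using y by auto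
  moreover have "\<forall>v\<in>unit ` J. P (c v)" using y c by simp
  moreover have "(\<Sum>v\<in>unit ` J. c v) = 1" unfolding s c using y by simp
  ultimately show "y \<in> ?L" by blast
qed

lemma open_unit_simplex: "finite J \<Longrightarrow> open_simplex (unit ` J) =
    {y. (\<forall>i\<in>J. y i > 0) \<and> (\<forall>i. i \<notin> J \<longrightarrow> y i = 0) \<and> (\<Sum>i\<in>J. y i) = 1}"
  unfolding open_simplex_def by (rule unit_simplex)

lemma closed_unit_simplex: "finite J \<Longrightarrow> closed_simplex (unit ` J) =
    {y. (\<forall>i\<in>J. y i \<ge> 0) \<and> (\<forall>i. i \<notin> J \<longrightarrow> y i = 0) \<and> (\<Sum>i\<in>J. y i) = 1}"
  unfolding closed_simplex_def by (rule unit_simplex)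

lemma standard_complex: "euclidean_complex M {unit ` J | J. J \<subseteq> {..<M} \<and> J \<noteq> {}}" (is "euclidean_complex M ?K")
  unfolding euclidean_complex_def
proof (intro conjI ballI allI impI)
  have "?K \<subseteq> (\<lambda>J. unit ` J) ` Pow {..<M}" by blast
  then show "finite ?K" by (rule finite_subset) simp
next
  fix V assume "V \<in> ?K"
  then obtain J where J: "V = unit ` J" "J \<subseteq> {..<M}" "J \<noteq> {}" by blast
  have fin: "finite J" using J(2) finite_subset by blast
  show "finite V" "V \<noteq> {}" using J fin by auto
  show "V \<subseteq> RR M" using J by (auto simp: RR_iff unit_def)
  show "affinely_independent V"
    unfolding affinely_independent_def J(1) unit_combination[OF fin]
    by (auto split: if_splits)
  show "W \<in> ?K" if "W \<subseteq> V \<and> W \<noteq> {}" for W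
  proof -
    obtain J' where "J' \<subseteq> J" "W = unit ` J'" using \<open>W \<subseteq> V \<and> W \<noteq> {}\<close> J(1) subset_imageE by metis
    then show ?thesis using J(2) that by blast
  qed
  fix W assume "W \<in> ?K"
  then obtain J' where J': "W = unit ` J'" "J' \<subseteq> {..<M}" by blast
  have fin': "finite J'" using J'(2) finite_subset by blast
  have VW: "V \<inter> W = unit ` (J \<inter> J')" unfolding J J' using inj_unit by (simp add: image_Int)
  have sum: "(\<Sum>i\<in>J. y i) = (\<Sum>i\<in>J \<inter> J'. y i)" "(\<Sum>i\<in>J'. y i) = (\<Sum>i\<in>J \<inter> J'. y i)"
    if "\<forall>i. i \<notin> J \<inter> J' \<longrightarrow> y i = 0" for y :: "nat \<Rightarrow> real"
    using that fin fin' by (auto intro!: sum.mono_neutral_right)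
  show "closed_simplex V \<inter> closed_simplex W = closed_simplex (V \<inter> W)"
    unfolding VW unfolding J(1) J'(1) closed_unit_simplex[OF fin] closed_unit_simplex[OF fin']
      closed_unit_simplex[OF finite_Int[OF disjI1[OF fin]]]
  proof (intro subset_antisym subsetI)
    fix y :: "nat \<Rightarrow> real" assume y: "y \<in> {y. (\<forall>i\<in>J. y i \<ge> 0) \<and> (\<forall>i. i \<notin> J \<longrightarrow> y i = 0) \<and> (\<Sum>i\<in>J. y i) = 1} \<inter>
      {y. (\<forall>i\<in>J'. y i \<ge> 0) \<and> (\<forall>i. i \<notin> J' \<longrightarrow> y i = 0) \<and> (\<Sum>i\<in>J'. y i) = 1}"
    then have z: "\<forall>i. i \<notin> J \<inter> J' \<longrightarrow> y i = 0" by blast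
    from sum(1)[OF this] y z
    show "y \<in> {y. (\<forall>i\<in>J \<inter> J'. y i \<ge> 0) \<and> (\<forall>i. i \<notin> J \<inter> J' \<longrightarrow> y i = 0) \<and> (\<Sum>i\<in>J \<inter> J'. y i) = 1}"
      by simp
  next
    fix y :: "nat \<Rightarrow> real" assume y: "y \<in> {y. (\<forall>i\<in>J \<inter> J'. y i \<ge> 0) \<and> (\<forall>i. i \<notin> J \<inter> J' \<longrightarrow> y i = 0) \<and> (\<Sum>i\<in>J \<inter> J'. y i) = 1}"
    then have z: "\<forall>i. i \<notin> J \<inter> J' \<longrightarrow> y i = 0" by blast
    have "y i \<ge> 0" for i using y z by (cases "i \<in> J \<inter> J'") auto
    with sum[OF z] y z show "y \<in> {y. (\<forall>i\<in>J. y i \<ge> 0) \<and> (\<forall>i. i \<notin> J \<longrightarrow> y i = 0) \<and> (\<Sum>i\<in>J. y i) = 1} \<inter>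
      {y. (\<forall>i\<in>J'. y i \<ge> 0) \<and> (\<forall>i. i \<notin> J' \<longrightarrow> y i = 0) \<and> (\<Sum>i\<in>J'. y i) = 1}" by simp
  qed
qed

text \<open>Homogeneous coordinates: \<open>(1, u)\<close> divided by its sum and placed at the
  positions from \<open>b\<close> to \<open>b + k\<close>, which maps \<open>pos k\<close> onto an
  open face.\<close>

definition bary :: "nat \<Rightarrow> nat \<Rightarrow> (nat \<Rightarrow> real) \<Rightarrow> nat \<Rightarrow> real" where
  "bary b k u i = (if i \<in> {b..b + k} then (if i = b then 1 else u (i - b - 1)) / (1 + (\<Sum>j<k. u j)) else 0)"

lemma bij_betw_bary: "bij_betw (bary b k) (pos k) (open_simplex (unit ` {b..b + k}))"
proof -
  have set: "{b..b + k} = insert b ((\<lambda>j. b + 1 + j) ` {..<k})"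
  proof (intro subset_antisym subsetI)
    fix i assume "i \<in> {b..b + k}"
    then show "i \<in> insert b ((\<lambda>j. b + 1 + j) ` {..<k})"
      by (cases "i = b") (auto intro!: image_eqI[of _ _ "i - b - 1"])
  qed auto
  have sum: "(\<Sum>i\<in>{b..b + k}. y i) = y b + (\<Sum>j<k. y (b + 1 + j))" for y :: "nat \<Rightarrow> real"
    unfolding set by (subst sum.insert) (auto simp: sum.reindex inj_on_def)
  have tot: "1 + (\<Sum>j<k. u j) > 0" if "u \<in> pos k" for u
  proof -
    have "(\<Sum>j<k. u j) \<ge> 0" using that by (intro sum_nonneg) (auto simp: pos_def less_imp_le)
    then show ?thesis by linarith
  qed
  have b0: "bary b k u b = 1 / (1 + (\<Sum>j<k. u j))" for u by (simp add: bary_def)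
  have bj: "bary b k u (b + 1 + j) = u j / (1 + (\<Sum>j<k. u j))" if "j < k" for u j
    using that by (simp add: bary_def)
  show ?thesis
    unfolding bij_betw_def open_unit_simplex[OF finite_atLeastAtMost]
  proof (intro conjI inj_onI subset_antisym subsetI)
    fix u u' assume u: "u \<in> pos k" "u' \<in> pos k" "bary b k u = bary b k u'"
    have "1 / (1 + (\<Sum>j<k. u j)) = 1 / (1 + (\<Sum>j<k. u' j))" using b0 u(3) by metis
    then have eq: "1 + (\<Sum>j<k. u j) = 1 + (\<Sum>j<k. u' j)" using tot[OF u(1)] tot[OF u(2)] by simp
    have "u j = u' j" for j
    proof (cases "j < k")
      case True
      then have "u j / (1 + (\<Sum>j<k. u j)) = u' j / (1 + (\<Sum>j<k. u' j))" using bj u(3) by metis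
      then show ?thesis using eq tot[OF u(1)] by simp
    next
      case False
      then show ?thesis using u(1,2) by (simp add: pos_def RR_iff)
    qed
    then show "u = u'" by blast
  next
    fix y assume "y \<in> bary b k ` pos k"
    then obtain u where u: "u \<in> pos k" "y = bary b k u" by blast
    have "y i > 0" if "i \<in> {b..b + k}" for i
    proof -
      have "i = b \<or> i - b - 1 < k" using that by auto
      then have "i = b \<or> u (i - b - 1) > 0" using u(1) unfolding pos_def by blast
      then show ?thesis using tot[OF u(1)] that unfolding u(2) bary_def by auto
    qed
    moreover have "y i = 0" if "i \<notin> {b..b + k}" for i unfolding u(2) bary_def by (rule if_not_P[OF that])
    moreover have "(\<Sum>i\<in>{b..b + k}. y i) = 1"
    proof -
      have "(\<Sum>j<k. bary b k u (b + 1 + j)) = (\<Sum>j<k. u j / (1 + (\<Sum>j<k. u j)))"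
        by (rule sum.cong[OF refl], rule bj) simp
      then have "(\<Sum>i\<in>{b..b + k}. y i) = 1 / (1 + (\<Sum>j<k. u j)) + (\<Sum>j<k. u j / (1 + (\<Sum>j<k. u j)))"
        unfolding sum u(2) b0 by simp
      also have "\<dots> = 1" using tot[OF u(1)] by (simp add: sum_divide_distrib[symmetric] add_divide_distrib[symmetric])
      finally show ?thesis .
    qed
    ultimately show "y \<in> {y. (\<forall>i\<in>{b..b + k}. 0 < y i) \<and> (\<forall>i. i \<notin> {b..b + k} \<longrightarrow> y i = 0) \<and> sum y {b..b + k} = 1}"
      by blast
  next
    fix y :: "nat \<Rightarrow> real" assume "y \<in> {y. (\<forall>i\<in>{b..b + k}. 0 < y i) \<and> (\<forall>i. i \<notin> {b..b + k} \<longrightarrow> y i = 0) \<and> sum y {b..b + k} = 1}"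
    then have y: "\<And>i. i \<in> {b..b + k} \<Longrightarrow> 0 < y i" "\<And>i. i \<notin> {b..b + k} \<Longrightarrow> y i = 0"
      "y b + (\<Sum>j<k. y (b + 1 + j)) = 1"
      using sum[of y] by auto
    have yb: "y b > 0" using y(1) by simp
    \<comment> \<open>Dividing by the coordinate at \<open>b\<close> restores the entry
      \<open>1\<close> and so undoes the normalisation.\<close>
    define u where "u = cut k (\<lambda>j. y (b + 1 + j) / y b)"
    have "u \<in> pos k" using yb y(1) unfolding pos_def u_def by (auto simp: cut_def RR_iff)
    have "(\<Sum>j<k. u j) = (\<Sum>j<k. y (b + 1 + j)) / y b"
      by (simp add: u_def cut_def sum_divide_distrib)
    then have t: "1 + (\<Sum>j<k. u j) = 1 / y b" using y(3) yb by (simp add: field_simps)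
    have "y i = bary b k u i" for i
    proof -
      consider "i \<notin> {b..b + k}" | "i = b" | "b < i" "i - b - 1 < k" "b + 1 + (i - b - 1) = i"
        by fastforce
      then show ?thesis
      proof cases
        case 1
        show ?thesis unfolding bary_def if_not_P[OF 1] by (rule y(2)[OF 1])
      next
        case 2
        then show ?thesis using b0 t by simp
      next
        case 3
        have "bary b k u i = u (i - b - 1) / (1 + (\<Sum>j<k. u j))" using bj[OF 3(2)] 3(3) by simp
        also have "\<dots> = y i" unfolding t using 3 yb by (simp add: u_def cut_def)
        finally show ?thesis by simp
      qed
    qed
    then have "y = bary b k u" by blast
    with \<open>u \<in> pos k\<close> show "y \<in> bary b k ` pos k" by blast
  qed
qed

section \<open>Existence and computation of the Euler characteristic\<close>

context o_minimal_structure
begin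

text \<open>Every cell receives its own block of vertices of one large standard simplex, so that
  faces carrying different cells share no vertex and their open faces are disjoint.\<close>

lemma has_euler_char_exists:
  assumes X: "dpred X"
  shows "\<exists>k. has_euler_char \<O> n {x \<in> RR n. X x} k"
proof -
  let ?S = "{x \<in> RR n. X x}"
  obtain C where "finite C" "disjoint C" "\<Union>C = ?S" "\<forall>c\<in>C. cell n c"
    using cellular_definable[OF X, of n] unfolding cellular_def by (elim exE conjE)
  note C = this(1-3) bspec[OF this(4)]
  define Q where "Q c P \<phi> k \<longleftrightarrow> dpred P \<and> dseq \<phi> \<and> c = {x \<in> RR n. P x} \<and> bij_betw \<phi> c (pos k)"
    for c P \<phi> k
  have "\<forall>c\<in>C. \<exists>P \<phi> k. Q c P \<phi> k"
    unfolding Q_def using C(4)[unfolded cell_def] by (intro ballI)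
  then obtain P \<phi> k where "\<And>c. c \<in> C \<Longrightarrow> Q c (P c) (\<phi> c) (k c)" by metis
  then have P: "dpred (P c)" "dseq (\<phi> c)" "c = {x \<in> RR n. P c x}" "bij_betw (\<phi> c) c (pos (k c))"
    if "c \<in> C" for c using that unfolding Q_def by - (drule meta_spec, drule meta_mp, assumption, elim conjE, assumption)+
  obtain h where h: "bij_betw h C {0..<card C}" using ex_bij_betw_finite_nat[OF C(1)] by blast
  \<comment> \<open>The block length: a face of dimension \<open>k c\<close> needs
    \<open>k c + 1 \<le> K\<close> vertices. The block of \<open>c\<close> starts at
    \<open>h c * K\<close>, and division by \<open>K\<close> recovers the number of the
    cell.\<close>
  define K where "K = Suc (\<Sum>c\<in>C. k c)"
  have kK: "k c < K" if "c \<in> C" for c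
    using member_le_sum[of c C k] that C(1) by (simp add: K_def)
  define M where "M = card C * K"
  define I where "I c = {h c * K..h c * K + k c}" for c
  have I_div: "i div K = h c" if "c \<in> C" "i \<in> I c" for c i
  proof -
    have "h c * K \<le> i" "i < Suc (h c) * K" using that kK[OF that(1)] by (auto simp: I_def)
    then show ?thesis by (intro div_nat_eqI) (auto simp: mult.commute)
  qed
  have I_M: "I c \<subseteq> {..<M}" if "c \<in> C" for c
  proof
    fix i assume i: "i \<in> I c"
    have "h c < card C" using h that bij_betwE by fastforce
    then have "Suc (h c) * K \<le> M" unfolding M_def by (intro mult_right_mono) auto
    moreover have "i < Suc (h c) * K" using i kK[OF that] by (simp add: I_def)
    ultimately show "i \<in> {..<M}" by simp
  qed
  have I_ne: "h c * K \<in> I c" and I_fin: "finite (I c)" for c by (auto simp: I_def)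
  have I_disj: "c = d" if "c \<in> C" "d \<in> C" "i \<in> I c" "i \<in> I d" for c d i
  proof -
    have "h c = h d" using I_div[OF that(1,3)] I_div[OF that(2,4)] by simp
    then show ?thesis using h that(1,2) unfolding bij_betw_def inj_on_def by blast
  qed
  define T where "T = (\<lambda>c. unit ` I c) ` C"
  have TK: "T \<subseteq> {unit ` J | J. J \<subseteq> {..<M} \<and> J \<noteq> {}}"
  proof
    fix V assume "V \<in> T"
    then obtain c where "c \<in> C" "V = unit ` I c" unfolding T_def by blast
    then show "V \<in> {unit ` J | J. J \<subseteq> {..<M} \<and> J \<noteq> {}}" using I_M I_ne by blast
  qed
  define Y where "Y = (\<Union>V\<in>T. open_simplex V)"
  \<comment> \<open>One definable formula for all cells; at most one summand is active because the
    cells are disjoint.\<close>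
  define \<Phi> where "\<Phi> x i = (\<Sum>c\<in>C. if P c x then bary (h c * K) (k c) (\<phi> c x) i else 0)" for x i
  have \<Phi>: "\<Phi> x = bary (h c * K) (k c) (\<phi> c x)" if "c \<in> C" "x \<in> c" for c x
  proof
    fix i
    have x: "x \<in> RR n" using P(3)[OF that(1)] that(2) by blast
    have uniq: "P d x \<longleftrightarrow> d = c" if "d \<in> C" for d
    proof -
      have "P d x \<longleftrightarrow> x \<in> d" using P(3)[OF that] x by blast
      then show ?thesis using C(2) \<open>c \<in> C\<close> \<open>x \<in> c\<close> that unfolding disjoint_def by blast
    qed
    have "\<Phi> x i = (\<Sum>d\<in>C. if d = c then bary (h d * K) (k d) (\<phi> d x) i else 0)"
      unfolding \<Phi>_def by (rule sum.cong) (simp_all add: uniq)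
    then show "\<Phi> x i = bary (h c * K) (k c) (\<phi> c x) i" using C(1) that(1) by simp
  qed
  have "bij_betw \<Phi> (\<Union>c\<in>C. c) (\<Union>c\<in>C. open_simplex (unit ` I c))"
  proof (rule bij_betw_UNION_disjoint)
    show "disjoint_family_on (\<lambda>c. open_simplex (unit ` I c)) C"
      unfolding disjoint_family_on_def
    proof (intro ballI impI)
      fix c d assume cd: "c \<in> C" "d \<in> C" "c \<noteq> d"
      have "y \<notin> open_simplex (unit ` I d)" if "y \<in> open_simplex (unit ` I c)" for y
      proof
        assume "y \<in> open_simplex (unit ` I d)"
        moreover have "h c * K \<notin> I d" using I_disj[OF cd(1,2) I_ne] cd(3) by blast
        ultimately have "y (h c * K) = 0" unfolding open_unit_simplex[OF I_fin] by blast
        moreover have "y (h c * K) > 0" using that I_ne unfolding open_unit_simplex[OF I_fin] by blast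
        ultimately show False by simp
      qed
      then show "open_simplex (unit ` I c) \<inter> open_simplex (unit ` I d) = {}" by blast
    qed
    fix c assume c: "c \<in> C"
    have "bij_betw (bary (h c * K) (k c) \<circ> \<phi> c) c (open_simplex (unit ` I c))"
      unfolding I_def by (rule bij_betw_trans[OF P(4)[OF c] bij_betw_bary])
    then show "bij_betw \<Phi> c (open_simplex (unit ` I c))"
      by (rule bij_betw_cong[THEN iffD1, rotated]) (simp add: \<Phi>[OF c])
  qed
  then have bij: "bij_betw \<Phi> ?S Y" unfolding Y_def T_def using C(3) by simp
  have Y_eq: "Y = {y \<in> RR M. \<exists>c\<in>C. (\<forall>i\<in>I c. y i > 0) \<and> (\<forall>i\<in>{..<M} - I c. y i = 0) \<and> (\<Sum>i\<in>I c. y i) = 1}"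
  proof -
    have "(\<forall>i. i \<notin> I c \<longrightarrow> y i = 0) \<longleftrightarrow> y \<in> RR M \<and> (\<forall>i\<in>{..<M} - I c. y i = 0)" if "c \<in> C" for c and y :: "nat \<Rightarrow> real"
      using I_M[OF that] unfolding RR_iff by (meson DiffD2 DiffI lessThan_iff not_le subsetD)
    then have *: "y \<in> open_simplex (unit ` I c) \<longleftrightarrow> y \<in> RR M \<and> (\<forall>i\<in>I c. y i > 0) \<and>
        (\<forall>i\<in>{..<M} - I c. y i = 0) \<and> (\<Sum>i\<in>I c. y i) = 1" if "c \<in> C" for c y
      unfolding open_unit_simplex[OF I_fin] using that by blast
    have "y \<in> Y \<longleftrightarrow> (\<exists>c\<in>C. y \<in> open_simplex (unit ` I c))" for y unfolding Y_def T_def by blast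
    then show ?thesis using * by blast
  qed
  have YO: "Y \<in> \<O> M"
    unfolding Y_eq using C(1) by (intro dpred_in dpred_intros I_fin) simp_all
  have d\<Phi>: "dfun (\<lambda>x. \<Phi> x i)" for i
  proof -
    have "dfun (\<lambda>x. bary (h c * K) (k c) (\<phi> c x) i)" if "c \<in> C" for c
    proof (cases "i \<in> {h c * K..h c * K + k c}")
      case True
      then show ?thesis unfolding bary_def if_P[OF True]
        by (cases "i = h c * K") (auto intro!: dpred_intros dseq_nth[OF P(2)[OF that]])
    next
      case False
      show ?thesis unfolding bary_def if_not_P[OF False] by (rule dfun_const)
    qed
    then show ?thesis unfolding \<Phi>_def using P(1) C(1) by (intro dfun_sum dfun_if dfun_const) auto
  qed
  have Y_RR: "Y \<subseteq> RR M" using YO subset by blast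
  have img: "\<Phi> x \<in> Y" if "x \<in> ?S" for x using bij that bij_betwE by blast
  have "{cat n x (\<Phi> x) |x. x \<in> ?S} = {s \<in> RR (n + M). X (cut n s) \<and> (\<forall>i\<in>{..<M}. s (n + i) = \<Phi> (cut n s) i)}"
    (is "_ = ?G")
  proof (intro subset_antisym subsetI)
    fix s assume "s \<in> {cat n x (\<Phi> x) |x. x \<in> ?S}"
    then obtain x where x: "s = cat n x (\<Phi> x)" "x \<in> ?S" by blast
    have "\<Phi> x \<in> RR M" using img[OF x(2)] Y_RR by blast
    moreover have "cut n s = x" using x by (auto simp: fun_eq_iff cut_def cat_def RR_iff)
    moreover have "s (n + i) = \<Phi> x i" for i by (simp add: x(1) cat_def)
    ultimately show "s \<in> ?G" using x cat_in_RR by auto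
  next
    fix s assume s: "s \<in> ?G"
    then have x: "cut n s \<in> ?S" by simp
    have R: "\<Phi> (cut n s) \<in> RR M" using img[OF x] Y_RR by blast
    have "s i = cat n (cut n s) (\<Phi> (cut n s)) i" for i
    proof -
      consider "i < n" | j where "i = n + j" "j < M" | j where "i = n + j" "j \<ge> M"
        by (metis le_Suc_ex not_le)
      then show ?thesis using s R by cases (auto simp: cat_def cut_def RR_iff)
    qed
    then have "s = cat n (cut n s) (\<Phi> (cut n s))" by blast
    with x show "s \<in> {cat n x (\<Phi> x) |x. x \<in> ?S}" by blast
  qed
  moreover have "?G \<in> \<O> (n + M)"
    by (intro dpred_in dpred_intros dpred_comp[OF X] dfun_comp[OF d\<Phi>]) simp
  ultimately have "definable_map \<O> n ?S M Y \<Phi>"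
    unfolding definable_map_def using dpred_in[OF X] YO img by simp
  then show ?thesis
    unfolding has_euler_char_def using standard_complex[of M] TK bij unfolding Y_def by blast
qed

theorem euler_char_EI:
  assumes "dpred X"
  shows "euler_char \<O> n {x \<in> RR n. X x} = EI n (\<lambda>x. of_bool (X x))"
proof -
  let ?S = "{x \<in> RR n. X x}"
  obtain k where k: "has_euler_char \<O> n ?S k" using has_euler_char_exists[OF assms] by blast
  have "euler_char \<O> n ?S = k"
    unfolding euler_char_def using k has_euler_char_EI[of n ?S] by (intro the_equality) auto
  also have "k = EI n (\<lambda>x. of_bool (x \<in> ?S))" by (rule has_euler_char_EI[OF k])
  also have "\<dots> = EI n (\<lambda>x. of_bool (X x))" by (rule EI_cong) simp
  finally show ?thesis .
qed

end

subsection \<open>The Radon transform of a bounded definable set\<close>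

definition dot :: "nat \<Rightarrow> (nat \<Rightarrow> real) \<Rightarrow> (nat \<Rightarrow> real) \<Rightarrow> real" where
  "dot d x v = (\<Sum>i<d. x i * v i)"

lemma dot_scale: "dot d x (\<lambda>i. r * v i) = r * dot d x v"
  by (simp add: dot_def sum_distrib_left mult.left_commute)

lemma dot_zero: "\<forall>i<d. v i = 0 \<Longrightarrow> dot d x v = 0"
  by (simp add: dot_def)

context o_minimal_structure
begin

lemma dfun_dot: "dseq w \<Longrightarrow> dseq v \<Longrightarrow> dfun (\<lambda>s. dot d (w s) (v s))"
  unfolding dot_def by (intro dfun_sum dfun_mult dseq_nth) simp_all

text \<open>For fixed \<open>x\<close> the vectors orthogonal to \<open>x - a\<close> form a
  hyperplane, of Euler characteristic \<open>(- 1) ^ (d - 1)\<close>, unless \<open>x = a\<close>,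
  when they fill the space and the sign is opposite. This change of sign at a single point produces
  the term with factor \<open>2\<close>.\<close>

lemma EI_hyperplanes_through_point:
  assumes A: "dpred A" and a: "a \<in> RR d" and d: "d \<ge> 1"
  shows "EI d (\<lambda>v. EI d (\<lambda>x. of_bool (A x \<and> dot d x v = dot d a v))) =
    (- 1) ^ (d - 1) * (EI d (\<lambda>x. of_bool (A x)) - 2 * of_bool (A a))"
proof -
  have "cfun2 (\<lambda>v x. of_bool (A x \<and> dot d x v = dot d a v) :: int)"
    unfolding cfun2_def
    by (intro cfun_of_bool dpred_conj dpred_eq dpred_reindex[OF A] dfun_dot dseq_lambda dfun_var dseq_const)
  from EI_swap[OF this]
  have "EI d (\<lambda>v. EI d (\<lambda>x. of_bool (A x \<and> dot d x v = dot d a v))) =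
    EI d (\<lambda>x. EI d (\<lambda>v. of_bool (A x \<and> dot d x v = dot d a v)))" .
  also have "\<dots> = EI d (\<lambda>x. (- 1) ^ (d - 1) * (of_bool (A x) - 2 * of_bool (A x \<and> (\<forall>i\<in>{..<d}. x i = a i))))"
  proof (rule EI_cong)
    fix x assume "x \<in> RR d"
    have eq: "dot d x v = dot d a v \<longleftrightarrow> (\<Sum>i<d. (x i - a i) * v i) = 0" for v
      by (simp add: dot_def left_diff_distrib sum_subtractf)
    \<comment> \<open>As \<open>d\<close> is positive, \<open>(- 1) ^ d\<close> is
      \<open>- (- 1) ^ (d - 1)\<close>.\<close>
    obtain m where m: "d = Suc m" using d by (cases d) auto
    have "EI d (\<lambda>v. of_bool (dot d x v = dot d a v)) =
        (- 1) ^ (d - 1) * (1 - 2 * of_bool (\<forall>i\<in>{..<d}. x i = a i))"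
      unfolding eq EI_hyperplane by (auto simp: m)
    then show "EI d (\<lambda>v. of_bool (A x \<and> dot d x v = dot d a v)) =
        (- 1) ^ (d - 1) * (of_bool (A x) - 2 * of_bool (A x \<and> (\<forall>i\<in>{..<d}. x i = a i)))"
      by (cases "A x") simp_all
  qed
  also have "\<dots> = (- 1) ^ (d - 1) * (EI d (\<lambda>x. of_bool (A x)) -
      2 * EI d (\<lambda>x. of_bool (A x \<and> (\<forall>i\<in>{..<d}. x i = a i))))"
  proof -
    have c: "cfun (\<lambda>x. of_bool (A x) :: int)" "cfun (\<lambda>x. of_bool (A x \<and> (\<forall>i\<in>{..<d}. x i = a i)) :: int)"
      by (intro cfun_of_bool A dpred_intros; simp)+
    then have c2: "cfun (\<lambda>x. 2 * of_bool (A x \<and> (\<forall>i\<in>{..<d}. x i = a i)) :: int)"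
      by (intro cfun_mult cfun_const)
    show ?thesis
      by (simp only: EI_cmult[OF cfun_diff[OF c(1) c2]] EI_diff[OF c(1) c2] EI_cmult[OF c(2)])
  qed
  also have "EI d (\<lambda>x. of_bool (A x \<and> (\<forall>i\<in>{..<d}. x i = a i))) = of_bool (A a)"
  proof -
    have eq: "(\<forall>i\<in>{..<d}. x i = a i) \<longleftrightarrow> x = a" if "x \<in> RR d" for x
      using that a unfolding RR_iff fun_eq_iff by (metis lessThan_iff not_le)
    have "EI d (\<lambda>x. of_bool (A x \<and> (\<forall>i\<in>{..<d}. x i = a i))) = EI d (\<lambda>x. of_bool (A a) * of_bool (x = a))"
      by (rule EI_cong) (auto simp: eq)
    also have "\<dots> = of_bool (A a)" by (cases "A a") (simp_all add: EI_point[OF a])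
    finally show ?thesis .
  qed
  finally show ?thesis .
qed

text \<open>Half-spaces determine hyperplanes by inclusion-exclusion, and all hyperplanes through \<open>a\<close>
  together see \<open>a\<close> with a different Euler characteristic than any other point.\<close>

theorem half_spaces_determine_set:
  assumes A: "dpred A" and B: "dpred B" and d: "d \<ge> 1"
    and bounded: "\<And>x. x \<in> RR d \<Longrightarrow> A x \<or> B x \<Longrightarrow> x 0 \<le> m"
    and half: "\<And>v h. v \<in> RR d \<Longrightarrow> (\<Sum>i<d. (v i)\<^sup>2) = 1 \<Longrightarrow>
      EI d (\<lambda>x. of_bool (A x \<and> dot d x v \<le> h)) = EI d (\<lambda>x. of_bool (B x \<and> dot d x v \<le> h))"
    and a: "a \<in> RR d"
  shows "A a \<longleftrightarrow> B a"
proof -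
  \<comment> \<open>The first unit vector: the half-space at height \<open>m\<close> in its
    direction contains both sets, so their total Euler characteristics are among the given
    data.\<close>
  define u :: "nat \<Rightarrow> real" where "u i = (if i = 0 then 1 else 0)" for i
  have u_RR: "u \<in> RR d" using d by (simp add: RR_iff u_def)
  have u: "(\<Sum>i<d. (u i)\<^sup>2) = 1" "dot d x u = x 0" for x
  proof -
    have "(\<Sum>i<d. (u i)\<^sup>2) = (\<Sum>i<d. if i = 0 then 1 else 0)" by (rule sum.cong) (auto simp: u_def)
    then show "(\<Sum>i<d. (u i)\<^sup>2) = 1" using d by simp
    have "dot d x u = (\<Sum>i<d. if i = 0 then x i else 0)"
      unfolding dot_def by (rule sum.cong) (auto simp: u_def)
    then show "dot d x u = x 0" using d by simp
  qed
  have all: "EI d (\<lambda>x. of_bool (P x)) = EI d (\<lambda>x. of_bool (P x \<and> dot d x u \<le> m))"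
    if "P = A \<or> P = B" for P
    using bounded that by (intro EI_cong) (auto simp: u)
  have total: "EI d (\<lambda>x. of_bool (A x)) = EI d (\<lambda>x. of_bool (B x))"
    using half[OF u_RR u(1), of m] all[of A] all[of B] by simp
  \<comment> \<open>The closed half-spaces for \<open>(v, h)\<close> and \<open>(- v, - h)\<close>
    cover the space and meet in the hyperplane.\<close>
  have plane: "EI d (\<lambda>x. of_bool (P x \<and> dot d x v = h)) = EI d (\<lambda>x. of_bool (P x \<and> dot d x v \<le> h)) +
      EI d (\<lambda>x. of_bool (P x \<and> dot d x (\<lambda>i. - 1 * v i) \<le> - h)) - EI d (\<lambda>x. of_bool (P x))"
    if P: "dpred P" for P v h
  proof -
    have c: "cfun (\<lambda>x. of_bool (P x \<and> dot d x w \<le> k) :: int)" "cfun (\<lambda>x. of_bool (P x) :: int)" for w k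
      by (intro cfun_of_bool dpred_conj P dpred_le dfun_dot dseq_id dseq_const dfun_const)+
    have "of_bool (P x \<and> dot d x v = h) = of_bool (P x \<and> dot d x v \<le> h) +
        of_bool (P x \<and> dot d x (\<lambda>i. - 1 * v i) \<le> - h) - (of_bool (P x) :: int)" for x
      unfolding dot_scale by auto
    then show ?thesis
      by (simp only: EI_diff[OF cfun_add[OF c(1) c(1)] c(2)] EI_add[OF c(1) c(1)])
  qed
  have unit_plane: "EI d (\<lambda>x. of_bool (A x \<and> dot d x v = h)) = EI d (\<lambda>x. of_bool (B x \<and> dot d x v = h))"
    if v: "v \<in> RR d" "(\<Sum>i<d. (v i)\<^sup>2) = 1" for v h
  proof -
    have "(\<lambda>i. - 1 * v i) \<in> RR d" "(\<Sum>i<d. (- 1 * v i)\<^sup>2) = 1" using v by (simp_all add: RR_iff)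
    from half[OF this, of "- h"] half[OF v, of h] total show ?thesis
      unfolding plane[OF A] plane[OF B] by simp
  qed
  have "EI d (\<lambda>x. of_bool (A x \<and> dot d x v = dot d a v)) = EI d (\<lambda>x. of_bool (B x \<and> dot d x v = dot d a v))"
    if v: "v \<in> RR d" for v
  proof (cases "\<forall>i<d. v i = 0")
    \<comment> \<open>The integral over all \<open>v\<close> includes \<open>v = 0\<close>, where
      the equation is vacuous and the totals are compared.\<close>
    case True
    then show ?thesis using total by (simp add: dot_zero)
  next
    case False
    then obtain j where j: "j < d" "v j \<noteq> 0" by blast
    \<comment> \<open>Scaling \<open>v\<close> and the height by the same positive factor leaves the
      hyperplane unchanged.\<close>
    define r where "r = 1 / sqrt (\<Sum>i<d. (v i)\<^sup>2)"
    have "0 < (v j)\<^sup>2" using j(2) by simp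
    also have "\<dots> \<le> (\<Sum>i<d. (v i)\<^sup>2)" using j(1) by (intro member_le_sum) auto
    finally have s: "0 < (\<Sum>i<d. (v i)\<^sup>2)" .
    then have r: "r > 0" by (simp add: r_def)
    have "(\<Sum>i<d. (r * v i)\<^sup>2) = r\<^sup>2 * (\<Sum>i<d. (v i)\<^sup>2)"
      by (simp add: power_mult_distrib sum_distrib_left)
    also have "\<dots> = 1" using s by (simp add: r_def power_divide)
    finally have "(\<Sum>i<d. (r * v i)\<^sup>2) = 1" .
    moreover have "(\<lambda>i. r * v i) \<in> RR d" using v by (simp add: RR_iff)
    ultimately have "EI d (\<lambda>x. of_bool (A x \<and> dot d x (\<lambda>i. r * v i) = r * dot d a v)) =
      EI d (\<lambda>x. of_bool (B x \<and> dot d x (\<lambda>i. r * v i) = r * dot d a v))"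
      by (intro unit_plane)
    then show ?thesis unfolding dot_scale using r by simp
  qed
  then have "EI d (\<lambda>v. EI d (\<lambda>x. of_bool (A x \<and> dot d x v = dot d a v))) =
      EI d (\<lambda>v. EI d (\<lambda>x. of_bool (B x \<and> dot d x v = dot d a v)))"
    by (rule EI_cong)
  then have "of_bool (A a) = (of_bool (B a) :: int)"
    unfolding EI_hyperplanes_through_point[OF A a d] EI_hyperplanes_through_point[OF B a d] total by simp
  then show ?thesis by (simp only: of_bool_eq_iff)
qed

subsection \<open>The transform\<close>

lemma dfun_of_definable_map:
  assumes f: "definable_map \<O> d (RR d) 1 (RR 1) (\<lambda>x. pt (f x))"
  shows "dfun (\<lambda>x. f (cut d x))"
proof -
  let ?\<Gamma> = "{cat d x (pt (f x)) |x. x \<in> RR d}"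
  have \<Gamma>: "?\<Gamma> \<in> \<O> (d + 1)" using f unfolding definable_map_def by blast
  show ?thesis
  proof (rule dfunI[where R = "\<lambda>x y. cut (d + 1) (cat d x (pt y)) \<in> ?\<Gamma>"])
    have "dfun (\<lambda>s. cat d (\<lambda>i. s (Suc i)) (pt (s 0)) i)" for i
      unfolding cat_def pt_def by (cases "i < d"; cases "i - d = 0") (simp_all add: dfun_var dfun_const)
    then have "dseq (\<lambda>s. cat d (\<lambda>i. s (Suc i)) (pt (s 0)))" by (simp add: dseq_def)
    from dpred_comp[OF dpred_set[OF \<Gamma>] this]
    show "dpred (\<lambda>s. cut (d + 1) (cat d (\<lambda>i. s (Suc i)) (pt (s 0))) \<in> ?\<Gamma>)" .
    fix x y
    have cut: "cut (d + 1) (cat d x (pt y)) = cat d (cut d x) (pt y)"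
      by (auto simp: cut_def cat_def pt_def fun_eq_iff)
    have "pt y = pt y' \<longleftrightarrow> y = y'" for y y' unfolding pt_def fun_eq_iff by metis
    then have "cat d (cut d x) (pt y) = cat d x' (pt (f x')) \<longleftrightarrow> cut d x = x' \<and> y = f x'"
      if "x' \<in> RR d" for x' using cat_eq_iff[OF cut_in_RR that] by simp
    then show "cut (d + 1) (cat d x (pt y)) \<in> ?\<Gamma> \<longleftrightarrow> y = f (cut d x)"
      unfolding cut mem_Collect_eq using cut_in_RR[of d x] by blast
  qed
qed

end

lemma select_domain_eq:
  assumes "d \<ge> 1"
  shows "select_domain d = {p \<in> RR (d + 2). (\<Sum>i<d. (p i)\<^sup>2) = 1}"
proof -
  have sph: "topspace (nsphere (d - 1)) = {v \<in> RR d. (\<Sum>i<d. (v i)\<^sup>2) = 1}"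
  proof -
    have "{..d - 1} = {..<d}" using assms by auto
    then show ?thesis using assms unfolding nsphere_def by auto
  qed
  show ?thesis
    unfolding select_domain_def prodR_def sph
  proof (intro subset_antisym subsetI)
    fix p
    assume "p \<in> {cat d v q |v q. v \<in> {v \<in> RR d. (\<Sum>i<d. (v i)\<^sup>2) = 1} \<and>
      q \<in> {cat 1 y z |y z. y \<in> RR 1 \<and> z \<in> RR 1}}"
    then obtain v y z where p: "p = cat d v (cat 1 y z)" "(\<Sum>i<d. (v i)\<^sup>2) = 1" "z \<in> RR 1" by blast
    have "(\<Sum>i<d. (p i)\<^sup>2) = (\<Sum>i<d. (v i)\<^sup>2)" by (rule sum.cong) (auto simp: p(1) cat_def)
    moreover have "p \<in> RR (d + (1 + 1))" unfolding p(1) by (intro cat_in_RR p(3))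
    ultimately show "p \<in> {p \<in> RR (d + 2). (\<Sum>i<d. (p i)\<^sup>2) = 1}" using p(2) by (simp add: numeral_2_eq_2)
  next
    fix p assume p: "p \<in> {p \<in> RR (d + 2). (\<Sum>i<d. (p i)\<^sup>2) = 1}"
    have "p i = cat d (cut d p) (cat 1 (pt (p d)) (pt (p (d + 1)))) i" for i
    proof -
      consider "i < d" | "i = d" | "i = d + 1" | "i \<ge> d + 2" by linarith
      then show ?thesis using p by cases (auto simp: cat_def cut_def pt_def RR_iff)
    qed
    then have "p = cat d (cut d p) (cat 1 (pt (p d)) (pt (p (d + 1))))" by blast
    moreover have "(\<Sum>i<d. (cut d p i)\<^sup>2) = 1" using p by (simp add: cut_def)
    moreover have "pt y \<in> RR 1" for y by (simp add: RR_iff pt_def)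
    ultimately show "p \<in> {cat d v q |v q. v \<in> {v \<in> RR d. (\<Sum>i<d. (v i)\<^sup>2) = 1} \<and>
      q \<in> {cat 1 y z |y z. y \<in> RR 1 \<and> z \<in> RR 1}}" using cut_in_RR by blast
  qed
qed

text \<open>The first coordinate is continuous, so it maps the compact closure of the support to a
  bounded set.\<close>

lemma compact_support_bound:
  assumes "compactin (Euclidean_space d) (Euclidean_space d closure_of {x \<in> RR d. f x \<noteq> (0::real)})"
  shows "\<exists>m. \<forall>x\<in>RR d. f x \<noteq> 0 \<longrightarrow> x 0 \<le> m"
proof -
  let ?S = "{x \<in> RR d. f x \<noteq> 0}"
  have "continuous_map (Euclidean_space d) euclideanreal (\<lambda>x. x 0)"
    unfolding Euclidean_space_def
    by (intro continuous_map_from_subtopology continuous_map_product_projection) simp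
  from image_compactin[OF assms this] have "compact ((\<lambda>x. x 0) ` (Euclidean_space d closure_of ?S))"
    by simp
  then have "bounded ((\<lambda>x. x 0) ` (Euclidean_space d closure_of ?S))" by (rule compact_imp_bounded)
  then obtain b where b: "\<forall>y\<in>(\<lambda>x. x 0) ` (Euclidean_space d closure_of ?S). norm y \<le> b"
    unfolding bounded_iff by blast
  have "?S \<subseteq> Euclidean_space d closure_of ?S" by (rule closure_of_subset) blast
  then have "\<forall>x\<in>RR d. f x \<noteq> 0 \<longrightarrow> x 0 \<le> b"
    using b by (fastforce simp: abs_le_iff)
  then show ?thesis ..
qed

context o_minimal_structure
begin

text \<open>\<open>dot d x p\<close> reads only the first \<open>d\<close> entries of
  \<open>p\<close>, so a point of the domain can stand for its own direction.\<close>

lemma SELECT_EI: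
  assumes f: "f \<in> definable_compact_support \<O> d" and p: "p \<in> select_domain d"
  shows "SELECT \<O> d f p = EI d (\<lambda>x. of_bool (dot d x p \<le> p d \<and> f (cut d x) \<ge> p (d + 1)))"
proof -
  have df: "dfun (\<lambda>x. f (cut d x))"
    using f by (intro dfun_of_definable_map) (simp add: definable_compact_support_def)
  have "{x \<in> RR d. (\<Sum>i<d. x i * (if i < d then p i else 0)) \<le> p d \<and> f x \<ge> p (d + 1)} =
    {x \<in> RR d. dot d x p \<le> p d \<and> f (cut d x) \<ge> p (d + 1)}"
    by (auto simp: dot_def cut_id)
  then have "SELECT \<O> d f p = euler_char \<O> d {x \<in> RR d. dot d x p \<le> p d \<and> f (cut d x) \<ge> p (d + 1)}"
    using p unfolding SELECT_def Let_def by simp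
  also have "\<dots> = EI d (\<lambda>x. of_bool (dot d x p \<le> p d \<and> f (cut d x) \<ge> p (d + 1)))"
    by (intro euler_char_EI dpred_conj dpred_le df dfun_dot dseq_id dseq_const dfun_const)
  finally show ?thesis .
qed

text \<open>As a function of \<open>p\<close> the transform is an iterated integral of a
  constructible indicator, hence constructible; the domain adds a polynomial condition.\<close>

theorem SELECT_in_CF:
  assumes f: "f \<in> definable_compact_support \<O> d" and d: "d \<ge> 1"
  shows "SELECT \<O> d f \<in> CF \<O> (d + 2) (select_domain d)"
proof -
  define F where "F p = EI d (\<lambda>x. of_bool (dot d x p \<le> p d \<and> f (cut d x) \<ge> p (d + 1)))" for p
  have df: "dfun (\<lambda>x. f (cut d x))"
    using f by (intro dfun_of_definable_map) (simp add: definable_compact_support_def)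
  have "cfun2 (\<lambda>p x. of_bool (dot d x p \<le> p d \<and> f (cut d x) \<ge> p (d + 1)) :: int)"
    unfolding cfun2_def
    by (intro cfun_of_bool dpred_conj dpred_le dfun_reindex[OF df] dfun_dot dseq_lambda dfun_var)
  then have F: "cfun F" unfolding F_def by (rule cfun_EI)
  have S: "SELECT \<O> d f p = F p" if "p \<in> select_domain d" for p
    unfolding F_def using SELECT_EI[OF f that] .
  have "{p \<in> select_domain d. SELECT \<O> d f p = k} \<in> \<O> (d + 2)" for k
  proof -
    have "{p \<in> select_domain d. SELECT \<O> d f p = k} = {p \<in> RR (d + 2). (\<Sum>i<d. p i * p i) = 1 \<and> F p = k}"
      using S unfolding select_domain_eq[OF d] by (auto simp: power2_eq_square)
    also have "\<dots> \<in> \<O> (d + 2)"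
      using F unfolding cfun_def by (intro dpred_in dpred_conj dpred_eq dfun_sum dfun_mult dfun_var dfun_const) auto
    finally show ?thesis .
  qed
  moreover have "{k. {p \<in> select_domain d. SELECT \<O> d f p = k} \<noteq> {}} \<subseteq> range F"
    using S by auto
  then have "finite {k. {p \<in> select_domain d. SELECT \<O> d f p = k} \<noteq> {}}"
    using F finite_subset unfolding cfun_def by blast
  moreover have "SELECT \<O> d f \<in> select_domain d \<rightarrow>\<^sub>E UNIV" unfolding SELECT_def by simp
  ultimately show ?thesis unfolding CF_def by simp
qed

theorem SELECT_injective:
  assumes f: "f \<in> definable_compact_support \<O> d" and g: "g \<in> definable_compact_support \<O> d"
    and eq: "SELECT \<O> d f = SELECT \<O> d g" and d: "d \<ge> 1"
  shows "f = g"
proof -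
  have df: "dfun (\<lambda>x. f (cut d x))" and dg: "dfun (\<lambda>x. g (cut d x))"
    using f g by (auto intro!: dfun_of_definable_map simp: definable_compact_support_def)
  obtain m where m: "\<forall>x\<in>RR d. f x \<noteq> 0 \<longrightarrow> x 0 \<le> m"
    using compact_support_bound[of d f] f unfolding definable_compact_support_def by blast
  obtain m' where m': "\<forall>x\<in>RR d. g x \<noteq> 0 \<longrightarrow> x 0 \<le> m'"
    using compact_support_bound[of d g] g unfolding definable_compact_support_def by blast
  have bnd: "x 0 \<le> max m m'" if "x \<in> RR d" "f x \<noteq> 0 \<or> g x \<noteq> 0" for x
    using m m' that by (auto simp: le_max_iff_disj)
  have half: "EI d (\<lambda>x. of_bool (f (cut d x) \<ge> t \<and> dot d x v \<le> h)) = EI d (\<lambda>x. of_bool (g (cut d x) \<ge> t \<and> dot d x v \<le> h))"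
    if v: "v \<in> RR d" "(\<Sum>i<d. (v i)\<^sup>2) = 1" for v h t
  proof -
    define p where "p = cat d v (h ## t ## (\<lambda>_. 0))"
    have pv: "p i = v i" if "i < d" for i using that by (simp add: p_def cat_def)
    have ph: "p d = h" "p (d + 1) = t" by (simp_all add: p_def cat_def)
    have "p \<in> RR (d + Suc (Suc 0))" unfolding p_def by (intro cat_in_RR) (simp add: RR_0)
    moreover have "(\<Sum>i<d. (p i)\<^sup>2) = 1" using v(2) pv by simp
    ultimately have p: "p \<in> select_domain d" unfolding select_domain_eq[OF d] by (simp add: numeral_2_eq_2)
    have "dot d x p = dot d x v" for x using pv by (simp add: dot_def)
    with SELECT_EI[OF f p] SELECT_EI[OF g p] eq show ?thesis
      unfolding ph by (simp add: conj_commute)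
  qed
  have level: "f a \<ge> t \<longleftrightarrow> g a \<ge> t" if a: "a \<in> RR d" for a t
  proof (cases "t > 0")
    case True
    have "f (cut d a) \<ge> t \<longleftrightarrow> g (cut d a) \<ge> t"
    proof (rule half_spaces_determine_set[OF _ _ d _ half a])
      show "dpred (\<lambda>x. f (cut d x) \<ge> t)" "dpred (\<lambda>x. g (cut d x) \<ge> t)"
        by (intro dpred_le df dg dfun_const)+
      show "x 0 \<le> max m m'" if "x \<in> RR d" "f (cut d x) \<ge> t \<or> g (cut d x) \<ge> t" for x
        using that True by (intro bnd) (auto simp: cut_id)
    qed
    then show ?thesis using a by (simp add: cut_id)
  next
    case False
    \<comment> \<open>For \<open>t \<le> 0\<close> a value below \<open>t\<close> is nonzero, so the
      strict sublevel set lies within the bound. Its half-space integrals differ from those of the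
      superlevel set by a term that does not depend on \<open>q\<close>, up to sign.\<close>
    have comp: "EI d (\<lambda>x. of_bool (q (cut d x) < t \<and> dot d x v \<le> h)) =
      EI d (\<lambda>x. of_bool (dot d x v \<le> h)) - EI d (\<lambda>x. of_bool (q (cut d x) \<ge> t \<and> dot d x v \<le> h))"
      if q: "dfun (\<lambda>x. q (cut d x))" for q v h
    proof -
      have "cfun (\<lambda>x. of_bool (dot d x v \<le> h) :: int)"
        "cfun (\<lambda>x. of_bool (q (cut d x) \<ge> t \<and> dot d x v \<le> h) :: int)"
        by (intro cfun_of_bool dpred_conj dpred_le q dfun_dot dseq_id dseq_const dfun_const)+
      note EI_diff[OF this, of d, symmetric]
      moreover have "of_bool (q (cut d x) < t \<and> dot d x v \<le> h) =
        (of_bool (dot d x v \<le> h) - of_bool (q (cut d x) \<ge> t \<and> dot d x v \<le> h) :: int)" for x by auto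
      ultimately show ?thesis by simp
    qed
    have "f (cut d a) < t \<longleftrightarrow> g (cut d a) < t"
    proof (rule half_spaces_determine_set[OF _ _ d _ _ a])
      show "dpred (\<lambda>x. f (cut d x) < t)" "dpred (\<lambda>x. g (cut d x) < t)"
        by (intro dpred_less df dg dfun_const)+
      show "x 0 \<le> max m m'" if "x \<in> RR d" "f (cut d x) < t \<or> g (cut d x) < t" for x
        using that False by (intro bnd) (auto simp: cut_id)
      show "EI d (\<lambda>x. of_bool (f (cut d x) < t \<and> dot d x v \<le> h)) = EI d (\<lambda>x. of_bool (g (cut d x) < t \<and> dot d x v \<le> h))"
        if "v \<in> RR d" "(\<Sum>i<d. (v i)\<^sup>2) = 1" for v h
        unfolding comp[OF df] comp[OF dg] half[OF that] ..
    qed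
    then show ?thesis using a by (simp add: cut_id not_less[symmetric])
  qed
  \<comment> \<open>Equal superlevel sets at the levels \<open>f x\<close> and \<open>g x\<close>
    give the two inequalities.\<close>
  have "f x = g x" if "x \<in> RR d" for x
    using level[OF that, of "f x"] level[OF that, of "g x"] by simp
  moreover have "f \<in> RR d \<rightarrow>\<^sub>E UNIV" "g \<in> RR d \<rightarrow>\<^sub>E UNIV"
    using f g by (simp_all add: definable_compact_support_def)
  ultimately show ?thesis by (intro PiE_ext)
qed

end

theorem theorem2p15:
  fixes \<O> :: "nat \<Rightarrow> (nat \<Rightarrow> real) set set" and d :: nat
  assumes "o_minimal_structure \<O>"
    and "d \<ge> 1"
  shows "SELECT \<O> d \<in> definable_compact_support \<O> d \<rightarrow> CF \<O> (d + 2) (select_domain d)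
    \<and> inj_on (SELECT \<O> d) (definable_compact_support \<O> d)"
proof -
  interpret o_minimal_structure \<O> by fact
  show ?thesis
    using SELECT_in_CF SELECT_injective assms(2) by (blast intro: inj_onI)
qed

end
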